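(* Let $d\ge 1$, let $(G_i)_{i\ge 1}$ be independent standard Gaussian random variables, and consider a sequence $$F_n=\sum_{i_1<\cdots<i_d} a_n(i_1,\dots,i_d)\,G_{i_1}\cdots G_{i_d},\qquad n\in\mathbb N,$$ where for each $n$ only finitely many of the real coefficients $a_n(i_1,\dots,i_d)$ are nonzero and $\mathbf E[F_n^2]=1$. Then the following are equivalent: (i) $(F_n)$ is asymptotically normal, i.e. $F_n$ converges in law to $\mathcal N(0,1)$ as $n\to\infty$; (ii) for some $k\in\{\lfloor d/2\rfloor,\dots,d-1\}$, $\tilde\rho_k(F_n)\to 0$ as $n\to\infty$.
   Context: For $k\in\mathbb N$ and a homogeneous polynomial $F=\sum_{i_1<\cdots<i_d}a_{i_1,\dots,i_d}G_{i_1}\cdots G_{i_d}$ (finitely many nonzero coefficients), the semi-norm $\tilde\rho_k$ is $$\tilde\rho_k(F)=\sup\Big\{\Big\|\sum_{i\ge1}\partial_{G_i}F\,\partial_{G_i}X\Big\|_{L^2}: X=\sum_{i_1<\cdots<i_k}b_{i_1,\dots,i_k}G_{i_1}\cdots G_{i_k},\ \|X\|_{L^2}\le 1\Big\},$$ where $X$ ranges over such sums with finitely many nonzero real coefficients, $\partial_{G_i}$ is the partial derivative with respect to $G_i$, and for $k=0$ the $X$ are constants (so $\tilde\rho_0=0$). *)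

theory Defs
  imports "HOL-Probability.Probability" "HOL-Library.Ramsey"
begin

text \<open>
  An increasing tuple \<open>i\<^sub>1 < \<dots> < i\<^sub>d\<close> of indices \<open>\<ge> 1\<close> is encoded by the \<open>d\<close>-element set
  \<open>{i\<^sub>1, \<dots>, i\<^sub>d}\<close>, i.e. by an element of \<^term>\<open>nsets {1..} d :: nat set set\<close>. A polynomial is
  the function it induces on real sequences.
\<close>

definition fin_coeffs :: "nat \<Rightarrow> (nat set \<Rightarrow> real) \<Rightarrow> bool" where
  "fin_coeffs d a \<longleftrightarrow> finite {I \<in> nsets {1..} d. a I \<noteq> 0}"

definition hom_poly :: "nat \<Rightarrow> (nat set \<Rightarrow> real) \<Rightarrow> (nat \<Rightarrow> real) \<Rightarrow> real" where
  "hom_poly d a x = (\<Sum>I \<in> {I \<in> nsets {1..} d. a I \<noteq> 0}. a I * (\<Prod>i\<in>I. x i))"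

definition partial_deriv :: "nat \<Rightarrow> ((nat \<Rightarrow> real) \<Rightarrow> real) \<Rightarrow> (nat \<Rightarrow> real) \<Rightarrow> real" where
  "partial_deriv i P x = deriv (\<lambda>t. P (x(i := t))) (x i)"

text \<open>
  The sum is infinite only formally: a polynomial with finitely many nonzero coefficients has
  finitely many nonvanishing partial derivatives.
\<close>

definition grad_prod ::
  "((nat \<Rightarrow> real) \<Rightarrow> real) \<Rightarrow> ((nat \<Rightarrow> real) \<Rightarrow> real) \<Rightarrow> (nat \<Rightarrow> real) \<Rightarrow> real" where
  "grad_prod P Q x = (\<Sum>\<^sub>\<infinity>i\<in>{1..}. partial_deriv i P x * partial_deriv i Q x)"

definition at_vars ::
  "(nat \<Rightarrow> 'a \<Rightarrow> real) \<Rightarrow> ((nat \<Rightarrow> real) \<Rightarrow> real) \<Rightarrow> 'a \<Rightarrow> real" where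
  "at_vars G P \<omega> = P (\<lambda>i. G i \<omega>)"

definition L2_norm :: "'a measure \<Rightarrow> ('a \<Rightarrow> real) \<Rightarrow> real" where
  "L2_norm M Y = sqrt (\<integral>\<omega>. (Y \<omega>)\<^sup>2 \<partial>M)"

text \<open>
  The supremum is taken in \<^typ>\<open>ennreal\<close>, where it needs no boundedness side condition.
\<close>

definition rho_tilde ::
  "'a measure \<Rightarrow> (nat \<Rightarrow> 'a \<Rightarrow> real) \<Rightarrow> nat \<Rightarrow> ((nat \<Rightarrow> real) \<Rightarrow> real) \<Rightarrow> ennreal" where
  "rho_tilde M G k P =
     (SUP b \<in> {b. fin_coeffs k b \<and> L2_norm M (at_vars G (hom_poly k b)) \<le> 1}.
        ennreal (L2_norm M (at_vars G (grad_prod P (hom_poly k b)))))"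

end

theory Submission
  imports Defs
begin

text \<open>
  Write \<open>F = \<Sum>\<^sub>I a\<^sub>I G\<^sub>I\<close>, \<open>X = \<Sum>\<^sub>J b\<^sub>J G\<^sub>J\<close> and \<open>\<Gamma>(F, X) = \<Sum>\<^sub>i \<partial>\<^sub>i F \<partial>\<^sub>i X\<close>. Splitting \<open>G\<^sub>i\<^sup>2 = 1 + (G\<^sub>i\<^sup>2 - 1)\<close> gives
  \<open>F X = \<Sum>\<^sub>c Y\<^sub>c\<close> and \<open>\<Gamma>(F, X) = \<Sum>\<^sub>c c Y\<^sub>c\<close>, where \<open>Y\<^sub>c\<close> is built from the order-\<open>c\<close> contraction of the
  coefficients and the \<open>Y\<^sub>c\<close> are mutually orthogonal. View \<open>a\<close> as a matrix \<open>f\<^sub>c\<close> indexed by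
  \<open>c\<close>-sets and \<open>(d - c)\<close>-sets; \<open>f\<^sub>c\<close> and \<open>f\<^sub>d\<^sub>-\<^sub>c\<close> are transposes of each other.

  If \<open>\<rho>\<^sub>k(F)\<close> is small, then testing with \<open>X\<close> multiplied by fresh variables bounds the operator norm of
  \<open>f\<^sub>r\<close> for all \<open>1 \<le> r \<le> k\<close>, and transposition covers all \<open>1 \<le> r < d\<close> because \<open>k \<ge> \<lfloor>d / 2\<rfloor>\<close>. Hence the
  variance of \<open>\<Gamma>(F, F)\<close> is small, and Gaussian integration by parts shows that the characteristic
  function of \<open>F\<close> almost solves \<open>\<phi>' = - t \<phi>\<close>.

  Conversely, hypercontractivity bounds the sixth moments, so convergence in law forces
  \<open>\<^bold>E F\<^sup>4 \<rightarrow> 3\<close>. The components \<open>Y\<^sub>0\<close> and \<open>Y\<^sub>d\<close> of \<open>F\<^sup>2\<close> already give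
  \<open>\<^bold>E F\<^sup>4 \<ge> 3 + \<Sum>\<^sub>0\<^sub><\<^sub>r\<^sub><\<^sub>d \<parallel>f\<^sub>r f\<^sub>r\<^sup>T\<parallel>\<^sup>2\<close> (Hilbert--Schmidt norms), so all operator
  norms, and with them \<open>\<rho>\<^sub>d\<^sub>-\<^sub>1(F)\<close>, tend to 0.
\<close>

section \<open>Contractions and the Wick expansion\<close>

text \<open>
  The coefficients of \<open>F\<close> as a matrix indexed by disjoint pairs of sets. The polynomial \<open>wick A B\<close> is the
  Wick product of the monomials \<open>G\<^sub>A\<close> and \<open>G\<^sub>B\<close>, and \<open>component\<close> is the term \<open>Y\<^sub>c\<close> of the product.
\<close>

definition split_coeff :: "(nat set \<Rightarrow> real) \<Rightarrow> nat set \<Rightarrow> nat set \<Rightarrow> real" where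
  "split_coeff a A C = (if A \<inter> C = {} then a (A \<union> C) else 0)"

text \<open>The product of two coefficient matrices, with the common \<open>c\<close>-set
  \<open>C\<close> summed out. Only \<open>C\<close> is kept disjoint from \<open>A\<close> and from
  \<open>B\<close>; \<open>A\<close> and \<open>B\<close> themselves may overlap, and the squared
  factors of \<open>wick A B\<close> live on that overlap.\<close>

definition contraction ::
  "nat set \<Rightarrow> nat \<Rightarrow> (nat set \<Rightarrow> real) \<Rightarrow> (nat set \<Rightarrow> real) \<Rightarrow> nat set \<Rightarrow> nat set \<Rightarrow> real" where
  "contraction V c a b A B = (\<Sum>C\<in>nsets V c. split_coeff a A C * split_coeff b B C)"

definition wick :: "nat set \<Rightarrow> nat set \<Rightarrow> (nat \<Rightarrow> real) \<Rightarrow> real" where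
  "wick A B x = (\<Prod>i\<in>(A - B) \<union> (B - A). x i) * (\<Prod>i\<in>A \<inter> B. (x i)\<^sup>2 - 1)"

definition component ::
  "nat set \<Rightarrow> nat \<Rightarrow> nat \<Rightarrow> (nat set \<Rightarrow> real) \<Rightarrow> (nat set \<Rightarrow> real) \<Rightarrow> nat \<Rightarrow> (nat \<Rightarrow> real) \<Rightarrow> real" where
  "component V d k a b c x =
    (\<Sum>A\<in>nsets V (d - c). \<Sum>B\<in>nsets V (k - c). contraction V c a b A B * wick A B x)"

lemma in_nsets: "I \<in> nsets V d \<longleftrightarrow> I \<subseteq> V \<and> finite I \<and> card I = d"
  by (auto simp: nsets_def)

lemma nsets_0: "nsets V 0 = {{}}"
  by (auto simp: nsets_def)

lemma split_coeff_commute: "split_coeff a A C = split_coeff a C A"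
  by (auto simp: split_coeff_def Int_commute Un_commute)

text \<open>On the common indices each square splits as \<open>1 + ((x i)^2 - 1)\<close>. When the
  product over \<open>A \<inter> B\<close> is expanded, \<open>D\<close> collects the indices at
  which the 1 is chosen.\<close>

lemma prod_mult_prod_eq_sum_wick:
  assumes "finite A" "finite B"
  shows "(\<Prod>i\<in>A. x i) * (\<Prod>i\<in>B. x i) = (\<Sum>D\<in>Pow (A \<inter> B). wick (A - D) (B - D) x)"
proof -
  have "(\<Prod>i\<in>A. x i) = (\<Prod>i\<in>A - B. x i) * (\<Prod>i\<in>A \<inter> B. x i)"
    using assms by (subst prod.union_disjoint[symmetric]) (auto intro!: prod.cong)
  moreover have "(\<Prod>i\<in>B. x i) = (\<Prod>i\<in>B - A. x i) * (\<Prod>i\<in>A \<inter> B. x i)"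
    using assms by (subst prod.union_disjoint[symmetric]) (auto intro!: prod.cong)
  moreover have "(\<Prod>i\<in>(A - B) \<union> (B - A). x i) = (\<Prod>i\<in>A - B. x i) * (\<Prod>i\<in>B - A. x i)"
    using assms by (subst prod.union_disjoint) auto
  ultimately have "(\<Prod>i\<in>A. x i) * (\<Prod>i\<in>B. x i) =
      (\<Prod>i\<in>(A - B) \<union> (B - A). x i) * (\<Prod>i\<in>A \<inter> B. (x i)\<^sup>2)"
    by (simp add: power2_eq_square prod.distrib)
  also have "(\<Prod>i\<in>A \<inter> B. (x i)\<^sup>2) = (\<Prod>i\<in>A \<inter> B. 1 + ((x i)\<^sup>2 - 1))"
    by simp
  also have "\<dots> = (\<Sum>D\<in>Pow (A \<inter> B). \<Prod>i\<in>A \<inter> B - D. (x i)\<^sup>2 - 1)"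
    using assms by (subst prod_add) auto
  also have "(\<Prod>i\<in>(A - B) \<union> (B - A). x i) * \<dots> = (\<Sum>D\<in>Pow (A \<inter> B). wick (A - D) (B - D) x)"
    unfolding sum_distrib_left
  proof (rule sum.cong)
    fix D assume D: "D \<in> Pow (A \<inter> B)"
    then have "(A - D - (B - D)) \<union> (B - D - (A - D)) = (A - B) \<union> (B - A)"
      "(A - D) \<inter> (B - D) = A \<inter> B - D" by auto
    then show "(\<Prod>i\<in>(A - B) \<union> (B - A). x i) * (\<Prod>i\<in>A \<inter> B - D. (x i)\<^sup>2 - 1) = wick (A - D) (B - D) x"
      by (simp add: wick_def)
  qed simp
  finally show ?thesis .
qed

text \<open>Change of variables from \<open>(I, J, C)\<close> to \<open>(I - C, J - C, C)\<close>.
  The image consists of the triples with \<open>C\<close> disjoint from \<open>A\<close> and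
  \<open>B\<close>; all other triples can be added because \<open>split_coeff\<close> vanishes on
  them.\<close>

lemma sum_nsets_eq_sum_contraction:
  assumes V: "finite V" and "c \<le> d" "c \<le> k"
  shows "(\<Sum>I\<in>nsets V d. \<Sum>J\<in>nsets V k. \<Sum>C\<in>nsets (I \<inter> J) c. a I * b J * h (I - C) (J - C)) =
    (\<Sum>A\<in>nsets V (d - c). \<Sum>B\<in>nsets V (k - c). contraction V c a b A B * h A B)"
    (is "?L = ?R")
proof -
  let ?SL = "Sigma (nsets V d) (\<lambda>I. Sigma (nsets V k) (\<lambda>J. nsets (I \<inter> J) c))"
  let ?SR = "{z \<in> nsets V (d - c) \<times> nsets V (k - c) \<times> nsets V c.
    case z of (A, B, C) \<Rightarrow> A \<inter> C = {} \<and> B \<inter> C = {}}"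
  have fin: "finite (nsets V m)" for m
    using V by (rule finite_imp_finite_nsets)
  have fin2: "finite (nsets (I \<inter> J) m)" if "I \<in> nsets V d" for I J m
    using that by (intro finite_imp_finite_nsets) (auto simp: in_nsets)
  have "?L = (\<Sum>I\<in>nsets V d. \<Sum>(J, C)\<in>Sigma (nsets V k) (\<lambda>J. nsets (I \<inter> J) c).
      a I * b J * h (I - C) (J - C))"
    by (intro sum.cong refl sum.Sigma fin) (auto intro: fin2)
  also have "\<dots> = (\<Sum>(I, J, C)\<in>?SL. a I * b J * h (I - C) (J - C))"
    by (subst sum.Sigma) (auto intro!: fin fin2 simp: split_def)
  also have "\<dots> = (\<Sum>(A, B, C)\<in>?SR. a (A \<union> C) * b (B \<union> C) * h A B)"
  proof (rule sum.reindex_bij_witness[where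
        i = "\<lambda>(A, B, C). (A \<union> C, B \<union> C, C)" and j = "\<lambda>(I, J, C). (I - C, J - C, C)"])
    fix z assume "z \<in> ?SL"
    then obtain I J C where z: "z = (I, J, C)" "I \<in> nsets V d" "J \<in> nsets V k" "C \<in> nsets (I \<inter> J) c"
      by auto
    then have un: "I - C \<union> C = I" "J - C \<union> C = J"
      by (auto simp: in_nsets)
    show "(case (case z of (I, J, C) \<Rightarrow> (I - C, J - C, C)) of (A, B, C) \<Rightarrow> (A \<union> C, B \<union> C, C)) = z"
      by (simp only: z un prod.case)
    show "(case z of (I, J, C) \<Rightarrow> (I - C, J - C, C)) \<in> ?SR"
      using z by (auto simp: in_nsets card_Diff_subset)
    show "(case (case z of (I, J, C) \<Rightarrow> (I - C, J - C, C)) of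
        (A, B, C) \<Rightarrow> a (A \<union> C) * b (B \<union> C) * h A B) =
      (case z of (I, J, C) \<Rightarrow> a I * b J * h (I - C) (J - C))"
      by (simp only: z un prod.case)
  next
    fix z assume "z \<in> ?SR"
    then obtain A B C where z: "z = (A, B, C)" "A \<in> nsets V (d - c)" "B \<in> nsets V (k - c)" "C \<in> nsets V c"
      "A \<inter> C = {}" "B \<inter> C = {}"
      by auto
    then have "A \<union> C - C = A" "B \<union> C - C = B" by auto
    then show "(case (case z of (A, B, C) \<Rightarrow> (A \<union> C, B \<union> C, C)) of (I, J, C) \<Rightarrow> (I - C, J - C, C)) = z"
      by (simp only: z prod.case)
    show "(case z of (A, B, C) \<Rightarrow> (A \<union> C, B \<union> C, C)) \<in> ?SL"
      using z assms by (auto simp: in_nsets card_Un_disjoint)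
  qed
  also have "\<dots> = (\<Sum>(A, B, C)\<in>nsets V (d - c) \<times> nsets V (k - c) \<times> nsets V c.
      split_coeff a A C * split_coeff b B C * h A B)"
    using fin by (intro sum.mono_neutral_cong_left) (auto simp: split_coeff_def split: if_splits)
  also have "\<dots> = ?R"
    by (simp add: sum.cartesian_product contraction_def sum_distrib_right split_def)
  finally show ?thesis .
qed

lemma sum_Pow_card:
  fixes h :: "'b set \<Rightarrow> real"
  assumes "finite X" "card X \<le> k"
  shows "(\<Sum>C\<in>Pow X. h C) = (\<Sum>c\<le>k. \<Sum>C\<in>nsets X c. h C)"
proof -
  have "(\<Sum>c\<le>k. \<Sum>C\<in>nsets X c. h C) = (\<Sum>c\<le>k. \<Sum>C\<in>{C \<in> Pow X. card C = c}. h C)"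
    using assms by (intro sum.cong refl) (auto simp: in_nsets dest: finite_subset)
  also have "\<dots> = (\<Sum>C\<in>Pow X. h C)"
    using assms by (intro sum.group) (auto intro: order_trans[OF card_mono])
  finally show ?thesis by simp
qed

text \<open>The weight \<open>w\<close> lets one rearrangement serve twice: \<open>w c = 1\<close>
  yields the product of two polynomials, \<open>w c = c\<close> their gradient product.\<close>

lemma sum_wick_eq_sum_component:
  assumes V: "finite V" and "k \<le> d"
  shows "(\<Sum>I\<in>nsets V d. \<Sum>J\<in>nsets V k. a I * b J * (\<Sum>C\<in>Pow (I \<inter> J). w (card C) * wick (I - C) (J - C) x)) =
    (\<Sum>c\<le>k. w c * component V d k a b c x)" (is "?L = _")
proof -
  have "?L = (\<Sum>I\<in>nsets V d. \<Sum>J\<in>nsets V k. \<Sum>c\<le>k. w c *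
      (\<Sum>C\<in>nsets (I \<inter> J) c. a I * b J * wick (I - C) (J - C) x))"
  proof (intro sum.cong refl)
    fix I J assume "I \<in> nsets V d" "J \<in> nsets V k"
    then have "finite (I \<inter> J)" "card (I \<inter> J) \<le> k"
      by (auto simp: in_nsets intro: card_mono)
    then show "a I * b J * (\<Sum>C\<in>Pow (I \<inter> J). w (card C) * wick (I - C) (J - C) x) =
      (\<Sum>c\<le>k. w c * (\<Sum>C\<in>nsets (I \<inter> J) c. a I * b J * wick (I - C) (J - C) x))"
      unfolding sum_Pow_card[OF \<open>finite (I \<inter> J)\<close> \<open>card (I \<inter> J) \<le> k\<close>] sum_distrib_left
      by (intro sum.cong refl) (simp add: in_nsets)
  qed
  also have "\<dots> = (\<Sum>I\<in>nsets V d. \<Sum>c\<le>k. \<Sum>J\<in>nsets V k. w c *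
      (\<Sum>C\<in>nsets (I \<inter> J) c. a I * b J * wick (I - C) (J - C) x))"
    by (intro sum.cong refl sum.swap)
  also have "\<dots> = (\<Sum>c\<le>k. \<Sum>I\<in>nsets V d. \<Sum>J\<in>nsets V k. w c *
      (\<Sum>C\<in>nsets (I \<inter> J) c. a I * b J * wick (I - C) (J - C) x))"
    by (rule sum.swap)
  also have "\<dots> = (\<Sum>c\<le>k. w c * component V d k a b c x)"
    using assms by (intro sum.cong refl)
      (simp add: component_def sum_nsets_eq_sum_contraction[symmetric] sum_distrib_left)
  finally show ?thesis .
qed

text \<open>\<open>I\<close> is cut into \<open>R\<close>, \<open>S\<close> and \<open>J\<close>
  into \<open>A\<close>, \<open>B\<close> so that regrouping gives \<open>K\<close> and
  \<open>L\<close>. An index lying in only one of \<open>I\<close>, \<open>J\<close> has its block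
  forced by \<open>K\<close> and \<open>L\<close>. An index of \<open>I \<inter> J\<close> lies
  either in \<open>R\<close> and \<open>B\<close> or in \<open>S\<close> and \<open>A\<close>, which
  gives the power of 2; \<open>U\<close> below is the set of indices with the first choice.\<close>

lemma card_quadruple_splits:
  fixes I J K L :: "'b set"
  assumes fin: "finite I" "finite J"
  defines "T \<equiv> {(R, S, A, B). R \<inter> S = {} \<and> R \<union> S = I \<and> A \<inter> B = {} \<and> A \<union> B = J \<and>
    R \<inter> A = {} \<and> R \<union> A = K \<and> S \<inter> B = {} \<and> S \<union> B = L}"
  shows "card T = (if I \<union> J = K \<union> L \<and> I \<inter> J = K \<inter> L then 2 ^ card (I \<inter> J) else 0)"
proof (cases "I \<union> J = K \<union> L \<and> I \<inter> J = K \<inter> L")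
  case True
  let ?f = "\<lambda>U. ((I \<inter> K - I \<inter> J) \<union> U, (I \<inter> L - I \<inter> J) \<union> (I \<inter> J - U),
    (J \<inter> K - I \<inter> J) \<union> (I \<inter> J - U), (J \<inter> L - I \<inter> J) \<union> U)"
  have "bij_betw ?f (Pow (I \<inter> J)) T"
  proof (rule bij_betw_byWitness[where f' = "\<lambda>(R, S, A, B). R \<inter> J"])
    show "\<forall>U\<in>Pow (I \<inter> J). (case ?f U of (R, S, A, B) \<Rightarrow> R \<inter> J) = U"
      by auto
    show "\<forall>z\<in>T. ?f (case z of (R, S, A, B) \<Rightarrow> R \<inter> J) = z"
    proof
      fix z assume "z \<in> T"
      then obtain R S A B where z: "z = (R, S, A, B)" and
        dis: "R \<inter> S = {}" "A \<inter> B = {}" "R \<inter> A = {}" "S \<inter> B = {}" and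
        un: "I = R \<union> S" "J = A \<union> B" "K = R \<union> A" "L = S \<union> B"
        unfolding T_def by blast
      show "?f (case z of (R, S, A, B) \<Rightarrow> R \<inter> J) = z"
        unfolding z un prod.case prod.inject using dis by (intro conjI) auto
    qed
    show "?f ` Pow (I \<inter> J) \<subseteq> T"
    proof (rule image_subsetI)
      fix U assume U: "U \<in> Pow (I \<inter> J)"
      have "(x \<in> I \<or> x \<in> J) = (x \<in> K \<or> x \<in> L)" "(x \<in> I \<and> x \<in> J) = (x \<in> K \<and> x \<in> L)"
        "x \<in> U \<Longrightarrow> x \<in> I \<and> x \<in> J" for x
        using True U by (auto simp: set_eq_iff)
      then show "?f U \<in> T"
        unfolding T_def mem_Collect_eq prod.case set_eq_iff Un_iff Int_iff Diff_iff empty_iff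
        by (intro conjI allI) metis+
    qed
    show "(\<lambda>(R, S, A, B). R \<inter> J) ` T \<subseteq> Pow (I \<inter> J)"
      unfolding T_def by auto
  qed
  then have "card T = card (Pow (I \<inter> J))"
    by (rule bij_betw_same_card[symmetric])
  also have "\<dots> = 2 ^ card (I \<inter> J)"
    using fin by (intro card_Pow) auto
  finally show ?thesis
    unfolding if_P[OF True] .
next
  case False
  have "T = {}"
    unfolding T_def using False by blast
  with False show ?thesis by auto
qed

text \<open>The left side is the second moment of \<open>Y_0\<close>. Its weight is the number of
  quadruples counted in \<open>card_quadruple_splits\<close>, so the sum can be taken over the
  blocks \<open>R\<close>, \<open>S\<close>, \<open>A\<close>, \<open>B\<close> instead and sorted
  by \<open>r = card R\<close>, which also equals \<open>card B\<close>.\<close>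

lemma sum_gram_eq_sum_contraction_squares:
  assumes V: "finite V"
  shows "(\<Sum>I\<in>nsets V d. \<Sum>J\<in>nsets V d. \<Sum>K\<in>nsets V d. \<Sum>L\<in>nsets V d. a I * a J * (a K * a L) *
      (if I \<union> J = K \<union> L \<and> I \<inter> J = K \<inter> L then 2 ^ card (I \<inter> J) else 0)) =
    (\<Sum>r\<le>d. \<Sum>R\<in>nsets V r. \<Sum>B\<in>nsets V r. (contraction V (d - r) a a R B)\<^sup>2)" (is "?L = ?R")
proof -
  let ?N = "nsets V d"
  define T where "T = (\<lambda>(I, J, K, L). {(R, S, A, B). R \<inter> S = {} \<and> R \<union> S = I \<and> A \<inter> B = {} \<and> A \<union> B = J \<and>
    R \<inter> A = {} \<and> R \<union> A = K \<and> S \<inter> B = {} \<and> S \<union> B = (L :: nat set)})"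
  define Q where "Q = {(r, R, B, S, A). r \<le> d \<and> R \<in> nsets V r \<and> B \<in> nsets V r \<and>
    S \<in> nsets V (d - r) \<and> A \<in> nsets V (d - r)}"
  have fin: "finite (nsets V m)" for m
    using V by (rule finite_imp_finite_nsets)
  have finT: "finite (T z)" if "z \<in> ?N \<times> ?N \<times> ?N \<times> ?N" for z
  proof (rule finite_subset)
    show "T z \<subseteq> Pow V \<times> Pow V \<times> Pow V \<times> Pow V"
      using that by (auto simp: T_def in_nsets)
  qed (use V in auto)
  have finQ: "finite Q"
  proof (rule finite_subset)
    show "Q \<subseteq> {..d} \<times> Pow V \<times> Pow V \<times> Pow V \<times> Pow V"
      by (auto simp: Q_def in_nsets)
  qed (use V in auto)
  have "?L = (\<Sum>(I, J, K, L)\<in>?N \<times> ?N \<times> ?N \<times> ?N. a I * a J * (a K * a L) *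
      (if I \<union> J = K \<union> L \<and> I \<inter> J = K \<inter> L then 2 ^ card (I \<inter> J) else 0))"
    by (simp add: sum.cartesian_product split_def)
  also have "\<dots> = (\<Sum>z\<in>?N \<times> ?N \<times> ?N \<times> ?N. \<Sum>t\<in>T z. case z of (I, J, K, L) \<Rightarrow> a I * a J * (a K * a L))"
  proof (rule sum.cong[OF refl], clarify, goal_cases)
    case (1 I J K L)
    have "real (card (T (I, J, K, L))) = (if I \<union> J = K \<union> L \<and> I \<inter> J = K \<inter> L then 2 ^ card (I \<inter> J) else 0)"
      using 1 unfolding T_def prod.case by (subst card_quadruple_splits) (auto simp: in_nsets)
    then show ?case by simp
  qed
  also have "\<dots> = (\<Sum>((I, J, K, L), t)\<in>Sigma (?N \<times> ?N \<times> ?N \<times> ?N) T. a I * a J * (a K * a L))"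
    using fin finT by (subst sum.Sigma) (auto simp: split_def)
  also have "\<dots> = (\<Sum>(r, R, B, S, A)\<in>{(r, R, B, S, A) \<in> Q. R \<inter> S = {} \<and> A \<inter> B = {} \<and> R \<inter> A = {} \<and> S \<inter> B = {}}.
      a (R \<union> S) * a (A \<union> B) * (a (R \<union> A) * a (S \<union> B)))"
    (is "_ = sum ?h ?Q'")
  proof (rule sum.reindex_bij_witness[where
        i = "\<lambda>(r, R, B, S, A). ((R \<union> S, A \<union> B, R \<union> A, S \<union> B), (R, S, A, B))" and
        j = "\<lambda>((I, J, K, L), (R, S, A, B)). (card R, R, B, S, A)"], goal_cases)
    case (1 z) then show ?case by (auto simp: T_def)
  next
    case (2 z)
    then obtain R S A B where z: "z = ((R \<union> S, A \<union> B, R \<union> A, S \<union> B), (R, S, A, B))"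
      and N: "R \<union> S \<in> ?N" "A \<union> B \<in> ?N" "R \<union> A \<in> ?N" "S \<union> B \<in> ?N"
      and dis: "R \<inter> S = {}" "A \<inter> B = {}" "R \<inter> A = {}" "S \<inter> B = {}"
      by (auto simp: T_def)
    have f: "finite R" "finite S" "finite A" "finite B" using N by (auto simp: in_nsets)
    have "card R + card S = d" "card A + card B = d" "card R + card A = d" "card S + card B = d"
      using N dis f by (auto simp: in_nsets card_Un_disjoint)
    then show ?case
      using N dis f unfolding z Q_def by (auto simp: in_nsets)
  next
    case (3 z) then show ?case by (auto simp: Q_def in_nsets)
  next
    case (4 z)
    then obtain r R B S A where z: "z = (r, R, B, S, A)" "z \<in> Q" and
      dis: "R \<inter> S = {}" "A \<inter> B = {}" "R \<inter> A = {}" "S \<inter> B = {}"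
      by auto
    then have "R \<union> S \<in> ?N" "A \<union> B \<in> ?N" "R \<union> A \<in> ?N" "S \<union> B \<in> ?N"
      by (auto simp: Q_def in_nsets card_Un_disjoint)
    with dis z(1) show ?case by (auto simp: T_def)
  next
    case (5 z) then show ?case by (auto simp: T_def)
  qed
  \<comment> \<open>The zeros of \<open>split_coeff\<close> absorb the disjointness conditions. For
    fixed \<open>R\<close> and \<open>B\<close> the sums over \<open>S\<close> and \<open>A\<close>
    then separate into two equal contractions.\<close>
  also have "\<dots> = (\<Sum>(r, R, B, S, A)\<in>Q. split_coeff a R S * split_coeff a B S * (split_coeff a R A * split_coeff a B A))"
    using finQ by (intro sum.mono_neutral_cong_left)
      (auto simp: split_coeff_def Un_commute Int_commute split: if_splits)
  also have "Q = Sigma {..d} (\<lambda>r. nsets V r \<times> nsets V r \<times> nsets V (d - r) \<times> nsets V (d - r))"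
    by (auto simp: Q_def)
  also have "(\<Sum>(r, R, B, S, A)\<in>\<dots>. split_coeff a R S * split_coeff a B S * (split_coeff a R A * split_coeff a B A)) = ?R"
    using fin by (subst sum.Sigma[symmetric])
      (auto simp: sum.cartesian_product contraction_def power2_eq_square sum_product split_def
        intro!: sum.cong)
  finally show ?thesis .
qed

section \<open>Operator norms of coefficient matrices\<close>

text \<open>The inner product of \<open>wick A B\<close> and \<open>wick A' B'\<close> in L2, by
  \<open>expectation_wick_mult\<close>. Each doubly occurring index contributes the variance 2 of a
  squared standard Gaussian.\<close>

definition gram :: "nat set \<Rightarrow> nat set \<Rightarrow> nat set \<Rightarrow> nat set \<Rightarrow> real" where
  "gram A B A' B' = (if A \<union> B = A' \<union> B' \<and> A \<inter> B = A' \<inter> B' then 2 ^ card (A \<inter> B) else 0)"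

text \<open>\<open>K\<close> bounds the square of the operator norm of \<open>f_c\<close>, acting
  from \<open>c\<close>-sets to \<open>(d - c)\<close>-sets.\<close>

definition contraction_bound :: "nat set \<Rightarrow> nat \<Rightarrow> (nat set \<Rightarrow> real) \<Rightarrow> nat \<Rightarrow> real \<Rightarrow> bool" where
  "contraction_bound V d a c K \<longleftrightarrow> (\<forall>v.
    (\<Sum>A\<in>nsets V (d - c). (\<Sum>C\<in>nsets V c. split_coeff a A C * v C)\<^sup>2) \<le> K * (\<Sum>C\<in>nsets V c. (v C)\<^sup>2))"

text \<open>A matrix and its transpose have the same operator norm: the squared length
  \<open>s\<close> of the transposed image is the inner product of \<open>w\<close> with the image
  of \<open>v\<close>, so Cauchy-Schwarz bounds \<open>s^2\<close> by a multiple of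
  \<open>s\<close>, and one factor \<open>s\<close> cancels.\<close>

lemma matrix_bound_transpose:
  fixes f :: "'b \<Rightarrow> 'c \<Rightarrow> real"
  assumes bound: "\<And>v. (\<Sum>x\<in>X. (\<Sum>y\<in>Y. f x y * v y)\<^sup>2) \<le> K * (\<Sum>y\<in>Y. (v y)\<^sup>2)" and "K \<ge> 0"
  shows "(\<Sum>y\<in>Y. (\<Sum>x\<in>X. f x y * w x)\<^sup>2) \<le> K * (\<Sum>x\<in>X. (w x)\<^sup>2)"
proof -
  define v where "v y = (\<Sum>x\<in>X. f x y * w x)" for y
  define s where "s = (\<Sum>y\<in>Y. (v y)\<^sup>2)"
  have "s = (\<Sum>y\<in>Y. \<Sum>x\<in>X. v y * (f x y * w x))"
    unfolding s_def power2_eq_square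
    by (intro sum.cong refl) (simp add: sum_distrib_left[symmetric] v_def[symmetric])
  also have "\<dots> = (\<Sum>x\<in>X. w x * (\<Sum>y\<in>Y. f x y * v y))"
    by (subst sum.swap) (simp add: sum_distrib_left mult_ac)
  finally have "s\<^sup>2 \<le> (\<Sum>x\<in>X. (w x)\<^sup>2) * (\<Sum>x\<in>X. (\<Sum>y\<in>Y. f x y * v y)\<^sup>2)"
    using Cauchy_Schwarz_ineq_sum[of w _ X] by simp
  also have "\<dots> \<le> (\<Sum>x\<in>X. (w x)\<^sup>2) * (K * s)"
    unfolding s_def by (intro mult_left_mono bound sum_nonneg) auto
  finally have le: "s * s \<le> (K * (\<Sum>x\<in>X. (w x)\<^sup>2)) * s"
    by (simp add: power2_eq_square mult_ac)
  have "s \<ge> 0" "K * (\<Sum>x\<in>X. (w x)\<^sup>2) \<ge> 0"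
    unfolding s_def using \<open>K \<ge> 0\<close> by (auto intro!: sum_nonneg mult_nonneg_nonneg)
  with le have "s \<le> K * (\<Sum>x\<in>X. (w x)\<^sup>2)"
    by (cases "s = 0") (auto simp: mult_le_cancel_right)
  then show ?thesis
    by (simp add: s_def v_def)
qed

text \<open>The left side is the quadratic form of \<open>f^T f\<close> at \<open>v\<close>;
  Cauchy-Schwarz over \<open>Y \<times> Y\<close> bounds it by the Hilbert-Schmidt norm of
  \<open>f^T f\<close>.\<close>

lemma matrix_bound_hilbert_schmidt:
  fixes f :: "'b \<Rightarrow> 'c \<Rightarrow> real"
  shows "(\<Sum>x\<in>X. (\<Sum>y\<in>Y. f x y * v y)\<^sup>2) \<le>
    sqrt (\<Sum>y\<in>Y. \<Sum>z\<in>Y. (\<Sum>x\<in>X. f x y * f x z)\<^sup>2) * (\<Sum>y\<in>Y. (v y)\<^sup>2)"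
proof -
  let ?N = "\<lambda>y z. \<Sum>x\<in>X. f x y * f x z"
  have "(\<Sum>x\<in>X. (\<Sum>y\<in>Y. f x y * v y)\<^sup>2) = (\<Sum>x\<in>X. \<Sum>y\<in>Y. \<Sum>z\<in>Y. v y * v z * (f x y * f x z))"
    by (simp add: power2_eq_square sum_product mult_ac)
  also have "\<dots> = (\<Sum>y\<in>Y. \<Sum>x\<in>X. \<Sum>z\<in>Y. v y * v z * (f x y * f x z))"
    by (rule sum.swap)
  also have "\<dots> = (\<Sum>y\<in>Y. \<Sum>z\<in>Y. v y * v z * ?N y z)"
    unfolding sum_distrib_left by (intro sum.cong refl sum.swap)
  also have "\<dots> = (\<Sum>(y, z)\<in>Y \<times> Y. (v y * v z) * ?N y z)"
    by (simp add: sum.cartesian_product)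
  also have "\<dots> \<le> sqrt ((\<Sum>(y, z)\<in>Y \<times> Y. (v y * v z)\<^sup>2) * (\<Sum>(y, z)\<in>Y \<times> Y. (?N y z)\<^sup>2))"
    using Cauchy_Schwarz_ineq_sum[of "\<lambda>(y, z). v y * v z" "\<lambda>(y, z). ?N y z" "Y \<times> Y"]
    by (intro real_le_rsqrt) (simp add: split_def)
  also have "(\<Sum>(y, z)\<in>Y \<times> Y. (v y * v z)\<^sup>2) = (\<Sum>y\<in>Y. (v y)\<^sup>2)\<^sup>2"
    by (simp add: sum.cartesian_product[symmetric] power_mult_distrib power2_eq_square[of "sum _ _"] sum_product)
  also have "sqrt (\<dots> * (\<Sum>(y, z)\<in>Y \<times> Y. (?N y z)\<^sup>2)) =
      sqrt (\<Sum>y\<in>Y. \<Sum>z\<in>Y. (?N y z)\<^sup>2) * (\<Sum>y\<in>Y. (v y)\<^sup>2)"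
    by (simp add: real_sqrt_mult sum_nonneg sum.cartesian_product)
  finally show ?thesis .
qed

text \<open>Schur's test for a symmetric nonnegative kernel, from
  \<open>u x * u y \<le> ((u x)^2 + (u y)^2) / 2\<close>.\<close>

lemma quadratic_form_le_row_sum:
  fixes q :: "'b \<Rightarrow> 'b \<Rightarrow> real"
  assumes nonneg: "\<And>x y. q x y \<ge> 0" and sym: "\<And>x y. q x y = q y x"
    and row: "\<And>x. x \<in> Z \<Longrightarrow> (\<Sum>y\<in>Z. q x y) \<le> N"
  shows "(\<Sum>x\<in>Z. \<Sum>y\<in>Z. u x * u y * q x y) \<le> N * (\<Sum>x\<in>Z. (u x)\<^sup>2)"
proof -
  have "(\<Sum>x\<in>Z. \<Sum>y\<in>Z. u x * u y * q x y) \<le> (\<Sum>x\<in>Z. \<Sum>y\<in>Z. ((u x)\<^sup>2 + (u y)\<^sup>2) / 2 * q x y)"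
  proof (intro sum_mono mult_right_mono nonneg)
    show "u x * u y \<le> ((u x)\<^sup>2 + (u y)\<^sup>2) / 2" for x y
      using sum_squares_bound[of "u x" "u y"] by simp
  qed
  also have "\<dots> = (\<Sum>x\<in>Z. \<Sum>y\<in>Z. (u x)\<^sup>2 * q x y) / 2 + (\<Sum>x\<in>Z. \<Sum>y\<in>Z. (u y)\<^sup>2 * q x y) / 2"
    by (simp add: sum.distrib[symmetric] sum_divide_distrib add_divide_distrib distrib_right)
  also have "(\<Sum>x\<in>Z. \<Sum>y\<in>Z. (u y)\<^sup>2 * q x y) = (\<Sum>x\<in>Z. \<Sum>y\<in>Z. (u x)\<^sup>2 * q x y)"
    by (subst sum.swap) (simp add: sym)
  also have "(\<Sum>x\<in>Z. \<Sum>y\<in>Z. (u x)\<^sup>2 * q x y) / 2 + (\<Sum>x\<in>Z. \<Sum>y\<in>Z. (u x)\<^sup>2 * q x y) / 2 =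
      (\<Sum>x\<in>Z. (u x)\<^sup>2 * (\<Sum>y\<in>Z. q x y))"
    by (simp add: sum_distrib_left)
  also have "\<dots> \<le> (\<Sum>x\<in>Z. (u x)\<^sup>2 * N)"
    by (intro sum_mono mult_left_mono row) auto
  finally show ?thesis
    by (simp add: sum_distrib_left mult_ac)
qed

text \<open>Wick products are orthogonal only up to regrouping of indices, and Schur's test measures
  the loss. In the row of \<open>(A, B)\<close> a nonzero entry needs two subsets of
  \<open>A \<union> B\<close>, hence there are at most \<open>4 ^ (p + q)\<close> of them, each at
  most \<open>2 ^ (p + q)\<close>.\<close>

lemma gram_sum_le:
  assumes V: "finite V"
  shows "(\<Sum>x\<in>nsets V p \<times> nsets V q. \<Sum>y\<in>nsets V p \<times> nsets V q.
      u x * u y * gram (fst x) (snd x) (fst y) (snd y)) \<le>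
    8 ^ (p + q) * (\<Sum>x\<in>nsets V p \<times> nsets V q. (u x)\<^sup>2)"
proof (rule quadratic_form_le_row_sum)
  fix x assume "x \<in> nsets V p \<times> nsets V q"
  then obtain A B where x: "x = (A, B)" "finite A" "card A = p" "finite B" "card B = q"
    by (auto simp: in_nsets)
  have le1: "card (A \<inter> B) \<le> p + q" "card (A \<union> B) \<le> p + q"
    using x card_mono[of A "A \<inter> B"] card_Un_le[of A B] by auto
  let ?Z = "nsets V p \<times> nsets V q" and ?W = "Pow (A \<union> B) \<times> Pow (A \<union> B)"
  have finZ: "finite ?Z"
    using V by (simp add: finite_imp_finite_nsets)
  have "(\<Sum>y\<in>?Z. gram (fst x) (snd x) (fst y) (snd y)) = (\<Sum>y\<in>?Z \<inter> ?W. gram A B (fst y) (snd y))"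
  proof (rule sum.mono_neutral_cong_right[OF finZ])
    show "\<forall>y\<in>?Z - ?Z \<inter> ?W. gram (fst x) (snd x) (fst y) (snd y) = 0"
    proof
      fix y assume y: "y \<in> ?Z - ?Z \<inter> ?W"
      have "fst y \<union> snd y \<noteq> A \<union> B"
      proof
        assume "fst y \<union> snd y = A \<union> B"
        then have "y \<in> ?W" by (metis Pow_iff Un_upper1 Un_upper2 mem_Times_iff)
        with y show False by blast
      qed
      then show "gram (fst x) (snd x) (fst y) (snd y) = 0"
        by (simp add: x gram_def)
    qed
  qed (simp_all add: x)
  also have "\<dots> \<le> (\<Sum>y\<in>?Z \<inter> ?W. 2 ^ (p + q))"
  proof (rule sum_mono)
    show "gram A B (fst y) (snd y) \<le> 2 ^ (p + q)" for y
    proof -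
      have "(2 :: real) ^ card (A \<inter> B) \<le> 2 ^ (p + q)"
        using le1 by (intro power_increasing) auto
      moreover have "gram A B (fst y) (snd y) \<in> {0, 2 ^ card (A \<inter> B)}"
        unfolding gram_def by auto
      ultimately show ?thesis by auto
    qed
  qed
  also have "\<dots> \<le> (\<Sum>y\<in>?W. 2 ^ (p + q))"
    using x by (intro sum_mono2) auto
  also have "\<dots> = 2 ^ card (A \<union> B) * 2 ^ card (A \<union> B) * 2 ^ (p + q)"
    using x by (simp add: card_cartesian_product card_Pow)
  also have "\<dots> \<le> 2 ^ (p + q) * 2 ^ (p + q) * 2 ^ (p + q)"
    using le1 by (intro mult_right_mono mult_mono power_increasing) auto
  also have "\<dots> = (8 :: real) ^ (p + q)"
    by (simp add: power_mult_distrib[symmetric])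
  finally show "(\<Sum>y\<in>?Z. gram (fst x) (snd x) (fst y) (snd y)) \<le> 8 ^ (p + q)" .
next
  show "gram (fst x) (snd x) (fst y) (snd y) = gram (fst y) (snd y) (fst x) (snd x)" for x y
    unfolding gram_def by metis
qed (simp add: gram_def)

lemma contraction_bound_transpose:
  assumes "contraction_bound V d a c K" "c \<le> d" "K \<ge> 0"
  shows "contraction_bound V d a (d - c) K"
  using matrix_bound_transpose[where X = "nsets V (d - c)" and Y = "nsets V c" and f = "split_coeff a" and K = K] assms
  by (simp add: contraction_bound_def split_coeff_commute)

text \<open>The product of \<open>f_c\<close> with its transpose that is indexed by pairs of
  \<open>c\<close>-sets sums out the \<open>(d - c)\<close>-sets, hence the contraction order
  \<open>d - c\<close>.\<close>

lemma contraction_bound_hilbert_schmidt: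
  "contraction_bound V d a c (sqrt (\<Sum>R\<in>nsets V c. \<Sum>B\<in>nsets V c. (contraction V (d - c) a a R B)\<^sup>2))"
  using matrix_bound_hilbert_schmidt[where X = "nsets V (d - c)" and Y = "nsets V c" and f = "split_coeff a"]
  by (simp add: contraction_bound_def contraction_def split_coeff_commute)

lemma contraction_bound_mono:
  assumes "contraction_bound V d a c K" "K \<le> K'"
  shows "contraction_bound V d a c K'"
  using assms unfolding contraction_bound_def
  by (meson mult_right_mono order_trans sum_nonneg zero_le_power2)

text \<open>Each \<open>J\<close> is split as \<open>B \<union> C\<close> in at most as many ways as
  it has subsets, namely \<open>2 ^ k\<close>.\<close>

lemma sum_split_coeff_le:
  fixes b :: "nat set \<Rightarrow> real"
  assumes V: "finite V" and "c \<le> k"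
  shows "(\<Sum>B\<in>nsets V (k - c). \<Sum>C\<in>nsets V c. (split_coeff b B C)\<^sup>2) \<le> 2 ^ k * (\<Sum>J\<in>nsets V k. (b J)\<^sup>2)"
proof -
  have fin: "finite (nsets V m)" for m
    using V by (rule finite_imp_finite_nsets)
  let ?P = "{(B, C) \<in> nsets V (k - c) \<times> nsets V c. B \<inter> C = {}}"
  have "(\<Sum>B\<in>nsets V (k - c). \<Sum>C\<in>nsets V c. (split_coeff b B C)\<^sup>2) =
      (\<Sum>(B, C)\<in>nsets V (k - c) \<times> nsets V c. (split_coeff b B C)\<^sup>2)"
    by (simp add: sum.cartesian_product)
  also have "\<dots> = (\<Sum>(B, C)\<in>?P. (b (B \<union> C))\<^sup>2)"
    using fin by (intro sum.mono_neutral_cong_right) (auto simp: split_coeff_def split: if_splits)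
  also have "\<dots> = (\<Sum>(J, C)\<in>Sigma (nsets V k) (\<lambda>J. nsets J c). (b J)\<^sup>2)"
  proof (rule sum.reindex_bij_witness[where
        i = "\<lambda>(J, C). (J - C, C)" and j = "\<lambda>(B, C). (B \<union> C, C)"], goal_cases)
    case (3 z)
    then obtain J C where z: "z = (J, C)" "J \<in> nsets V k" "C \<in> nsets J c" by auto
    then have "J - C \<union> C = J" by (auto simp: in_nsets)
    then show ?case by (simp only: z prod.case)
  next
    case (4 z)
    then show ?case by (clarsimp simp: in_nsets card_Diff_subset) blast
  qed (use \<open>c \<le> k\<close> in \<open>auto simp: in_nsets card_Un_disjoint\<close>)
  also have "\<dots> = (\<Sum>J\<in>nsets V k. real (card (nsets J c)) * (b J)\<^sup>2)"
    using fin by (subst sum.Sigma[symmetric]) (auto simp: in_nsets finite_imp_finite_nsets)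
  also have "\<dots> \<le> (\<Sum>J\<in>nsets V k. 2 ^ k * (b J)\<^sup>2)"
  proof (intro sum_mono mult_right_mono)
    fix J assume "J \<in> nsets V k"
    then have J: "finite J" "card J = k"
      by (auto simp: in_nsets)
    have "card (nsets J c) \<le> card (Pow J)"
      using J by (intro card_mono) (auto simp: in_nsets)
    moreover have "card (Pow J) = 2 ^ k"
      using J by (simp add: card_Pow)
    ultimately show "real (card (nsets J c)) \<le> 2 ^ k"
      by (metis of_nat_le_numeral_power_cancel_iff)
  qed auto
  finally show ?thesis
    by (simp add: sum_distrib_left)
qed

text \<open>For fixed \<open>B\<close> the contraction is the image under \<open>f_c\<close> of the
  vector \<open>split_coeff b B\<close>; the operator bound is applied to each \<open>B\<close> and
  summed.\<close>

lemma sum_contraction_le: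
  assumes V: "finite V" and "c \<le> k" and "K \<ge> 0" and bound: "contraction_bound V d a c K"
  shows "(\<Sum>A\<in>nsets V (d - c). \<Sum>B\<in>nsets V (k - c). (contraction V c a b A B)\<^sup>2) \<le>
    K * 2 ^ k * (\<Sum>J\<in>nsets V k. (b J)\<^sup>2)"
proof -
  have "(\<Sum>A\<in>nsets V (d - c). \<Sum>B\<in>nsets V (k - c). (contraction V c a b A B)\<^sup>2) =
      (\<Sum>B\<in>nsets V (k - c). \<Sum>A\<in>nsets V (d - c). (\<Sum>C\<in>nsets V c. split_coeff a A C * split_coeff b B C)\<^sup>2)"
    unfolding contraction_def by (rule sum.swap)
  also have "\<dots> \<le> (\<Sum>B\<in>nsets V (k - c). K * (\<Sum>C\<in>nsets V c. (split_coeff b B C)\<^sup>2))"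
    using bound unfolding contraction_bound_def by (intro sum_mono) auto
  also have "\<dots> = K * (\<Sum>B\<in>nsets V (k - c). \<Sum>C\<in>nsets V c. (split_coeff b B C)\<^sup>2)"
    by (simp add: sum_distrib_left)
  also have "\<dots> \<le> K * (2 ^ k * (\<Sum>J\<in>nsets V k. (b J)\<^sup>2))"
    using assms by (intro mult_left_mono sum_split_coeff_le) auto
  finally show ?thesis by (simp add: mult_ac)
qed

text \<open>The extreme contractions reproduce the squared norm, which is where the constant 3 comes from.\<close>

lemma sum_contraction_squares_eq:
  assumes V: "finite V" and "d \<ge> 1"
  shows "2 * (\<Sum>I\<in>nsets V d. (a I)\<^sup>2)\<^sup>2 +
      (\<Sum>r\<in>{1..<d}. \<Sum>R\<in>nsets V r. \<Sum>B\<in>nsets V r. (contraction V (d - r) a a R B)\<^sup>2) =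
    (\<Sum>r\<le>d. \<Sum>R\<in>nsets V r. \<Sum>B\<in>nsets V r. (contraction V (d - r) a a R B)\<^sup>2)"
proof -
  let ?T = "\<lambda>r. \<Sum>R\<in>nsets V r. \<Sum>B\<in>nsets V r. (contraction V (d - r) a a R B)\<^sup>2"
  have "{..d} = insert 0 (insert d {1..<d})"
    using \<open>d \<ge> 1\<close> by auto
  then have "(\<Sum>r\<le>d. ?T r) = ?T 0 + ?T d + (\<Sum>r\<in>{1..<d}. ?T r)"
    using \<open>d \<ge> 1\<close> by simp
  moreover have "?T 0 = (\<Sum>I\<in>nsets V d. (a I)\<^sup>2)\<^sup>2"
    by (simp add: nsets_0 contraction_def split_coeff_def power2_eq_square)
  moreover have "?T d = (\<Sum>I\<in>nsets V d. (a I)\<^sup>2)\<^sup>2"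
    by (simp add: nsets_0 contraction_def split_coeff_def power2_eq_square sum_product mult_ac)
  ultimately show ?thesis by simp
qed

section \<open>Gradient products of polynomials\<close>

text \<open>\<open>V\<close> need only contain the variables that occur. It may be enlarged, so that
  two polynomials share one \<open>V\<close> or fresh variables become available.\<close>

definition supported :: "nat set \<Rightarrow> nat \<Rightarrow> (nat set \<Rightarrow> real) \<Rightarrow> bool" where
  "supported V d a \<longleftrightarrow> finite V \<and> V \<subseteq> {1..} \<and> (\<forall>I\<in>nsets {1..} d. a I \<noteq> 0 \<longrightarrow> I \<subseteq> V)"

definition dpoly :: "nat set \<Rightarrow> nat \<Rightarrow> (nat set \<Rightarrow> real) \<Rightarrow> nat \<Rightarrow> (nat \<Rightarrow> real) \<Rightarrow> real" where
  "dpoly V d a i x = (\<Sum>I\<in>nsets V d. if i \<in> I then a I * (\<Prod>j\<in>I - {i}. x j) else 0)"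

lemma supportedD:
  assumes "supported V d a"
  shows "finite V" "V \<subseteq> {1..}" "i \<in> V \<Longrightarrow> i \<ge> 1"
  using assms by (auto simp: supported_def)

lemma supported_superset:
  assumes "supported V d a" "V \<subseteq> W" "finite W" "W \<subseteq> {1..}"
  shows "supported W d a"
  using assms unfolding supported_def by blast

lemma fin_coeffs_supported:
  assumes "fin_coeffs d a"
  obtains V where "supported V d a"
proof
  show "supported (\<Union>{I \<in> nsets {1..} d. a I \<noteq> 0}) d a"
    unfolding supported_def
  proof (intro conjI ballI impI)
    show "finite (\<Union>{I \<in> nsets {1..} d. a I \<noteq> 0})"
      using assms unfolding fin_coeffs_def by (intro finite_Union) (simp_all add: in_nsets)
    show "\<Union>{I \<in> nsets {1..} d. a I \<noteq> 0} \<subseteq> {1..}"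
      by (intro Union_least) (simp add: in_nsets)
    show "I \<subseteq> \<Union>{I \<in> nsets {1..} d. a I \<noteq> 0}" if "I \<in> nsets {1..} d" "a I \<noteq> 0" for I
      using that by (intro Union_upper) simp
  qed
qed

lemma hom_poly_eq:
  assumes "supported V d a"
  shows "hom_poly d a x = (\<Sum>I\<in>nsets V d. a I * (\<Prod>i\<in>I. x i))"
  unfolding hom_poly_def
proof (rule sum.mono_neutral_left)
  show "finite (nsets V d)"
    using assms by (auto simp: supported_def intro: finite_imp_finite_nsets)
  show "{I \<in> nsets {1..} d. a I \<noteq> 0} \<subseteq> nsets V d"
    using assms by (auto simp: supported_def in_nsets)
  show "\<forall>I\<in>nsets V d - {I \<in> nsets {1..} d. a I \<noteq> 0}. a I * (\<Prod>i\<in>I. x i) = 0"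
  proof
    fix I assume I: "I \<in> nsets V d - {I \<in> nsets {1..} d. a I \<noteq> 0}"
    then have "I \<in> nsets {1..} d"
      using assms nsets_mono[of V "{1..}" d] by (auto simp: supported_def)
    with I show "a I * (\<Prod>i\<in>I. x i) = 0" by simp
  qed
qed

lemma partial_deriv_hom_poly:
  assumes "supported V d a"
  shows "partial_deriv i (hom_poly d a) x = dpoly V d a i x"
proof -
  have "((\<lambda>t. a I * (\<Prod>j\<in>I. (x(i := t)) j)) has_real_derivative
      (if i \<in> I then a I * (\<Prod>j\<in>I - {i}. x j) else 0)) (at (x i))" if "finite I" for I
  proof (cases "i \<in> I")
    case True
    have "(\<Prod>j\<in>I. (x(i := t)) j) = t * (\<Prod>j\<in>I - {i}. x j)" for t
      using that True by (subst prod.remove[of _ i]) (auto intro!: prod.cong)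
    with True show ?thesis
      by (auto intro!: derivative_eq_intros)
  next
    case False
    then have "(\<Prod>j\<in>I. (x(i := t)) j) = (\<Prod>j\<in>I. x j)" for t
      by (intro prod.cong) auto
    with False show ?thesis by simp
  qed
  then have "((\<lambda>t. hom_poly d a (x(i := t))) has_real_derivative dpoly V d a i x) (at (x i))"
    unfolding hom_poly_eq[OF assms] dpoly_def by (intro DERIV_sum) (auto simp: in_nsets)
  then show ?thesis
    unfolding partial_deriv_def by (rule DERIV_imp_deriv)
qed

lemma dpoly_eq_0: "i \<notin> V \<Longrightarrow> dpoly V d a i x = 0"
  unfolding dpoly_def by (intro sum.neutral) (auto simp: in_nsets)

lemma grad_prod_hom_poly:
  assumes "supported V d a" "supported V k b"
  shows "grad_prod (hom_poly d a) (hom_poly k b) x = (\<Sum>i\<in>V. dpoly V d a i x * dpoly V k b i x)"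
proof -
  have "grad_prod (hom_poly d a) (hom_poly k b) x = (\<Sum>\<^sub>\<infinity>i\<in>{1..}. dpoly V d a i x * dpoly V k b i x)"
    unfolding grad_prod_def using assms by (simp add: partial_deriv_hom_poly)
  also have "\<dots> = (\<Sum>\<^sub>\<infinity>i\<in>V. dpoly V d a i x * dpoly V k b i x)"
    using supportedD(2)[OF assms(1)] by (intro infsum_cong_neutral) (auto simp: dpoly_eq_0)
  finally show ?thesis
    using supportedD(1)[OF assms(1)] by simp
qed

text \<open>A set \<open>C\<close> arises as \<open>insert i D\<close> once for each of its
  elements. This multiplicity is the source of the weight \<open>c\<close> in the expansion of the
  gradient product.\<close>

lemma sum_insert_Pow:
  fixes h :: "'b set \<Rightarrow> real"
  assumes "finite X"
  shows "(\<Sum>i\<in>X. \<Sum>D\<in>Pow (X - {i}). h (insert i D)) = (\<Sum>C\<in>Pow X. real (card C) * h C)"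
proof -
  have "(\<Sum>i\<in>X. \<Sum>D\<in>Pow (X - {i}). h (insert i D)) =
      (\<Sum>(i, D)\<in>Sigma X (\<lambda>i. Pow (X - {i})). h (insert i D))"
    using assms by (intro sum.Sigma) auto
  also have "\<dots> = (\<Sum>(C, i)\<in>Sigma (Pow X) (\<lambda>C. C). h C)"
    by (rule sum.reindex_bij_witness[where i = "\<lambda>(C, i). (i, C - {i})" and j = "\<lambda>(i, D). (insert i D, i)"])
       (auto simp: insert_absorb)
  also have "\<dots> = (\<Sum>C\<in>Pow X. \<Sum>i\<in>C. h C)"
    using assms by (intro sum.Sigma[symmetric]) (auto intro: finite_subset)
  finally show ?thesis by simp
qed

text \<open>Differentiating both factors in a common index \<open>i\<close> removes it from
  \<open>I\<close> and \<open>J\<close>. Expanding the remaining product removes a further set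
  \<open>D\<close>, and \<open>insert i D\<close> is the contracted set.\<close>

lemma grad_prod_eq_sum_component:
  assumes "supported V d a" "supported V k b" "k \<le> d"
  shows "grad_prod (hom_poly d a) (hom_poly k b) x = (\<Sum>c\<le>k. real c * component V d k a b c x)"
proof -
  have V: "finite V" using assms(1) by (rule supportedD)
  have inner: "(\<Sum>i\<in>V. (if i \<in> I then a I * (\<Prod>j\<in>I - {i}. x j) else 0) *
        (if i \<in> J then b J * (\<Prod>j\<in>J - {i}. x j) else 0)) =
      a I * b J * (\<Sum>C\<in>Pow (I \<inter> J). real (card C) * wick (I - C) (J - C) x)"
    if "I \<in> nsets V d" "J \<in> nsets V k" for I J
  proof -
    have IJ: "finite I" "finite J" "I \<inter> J \<subseteq> V" using that by (auto simp: in_nsets)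
    have "(\<Sum>i\<in>V. (if i \<in> I then a I * (\<Prod>j\<in>I - {i}. x j) else 0) *
        (if i \<in> J then b J * (\<Prod>j\<in>J - {i}. x j) else 0)) =
      (\<Sum>i\<in>I \<inter> J. a I * b J * ((\<Prod>j\<in>I - {i}. x j) * (\<Prod>j\<in>J - {i}. x j)))"
      using V IJ by (intro sum.mono_neutral_cong_right) (auto split: if_splits)
    also have "\<dots> = (\<Sum>i\<in>I \<inter> J. a I * b J *
        (\<Sum>D\<in>Pow (I \<inter> J - {i}). wick (I - insert i D) (J - insert i D) x))"
    proof (rule sum.cong[OF refl])
      fix i
      have "(I - {i}) \<inter> (J - {i}) = I \<inter> J - {i}" "I - {i} - D = I - insert i D" "J - {i} - D = J - insert i D" for D
        by auto
      then show "a I * b J * ((\<Prod>j\<in>I - {i}. x j) * (\<Prod>j\<in>J - {i}. x j)) =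
          a I * b J * (\<Sum>D\<in>Pow (I \<inter> J - {i}). wick (I - insert i D) (J - insert i D) x)"
        using IJ by (subst prod_mult_prod_eq_sum_wick) simp_all
    qed
    also have "\<dots> = a I * b J * (\<Sum>C\<in>Pow (I \<inter> J). real (card C) * wick (I - C) (J - C) x)"
      using IJ by (subst sum_insert_Pow[symmetric]) (simp_all add: sum_distrib_left)
    finally show ?thesis .
  qed
  have "grad_prod (hom_poly d a) (hom_poly k b) x = (\<Sum>i\<in>V. \<Sum>I\<in>nsets V d. \<Sum>J\<in>nsets V k.
      (if i \<in> I then a I * (\<Prod>j\<in>I - {i}. x j) else 0) * (if i \<in> J then b J * (\<Prod>j\<in>J - {i}. x j) else 0))"
    using assms by (simp only: grad_prod_hom_poly dpoly_def sum_product)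
  also have "\<dots> = (\<Sum>I\<in>nsets V d. \<Sum>i\<in>V. \<Sum>J\<in>nsets V k.
      (if i \<in> I then a I * (\<Prod>j\<in>I - {i}. x j) else 0) * (if i \<in> J then b J * (\<Prod>j\<in>J - {i}. x j) else 0))"
    by (rule sum.swap)
  also have "\<dots> = (\<Sum>I\<in>nsets V d. \<Sum>J\<in>nsets V k. \<Sum>i\<in>V.
      (if i \<in> I then a I * (\<Prod>j\<in>I - {i}. x j) else 0) * (if i \<in> J then b J * (\<Prod>j\<in>J - {i}. x j) else 0))"
    by (intro sum.cong refl sum.swap)
  also have "\<dots> = (\<Sum>I\<in>nsets V d. \<Sum>J\<in>nsets V k.
      a I * b J * (\<Sum>C\<in>Pow (I \<inter> J). real (card C) * wick (I - C) (J - C) x))"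
    by (intro sum.cong refl inner)
  also have "\<dots> = (\<Sum>c\<le>k. real c * component V d k a b c x)"
    using V assms(3) by (rule sum_wick_eq_sum_component)
  finally show ?thesis .
qed

lemma hom_poly_mult_eq_sum_component:
  assumes "supported V d a" "supported V k b" "k \<le> d"
  shows "hom_poly d a x * hom_poly k b x = (\<Sum>c\<le>k. component V d k a b c x)"
proof -
  have V: "finite V" using assms(1) by (rule supportedD)
  have "hom_poly d a x * hom_poly k b x = (\<Sum>I\<in>nsets V d. \<Sum>J\<in>nsets V k.
      a I * b J * ((\<Prod>i\<in>I. x i) * (\<Prod>j\<in>J. x j)))"
    using assms by (simp add: hom_poly_eq sum_product mult_ac)
  also have "\<dots> = (\<Sum>I\<in>nsets V d. \<Sum>J\<in>nsets V k.
      a I * b J * (\<Sum>C\<in>Pow (I \<inter> J). 1 * wick (I - C) (J - C) x))"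
    by (intro sum.cong refl) (subst prod_mult_prod_eq_sum_wick; simp add: in_nsets)
  also have "\<dots> = (\<Sum>c\<le>k. 1 * component V d k a b c x)"
    using V assms(3) by (rule sum_wick_eq_sum_component)
  finally show ?thesis by simp
qed

text \<open>Full contraction leaves no variables, so \<open>Y_d\<close> is a constant, by
  orthogonality the mean of the square of the polynomial.\<close>

lemma component_top:
  assumes V: "finite V"
  shows "component V d d a a d x = (\<Sum>I\<in>nsets V d. (a I)\<^sup>2)"
  by (simp add: component_def nsets_0 contraction_def split_coeff_def wick_def power2_eq_square)

text \<open>Euler's identity: each monomial is recovered once from each of its \<open>d\<close>
  variables.\<close>

lemma euler_hom_poly:
  assumes "supported V d a"
  shows "(\<Sum>i\<in>V. x i * dpoly V d a i x) = real d * hom_poly d a x"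
proof -
  have V: "finite V" using assms(1) by (rule supportedD)
  have "(\<Sum>i\<in>V. x i * dpoly V d a i x) =
      (\<Sum>I\<in>nsets V d. \<Sum>i\<in>V. if i \<in> I then a I * (x i * (\<Prod>j\<in>I - {i}. x j)) else 0)"
    unfolding dpoly_def sum_distrib_left by (subst sum.swap) (intro sum.cong refl, simp)
  also have "\<dots> = (\<Sum>I\<in>nsets V d. real d * (a I * (\<Prod>i\<in>I. x i)))"
  proof (rule sum.cong[OF refl])
    fix I assume "I \<in> nsets V d"
    then have I: "I \<subseteq> V" "finite I" "card I = d" by (auto simp: in_nsets)
    have "(\<Sum>i\<in>V. if i \<in> I then a I * (x i * (\<Prod>j\<in>I - {i}. x j)) else 0) =
        (\<Sum>i\<in>I. a I * (\<Prod>i\<in>I. x i))"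
      using I V by (intro sum.mono_neutral_cong_right) (auto simp: prod.remove[symmetric])
    then show "(\<Sum>i\<in>V. if i \<in> I then a I * (x i * (\<Prod>j\<in>I - {i}. x j)) else 0) =
        real d * (a I * (\<Prod>i\<in>I. x i))"
      using I by simp
  qed
  finally show ?thesis
    using assms by (simp add: hom_poly_eq sum_distrib_left)
qed

section \<open>Orthogonality\<close>

text \<open>Unlike integrability, this property passes to products, so it settles every
  integrability question about polynomials in the Gaussians.\<close>

definition (in prob_space) all_moments :: "('a \<Rightarrow> real) \<Rightarrow> bool" where
  "all_moments f \<longleftrightarrow> f \<in> borel_measurable M \<and> (\<forall>n. integrable M (\<lambda>\<omega>. \<bar>f \<omega>\<bar> ^ n))"

section \<open>Closure properties of variables with all moments\<close>

context prob_space
begin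

lemma all_moments_integrable: "all_moments f \<Longrightarrow> integrable M f"
  unfolding all_moments_def
  by (rule Bochner_Integration.integrable_bound[of _ "\<lambda>\<omega>. \<bar>f \<omega>\<bar> ^ 1"]) (blast, auto)

lemma all_moments_measurable: "all_moments f \<Longrightarrow> f \<in> borel_measurable M"
  by (simp add: all_moments_def)

lemma all_moments_const: "all_moments (\<lambda>_. c)"
  by (simp add: all_moments_def)

lemma all_moments_add:
  assumes "all_moments f" "all_moments g"
  shows "all_moments (\<lambda>\<omega>. f \<omega> + g \<omega>)"
  unfolding all_moments_def
proof (intro conjI allI)
  note [measurable] = assms[THEN all_moments_measurable]
  show "(\<lambda>\<omega>. f \<omega> + g \<omega>) \<in> borel_measurable M" by simp
  fix n
  have le: "\<bar>x + y\<bar> ^ n \<le> 2 ^ n * (\<bar>x\<bar> ^ n + \<bar>y\<bar> ^ n)" for x y :: real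
  proof -
    have "\<bar>x + y\<bar> ^ n \<le> (2 * max \<bar>x\<bar> \<bar>y\<bar>) ^ n"
      by (intro power_mono) auto
    also have "\<dots> \<le> 2 ^ n * (\<bar>x\<bar> ^ n + \<bar>y\<bar> ^ n)"
      by (auto simp: power_mult_distrib max_def)
    finally show ?thesis .
  qed
  show "integrable M (\<lambda>\<omega>. \<bar>f \<omega> + g \<omega>\<bar> ^ n)"
  proof (rule Bochner_Integration.integrable_bound)
    show "integrable M (\<lambda>\<omega>. 2 ^ n * (\<bar>f \<omega>\<bar> ^ n + \<bar>g \<omega>\<bar> ^ n))"
      using assms by (auto simp: all_moments_def)
    show "AE \<omega> in M. norm (\<bar>f \<omega> + g \<omega>\<bar> ^ n) \<le> norm (2 ^ n * (\<bar>f \<omega>\<bar> ^ n + \<bar>g \<omega>\<bar> ^ n))"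
      using le by (auto intro!: AE_I2)
  qed simp
qed

lemma all_moments_mult:
  assumes "all_moments f" "all_moments g"
  shows "all_moments (\<lambda>\<omega>. f \<omega> * g \<omega>)"
  unfolding all_moments_def
proof (intro conjI allI)
  note [measurable] = assms[THEN all_moments_measurable]
  show "(\<lambda>\<omega>. f \<omega> * g \<omega>) \<in> borel_measurable M" by simp
  fix n
  have le: "\<bar>x * y\<bar> ^ n \<le> \<bar>x\<bar> ^ (n * 2) + \<bar>y\<bar> ^ (n * 2)" for x y :: real
    using sum_squares_bound[of "\<bar>x\<bar> ^ n" "\<bar>y\<bar> ^ n"] zero_le_power2[of "\<bar>x\<bar> ^ n"] zero_le_power2[of "\<bar>y\<bar> ^ n"]
    unfolding power_mult abs_mult power_mult_distrib by linarith
  show "integrable M (\<lambda>\<omega>. \<bar>f \<omega> * g \<omega>\<bar> ^ n)"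
  proof (rule Bochner_Integration.integrable_bound)
    show "integrable M (\<lambda>\<omega>. \<bar>f \<omega>\<bar> ^ (n * 2) + \<bar>g \<omega>\<bar> ^ (n * 2))"
      using assms unfolding all_moments_def by (intro Bochner_Integration.integrable_add) blast+
    show "AE \<omega> in M. norm (\<bar>f \<omega> * g \<omega>\<bar> ^ n) \<le> norm (\<bar>f \<omega>\<bar> ^ (n * 2) + \<bar>g \<omega>\<bar> ^ (n * 2))"
      using le by (auto intro!: AE_I2)
  qed simp
qed

lemma all_moments_diff: "all_moments f \<Longrightarrow> all_moments g \<Longrightarrow> all_moments (\<lambda>\<omega>. f \<omega> - g \<omega>)"
  using all_moments_add[of f "\<lambda>\<omega>. - 1 * g \<omega>"] all_moments_mult[of "\<lambda>_. - 1" g] all_moments_const[of "-1"] by simp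

lemma all_moments_sum: "(\<And>i. i \<in> I \<Longrightarrow> all_moments (f i)) \<Longrightarrow> all_moments (\<lambda>\<omega>. \<Sum>i\<in>I. f i \<omega>)"
  by (induction I rule: infinite_finite_induct) (auto intro: all_moments_add all_moments_const)

lemma all_moments_prod: "(\<And>i. i \<in> I \<Longrightarrow> all_moments (f i)) \<Longrightarrow> all_moments (\<lambda>\<omega>. \<Prod>i\<in>I. f i \<omega>)"
  by (induction I rule: infinite_finite_induct) (auto intro: all_moments_mult all_moments_const)

lemma all_moments_power: "all_moments f \<Longrightarrow> all_moments (\<lambda>\<omega>. f \<omega> ^ n)"
  by (induction n) (auto intro: all_moments_mult all_moments_const)

lemmas all_moments_intros = all_moments_const all_moments_add all_moments_mult all_moments_diff
  all_moments_sum all_moments_prod all_moments_power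

end

section \<open>Wick products as products of Hermite polynomials\<close>

lemma nsets_subset_trans: "I \<in> nsets V d \<Longrightarrow> V \<subseteq> W \<Longrightarrow> I \<subseteq> W"
  by (auto simp: in_nsets)

text \<open>Agreement of unions and intersections, as demanded by \<open>gram\<close>, is the same
  as agreement of the multiplicities 0, 1 or 2 of every index.\<close>

lemma of_bool_add_eq_iff:
  "(of_bool p + of_bool q :: nat) = of_bool r + of_bool s \<longleftrightarrow> (p \<or> q \<longleftrightarrow> r \<or> s) \<and> (p \<and> q \<longleftrightarrow> r \<and> s)"
  by (cases p; cases q; cases r; cases s) simp_all

text \<open>The probabilists' Hermite polynomials of degree 0, 1 and 2. Larger \<open>n\<close> fall
  into the last case, but an index occurs at most twice in a pair of sets.\<close>

definition hermite :: "nat \<Rightarrow> real \<Rightarrow> real" where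
  "hermite n x = (if n = 0 then 1 else if n = 1 then x else x\<^sup>2 - 1)"

lemma hermite_simps: "hermite 0 x = 1" "hermite 1 x = x" "hermite (Suc 0) x = x" "hermite 2 x = x\<^sup>2 - 1"
  by (auto simp: hermite_def)

lemma wick_eq_prod_hermite:
  assumes "finite V" "A \<subseteq> V" "B \<subseteq> V"
  shows "wick A B x = (\<Prod>i\<in>V. hermite (of_bool (i \<in> A) + of_bool (i \<in> B)) (x i))"
proof -
  have V: "V = ((A - B) \<union> (B - A)) \<union> (A \<inter> B) \<union> (V - (A \<union> B))"
    using assms by auto
  have fin: "finite A" "finite B" using assms finite_subset by auto
  let ?h = "\<lambda>i. hermite (of_bool (i \<in> A) + of_bool (i \<in> B)) (x i)"
  have "(\<Prod>i\<in>V. ?h i) = (\<Prod>i\<in>(A - B) \<union> (B - A). ?h i) * (\<Prod>i\<in>A \<inter> B. ?h i) * (\<Prod>i\<in>V - (A \<union> B). ?h i)"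
    by (subst V, subst prod.union_disjoint, (use assms fin in auto)[3],
        subst prod.union_disjoint, (use assms fin in auto)[3], rule refl)
  also have "(\<Prod>i\<in>(A - B) \<union> (B - A). ?h i) = (\<Prod>i\<in>(A - B) \<union> (B - A). x i)"
    by (intro prod.cong) (auto simp: hermite_simps)
  also have "(\<Prod>i\<in>A \<inter> B. ?h i) = (\<Prod>i\<in>A \<inter> B. (x i)\<^sup>2 - 1)"
    by (intro prod.cong) (auto simp: hermite_def)
  also have "(\<Prod>i\<in>V - (A \<union> B). ?h i) = 1"
    by (intro prod.neutral) (auto simp: hermite_simps)
  finally show ?thesis
    by (simp add: wick_def)
qed

section \<open>Inner products of polynomials in independent Gaussians\<close>

locale gaussian_sequence = prob_space M for M :: "'a measure" +
  fixes G :: "nat \<Rightarrow> 'a \<Rightarrow> real"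
  assumes indep_G: "indep_vars (\<lambda>_. borel) G {1..}"
    and distributed_G: "i \<ge> 1 \<Longrightarrow> distributed M lborel (G i) std_normal_density"
begin

abbreviation ev :: "((nat \<Rightarrow> real) \<Rightarrow> real) \<Rightarrow> 'a \<Rightarrow> real" where
  "ev P \<equiv> at_vars G P"

lemma G_measurable[measurable]: "i \<ge> 1 \<Longrightarrow> G i \<in> borel_measurable M"
  using distributed_measurable[OF distributed_G] by simp

lemma distr_G: "i \<ge> 1 \<Longrightarrow> distr M borel (G i) = std_normal_distribution"
  using distributed_distr_eq_density[OF distributed_G]
  by (metis distr_cong sets_lborel)

lemma all_moments_G: "i \<ge> 1 \<Longrightarrow> all_moments (G i)"
  unfolding all_moments_def
proof (intro conjI allI)
  fix n assume i: "i \<ge> 1"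
  have "integrable (distr M borel (G i)) (\<lambda>x. \<bar>x\<bar> ^ n)"
    using integrable_std_normal_moment_abs[of n]
    by (simp add: distr_G[OF i] integrable_density normal_density_nonneg)
  then show "integrable M (\<lambda>\<omega>. \<bar>G i \<omega>\<bar> ^ n)"
    using i by (subst (asm) integrable_distr_eq) auto
qed simp

lemma moment_G:
  assumes "i \<ge> 1"
  shows "expectation (\<lambda>\<omega>. G i \<omega> ^ n) = (if even n then fact n / (2 ^ (n div 2) * fact (n div 2)) else 0)"
proof -
  have "expectation (\<lambda>\<omega>. G i \<omega> ^ n) = (LINT x|distr M borel (G i). x ^ n)"
    using assms by (subst integral_distr) auto
  then show ?thesis
    using std_normal_distribution_even_moments(1)[of "n div 2"]
    by (cases "even n") (simp_all add: distr_G[OF assms] integral_std_normal_distribution_moment_odd)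
qed

text \<open>Only the moments 0, 1, 0, 3 of orders 1 to 4 enter; the value 2 is
  \<open>3 - 2 + 1\<close>.\<close>

lemma hermite_orthogonal:
  assumes i: "i \<ge> 1" and "m \<le> 2" "n \<le> 2"
  shows "expectation (\<lambda>\<omega>. hermite m (G i \<omega>) * hermite n (G i \<omega>)) =
    (if m = n then (if n = 2 then 2 else 1) else 0)"
proof -
  have int: "integrable M (\<lambda>\<omega>. G i \<omega> ^ k)" for k
    using i by (intro all_moments_integrable all_moments_intros all_moments_G)
  have m1: "expectation (\<lambda>\<omega>. G i \<omega>) = 0" "integrable M (G i)"
    using moment_G[OF i, of 1] int[of 1] by simp_all
  have m2: "expectation (\<lambda>\<omega>. (G i \<omega>)\<^sup>2) = 1"
    using moment_G[OF i, of 2] by simp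
  have m3: "expectation (\<lambda>\<omega>. G i \<omega> ^ 3) = 0"
    using moment_G[OF i, of 3] by simp
  have m4: "expectation (\<lambda>\<omega>. G i \<omega> ^ 4) = 3"
    using moment_G[OF i, of 4] by (simp add: fact_numeral)
  have e: "x * (x\<^sup>2 - 1) = x ^ 3 - x" "(x\<^sup>2 - 1) * x = x ^ 3 - x"
    "(x\<^sup>2 - 1) * (x\<^sup>2 - 1) = x ^ 4 - 2 * x\<^sup>2 + 1" "(x\<^sup>2 - 1)\<^sup>2 = x ^ 4 - 2 * x\<^sup>2 + 1"
    "x * x = x\<^sup>2" for x :: real
    by (auto simp: algebra_simps power2_eq_square power3_eq_cube power4_eq_xxxx)
  have "m = 0 \<or> m = 1 \<or> m = 2" "n = 0 \<or> n = 1 \<or> n = 2"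
    using assms by auto
  then show ?thesis
    using int m1 m2 m3 m4 by (auto simp: hermite_simps e prob_space)
qed

text \<open>Independence factors the expectation over the indices. A factor vanishes where the
  multiplicities differ, and equals 2 where both are 2.\<close>

lemma expectation_wick_mult:
  assumes "finite V" "V \<subseteq> {1..}" "A \<subseteq> V" "B \<subseteq> V" "A' \<subseteq> V" "B' \<subseteq> V"
  shows "expectation (\<lambda>\<omega>. ev (wick A B) \<omega> * ev (wick A' B') \<omega>) = gram A B A' B'"
proof -
  let ?m = "\<lambda>i. of_bool (i \<in> A) + of_bool (i \<in> B) :: nat"
  let ?m' = "\<lambda>i. of_bool (i \<in> A') + of_bool (i \<in> B') :: nat"
  have [measurable]: "hermite n \<in> borel_measurable borel" for n
    unfolding hermite_def by measurable
  have "ev (wick A B) \<omega> * ev (wick A' B') \<omega> = (\<Prod>i\<in>V. hermite (?m i) (G i \<omega>) * hermite (?m' i) (G i \<omega>))" for \<omega>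
    using assms by (simp add: at_vars_def wick_eq_prod_hermite[of V] prod.distrib)
  then have "expectation (\<lambda>\<omega>. ev (wick A B) \<omega> * ev (wick A' B') \<omega>) =
      expectation (\<lambda>\<omega>. \<Prod>i\<in>V. hermite (?m i) (G i \<omega>) * hermite (?m' i) (G i \<omega>))"
    by simp
  also have "\<dots> = (\<Prod>i\<in>V. expectation (\<lambda>\<omega>. hermite (?m i) (G i \<omega>) * hermite (?m' i) (G i \<omega>)))"
  proof (rule indep_vars_lebesgue_integral[OF \<open>finite V\<close>])
    show "indep_vars (\<lambda>_. borel) (\<lambda>i \<omega>. hermite (?m i) (G i \<omega>) * hermite (?m' i) (G i \<omega>)) V"
      using assms(2) by (intro indep_vars_compose2[OF indep_vars_subset[OF indep_G]]) auto
    show "integrable M (\<lambda>\<omega>. hermite (?m i) (G i \<omega>) * hermite (?m' i) (G i \<omega>))" if "i \<in> V" for i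
    proof -
      have "all_moments (\<lambda>\<omega>. hermite n (G i \<omega>))" for n
        using that assms(2) unfolding hermite_def
        by (cases "n = 0"; cases "n = 1") (auto intro!: all_moments_intros all_moments_G)
      then show ?thesis
        by (intro all_moments_integrable all_moments_intros)
    qed
  qed
  also have "\<dots> = (\<Prod>i\<in>V. if ?m i = ?m' i then (if ?m' i = 2 then 2 else 1) else 0)"
    using assms(2) by (intro prod.cong refl hermite_orthogonal) auto
  also have "\<dots> = gram A B A' B'"
  proof (cases "A \<union> B = A' \<union> B' \<and> A \<inter> B = A' \<inter> B'")
    case True
    have m: "?m' i = ?m i" for i
      using True unfolding of_bool_add_eq_iff by (simp add: set_eq_iff)
    have "(\<Prod>i\<in>V. if ?m i = ?m' i then (if ?m' i = 2 then 2 else 1) else 0) =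
        (\<Prod>i\<in>V. if i \<in> A \<inter> B then 2 else (1 :: real))"
      unfolding m by (intro prod.cong) auto
    also have "\<dots> = (\<Prod>i\<in>A \<inter> B. 2)"
      using assms by (intro prod.mono_neutral_cong_right) auto
    finally show ?thesis
      using True by (simp add: gram_def)
  next
    case False
    then obtain i where i: "?m i \<noteq> ?m' i"
      unfolding of_bool_add_eq_iff by (auto simp: set_eq_iff)
    moreover from i have "i \<in> V"
      using assms unfolding of_bool_add_eq_iff by blast
    ultimately have i: "i \<in> V" "?m i \<noteq> ?m' i" by auto
    with \<open>finite V\<close> have "(\<Prod>i\<in>V. if ?m i = ?m' i then (if ?m' i = 2 then 2 else 1) else (0 :: real)) = 0"
      by (intro prod_zero bexI[of _ i] if_not_P) auto
    with False show ?thesis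
      by (simp add: gram_def)
  qed
  finally show ?thesis .
qed

lemma all_moments_wick:
  assumes "A \<subseteq> {1..}" "B \<subseteq> {1..}"
  shows "all_moments (ev (wick A B))"
  using assms unfolding at_vars_def wick_def
  by (auto intro!: all_moments_intros all_moments_G)

lemma all_moments_hom_poly: "all_moments (ev (hom_poly d a))"
  unfolding at_vars_def hom_poly_def
  by (auto intro!: all_moments_intros all_moments_G simp: in_nsets)

lemma all_moments_dpoly:
  assumes "V \<subseteq> {1..}"
  shows "all_moments (ev (dpoly V d a i))"
proof -
  have "all_moments (\<lambda>\<omega>. if i \<in> I then a I * (\<Prod>j\<in>I - {i}. G j \<omega>) else 0)" if "I \<in> nsets V d" for I
    using that assms by (cases "i \<in> I") (auto intro!: all_moments_intros all_moments_G simp: in_nsets)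
  then show ?thesis
    unfolding at_vars_def dpoly_def by (auto intro!: all_moments_sum)
qed

lemma all_moments_component:
  assumes "V \<subseteq> {1..}"
  shows "all_moments (ev (component V d k a b c))"
  using assms unfolding at_vars_def component_def
  by (intro all_moments_intros all_moments_wick[unfolded at_vars_def] nsets_subset_trans[OF _ assms])

lemma expectation_component_mult:
  assumes V: "finite V" "V \<subseteq> {1..}"
  shows "expectation (\<lambda>\<omega>. ev (component V d k a b c) \<omega> * ev (component V d k a b c') \<omega>) =
    (\<Sum>x\<in>nsets V (d - c) \<times> nsets V (k - c). \<Sum>y\<in>nsets V (d - c') \<times> nsets V (k - c').
      contraction V c a b (fst x) (snd x) * contraction V c' a b (fst y) (snd y) *
      gram (fst x) (snd x) (fst y) (snd y))"
proof -
  let ?X = "nsets V (d - c) \<times> nsets V (k - c)" and ?Y = "nsets V (d - c') \<times> nsets V (k - c')"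
  have "ev (component V d k a b c) \<omega> * ev (component V d k a b c') \<omega> = (\<Sum>x\<in>?X. \<Sum>y\<in>?Y.
      (contraction V c a b (fst x) (snd x) * contraction V c' a b (fst y) (snd y)) *
      (ev (wick (fst x) (snd x)) \<omega> * ev (wick (fst y) (snd y)) \<omega>))" for \<omega>
    unfolding at_vars_def component_def sum.cartesian_product sum_product
    by (simp add: split_def mult_ac)
  then have "expectation (\<lambda>\<omega>. ev (component V d k a b c) \<omega> * ev (component V d k a b c') \<omega>) =
      expectation (\<lambda>\<omega>. \<Sum>x\<in>?X. \<Sum>y\<in>?Y.
      (contraction V c a b (fst x) (snd x) * contraction V c' a b (fst y) (snd y)) *
      (ev (wick (fst x) (snd x)) \<omega> * ev (wick (fst y) (snd y)) \<omega>))"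
    by simp
  also have "\<dots> = (\<Sum>x\<in>?X. \<Sum>y\<in>?Y. expectation (\<lambda>\<omega>.
      (contraction V c a b (fst x) (snd x) * contraction V c' a b (fst y) (snd y)) *
      (ev (wick (fst x) (snd x)) \<omega> * ev (wick (fst y) (snd y)) \<omega>)))"
  proof -
    have am: "all_moments (\<lambda>\<omega>. u * (ev (wick (fst x) (snd x)) \<omega> * ev (wick (fst y) (snd y)) \<omega>))"
      if "x \<in> ?X" "y \<in> ?Y" for x y u
      using that by (intro all_moments_intros all_moments_wick nsets_subset_trans[OF _ V(2)]) auto
    show ?thesis
      by (subst Bochner_Integration.integral_sum,
          (intro all_moments_integrable all_moments_sum am; assumption),
          intro sum.cong refl Bochner_Integration.integral_sum all_moments_integrable am)
  qed
  also have "\<dots> = (\<Sum>x\<in>?X. \<Sum>y\<in>?Y.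
      contraction V c a b (fst x) (snd x) * contraction V c' a b (fst y) (snd y) *
      gram (fst x) (snd x) (fst y) (snd y))"
  proof (intro sum.cong refl)
    fix x y assume "x \<in> ?X" "y \<in> ?Y"
    then show "expectation (\<lambda>\<omega>.
      (contraction V c a b (fst x) (snd x) * contraction V c' a b (fst y) (snd y)) *
      (ev (wick (fst x) (snd x)) \<omega> * ev (wick (fst y) (snd y)) \<omega>)) =
      contraction V c a b (fst x) (snd x) * contraction V c' a b (fst y) (snd y) *
      gram (fst x) (snd x) (fst y) (snd y)"
      using V by (subst integral_mult_right_zero, subst expectation_wick_mult[of V]) (auto simp: in_nsets)
  qed
  finally show ?thesis .
qed

text \<open>A nonzero \<open>gram\<close> entry forces equal total degrees, that is
  \<open>(d - c) + (k - c) = (d - c') + (k - c')\<close>. The bounds by \<open>k\<close> and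
  \<open>d\<close> keep these subtractions from truncating, so \<open>c = c'\<close>.\<close>

lemma component_orthogonal:
  assumes V: "finite V" "V \<subseteq> {1..}" and "c \<le> k" "c' \<le> k" "k \<le> d" "c \<noteq> c'"
  shows "expectation (\<lambda>\<omega>. ev (component V d k a b c) \<omega> * ev (component V d k a b c') \<omega>) = 0"
  unfolding expectation_component_mult[OF V]
proof (intro sum.neutral ballI)
  fix x y assume x: "x \<in> nsets V (d - c) \<times> nsets V (k - c)" and y: "y \<in> nsets V (d - c') \<times> nsets V (k - c')"
  have "gram (fst x) (snd x) (fst y) (snd y) = 0"
  proof (rule ccontr)
    assume "gram (fst x) (snd x) (fst y) (snd y) \<noteq> 0"
    then have "fst x \<union> snd x = fst y \<union> snd y" "fst x \<inter> snd x = fst y \<inter> snd y"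
      unfolding gram_def by metis+
    then have "card (fst x) + card (snd x) = card (fst y) + card (snd y)"
      using x y by (subst (1 2) card_Un_Int) (auto simp: in_nsets)
    with x y assms show False by (auto simp: in_nsets)
  qed
  then show "contraction V c a b (fst x) (snd x) * contraction V c' a b (fst y) (snd y) *
      gram (fst x) (snd x) (fst y) (snd y) = 0" by simp
qed

text \<open>\<open>gram_sum_le\<close> reduces the second moment to the Hilbert-Schmidt norm of the
  contraction, which the operator bound controls. The exponent \<open>d + k\<close> makes the
  constant independent of \<open>c\<close>.\<close>

lemma expectation_component_square_le:
  assumes V: "finite V" "V \<subseteq> {1..}" and "c \<le> k" "K \<ge> 0" "contraction_bound V d a c K"
  shows "expectation (\<lambda>\<omega>. (ev (component V d k a b c) \<omega>)\<^sup>2) \<le>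
    8 ^ (d + k) * (K * 2 ^ k * (\<Sum>J\<in>nsets V k. (b J)\<^sup>2))"
proof -
  let ?S = "\<Sum>x\<in>nsets V (d - c) \<times> nsets V (k - c). (contraction V c a b (fst x) (snd x))\<^sup>2"
  have "expectation (\<lambda>\<omega>. (ev (component V d k a b c) \<omega>)\<^sup>2) \<le> 8 ^ ((d - c) + (k - c)) * ?S"
    unfolding power2_eq_square[of "ev _ _"] expectation_component_mult[OF V] using V(1) by (rule gram_sum_le)
  also have "\<dots> \<le> 8 ^ (d + k) * ?S"
    by (intro mult_right_mono power_increasing sum_nonneg) auto
  also have "?S = (\<Sum>A\<in>nsets V (d - c). \<Sum>B\<in>nsets V (k - c). (contraction V c a b A B)\<^sup>2)"
    by (simp add: sum.cartesian_product split_def)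
  also have "8 ^ (d + k) * \<dots> \<le> 8 ^ (d + k) * (K * 2 ^ k * (\<Sum>J\<in>nsets V k. (b J)\<^sup>2))"
    using assms by (intro mult_left_mono sum_contraction_le) auto
  finally show ?thesis .
qed

text \<open>Pythagoras for the orthogonal components. The index set \<open>S\<close> is free so that
  the constant top component can be left out.\<close>

lemma expectation_sum_component_square:
  assumes V: "finite V" "V \<subseteq> {1..}" and "k \<le> d" and S: "S \<subseteq> {..k}"
  shows "expectation (\<lambda>\<omega>. (\<Sum>c\<in>S. w c * ev (component V d k a b c) \<omega>)\<^sup>2) =
    (\<Sum>c\<in>S. (w c)\<^sup>2 * expectation (\<lambda>\<omega>. (ev (component V d k a b c) \<omega>)\<^sup>2))"
proof -
  let ?Y = "\<lambda>c. ev (component V d k a b c)"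
  have fin: "finite S" using S by (rule finite_subset) simp
  have am: "all_moments (\<lambda>\<omega>. w c * w c' * (?Y c \<omega> * ?Y c' \<omega>))" for c c'
    using V by (intro all_moments_intros all_moments_component)
  have "expectation (\<lambda>\<omega>. (\<Sum>c\<in>S. w c * ?Y c \<omega>)\<^sup>2) =
      expectation (\<lambda>\<omega>. \<Sum>c\<in>S. \<Sum>c'\<in>S. w c * w c' * (?Y c \<omega> * ?Y c' \<omega>))"
    by (simp add: power2_eq_square sum_product mult_ac)
  also have "\<dots> = (\<Sum>c\<in>S. \<Sum>c'\<in>S. expectation (\<lambda>\<omega>. w c * w c' * (?Y c \<omega> * ?Y c' \<omega>)))"
    by (subst Bochner_Integration.integral_sum,
          (intro all_moments_integrable all_moments_sum am),
          intro sum.cong refl Bochner_Integration.integral_sum all_moments_integrable am)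
  also have "\<dots> = (\<Sum>c\<in>S. \<Sum>c'\<in>S. if c = c' then (w c)\<^sup>2 * expectation (\<lambda>\<omega>. (?Y c \<omega>)\<^sup>2) else 0)"
    using S component_orthogonal[OF V _ _ \<open>k \<le> d\<close>]
    by (intro sum.cong refl) (auto simp: power2_eq_square subset_iff)
  finally show ?thesis
    using fin by simp
qed

end

section \<open>Moments, gradient products and contractions\<close>

context gaussian_sequence
begin

text \<open>A monomial is \<open>wick I {}\<close>, and \<open>gram I {} J {}\<close> is 1 if
  \<open>I = J\<close> and 0 otherwise, so the monomials are orthonormal.\<close>

lemma expectation_hom_poly_square:
  assumes "supported V d a"
  shows "expectation (\<lambda>\<omega>. (ev (hom_poly d a) \<omega>)\<^sup>2) = (\<Sum>I\<in>nsets V d. (a I)\<^sup>2)"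
proof -
  note V = supportedD(1,2)[OF assms]
  have fin: "finite (nsets V d)"
    using V by (intro finite_imp_finite_nsets)
  have "(ev (hom_poly d a) \<omega>)\<^sup>2 = (\<Sum>I\<in>nsets V d. \<Sum>J\<in>nsets V d.
      a I * a J * (ev (wick I {}) \<omega> * ev (wick J {}) \<omega>))" for \<omega>
    by (simp add: at_vars_def hom_poly_eq[OF assms] wick_def power2_eq_square sum_product mult_ac)
  then have "expectation (\<lambda>\<omega>. (ev (hom_poly d a) \<omega>)\<^sup>2) =
      expectation (\<lambda>\<omega>. \<Sum>I\<in>nsets V d. \<Sum>J\<in>nsets V d. a I * a J * (ev (wick I {}) \<omega> * ev (wick J {}) \<omega>))"
    by simp
  also have "\<dots> = (\<Sum>I\<in>nsets V d. \<Sum>J\<in>nsets V d.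
      expectation (\<lambda>\<omega>. a I * a J * (ev (wick I {}) \<omega> * ev (wick J {}) \<omega>)))"
  proof -
    have am: "all_moments (\<lambda>\<omega>. a I * a J * (ev (wick I {}) \<omega> * ev (wick J {}) \<omega>))"
      if "I \<in> nsets V d" "J \<in> nsets V d" for I J
      using that by (intro all_moments_intros all_moments_wick empty_subsetI nsets_subset_trans[OF _ V(2)])
    show ?thesis
      by (subst Bochner_Integration.integral_sum,
          (intro all_moments_integrable all_moments_sum am; assumption),
          intro sum.cong refl Bochner_Integration.integral_sum all_moments_integrable am)
  qed
  also have "\<dots> = (\<Sum>I\<in>nsets V d. \<Sum>J\<in>nsets V d. if I = J then (a I)\<^sup>2 else 0)"
  proof (intro sum.cong refl)
    fix I J assume IJ: "I \<in> nsets V d" "J \<in> nsets V d"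
    have "expectation (\<lambda>\<omega>. ev (wick I {}) \<omega> * ev (wick J {}) \<omega>) = gram I {} J {}"
      using V IJ by (intro expectation_wick_mult[of V]) (auto simp: in_nsets)
    then show "expectation (\<lambda>\<omega>. a I * a J * (ev (wick I {}) \<omega> * ev (wick J {}) \<omega>)) = (if I = J then (a I)\<^sup>2 else 0)"
      by (simp add: gram_def power2_eq_square)
  qed
  finally show ?thesis
    using fin by simp
qed

text \<open>The square of \<open>F\<close> is the sum of the orthogonal \<open>Y_c\<close>, so the
  fourth moment is the sum of their second moments. \<open>Y_d\<close> contributes 1 and
  \<open>Y_0\<close> contributes 2 plus the contraction terms; the other components are
  discarded.\<close>

lemma fourth_moment_ge:
  assumes "supported V d a" "d \<ge> 1" and norm: "(\<Sum>I\<in>nsets V d. (a I)\<^sup>2) = 1"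
  shows "3 + (\<Sum>r\<in>{1..<d}. \<Sum>R\<in>nsets V r. \<Sum>B\<in>nsets V r. (contraction V (d - r) a a R B)\<^sup>2) \<le>
    expectation (\<lambda>\<omega>. (ev (hom_poly d a) \<omega>) ^ 4)"
proof -
  note V = supportedD(1,2)[OF assms(1)]
  let ?Y = "\<lambda>c. ev (component V d d a a c)"
  have "(ev (hom_poly d a) \<omega>) ^ 4 = (\<Sum>c\<in>{..d}. 1 * ?Y c \<omega>)\<^sup>2" for \<omega>
    using hom_poly_mult_eq_sum_component[OF assms(1) assms(1), of "\<lambda>i. G i \<omega>"]
    by (simp add: at_vars_def power2_eq_square power4_eq_xxxx mult_ac)
  then have "expectation (\<lambda>\<omega>. (ev (hom_poly d a) \<omega>) ^ 4) = expectation (\<lambda>\<omega>. (\<Sum>c\<in>{..d}. 1 * ?Y c \<omega>)\<^sup>2)"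
    by simp
  also have "\<dots> = (\<Sum>c\<in>{..d}. 1\<^sup>2 * expectation (\<lambda>\<omega>. (?Y c \<omega>)\<^sup>2))"
    by (rule expectation_sum_component_square[OF V]) auto
  also have "\<dots> \<ge> (\<Sum>c\<in>{0, d}. 1\<^sup>2 * expectation (\<lambda>\<omega>. (?Y c \<omega>)\<^sup>2))"
    by (intro sum_mono2) auto
  also have "(\<Sum>c\<in>{0, d}. 1\<^sup>2 * expectation (\<lambda>\<omega>. (?Y c \<omega>)\<^sup>2)) =
      expectation (\<lambda>\<omega>. (?Y 0 \<omega>)\<^sup>2) + expectation (\<lambda>\<omega>. (?Y d \<omega>)\<^sup>2)"
    using \<open>d \<ge> 1\<close> by simp
  also have "expectation (\<lambda>\<omega>. (?Y d \<omega>)\<^sup>2) = 1"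
    using norm by (simp add: at_vars_def component_top[OF V(1)] prob_space)
  also have "expectation (\<lambda>\<omega>. (?Y 0 \<omega>)\<^sup>2) = (\<Sum>x\<in>nsets V d \<times> nsets V d. \<Sum>y\<in>nsets V d \<times> nsets V d.
      a (fst x) * a (snd x) * (a (fst y) * a (snd y)) * gram (fst x) (snd x) (fst y) (snd y))"
    unfolding power2_eq_square[of "ev _ _"] expectation_component_mult[OF V]
    by (simp add: contraction_def nsets_0 split_coeff_def)
  also have "\<dots> = (\<Sum>I\<in>nsets V d. \<Sum>J\<in>nsets V d. \<Sum>K\<in>nsets V d. \<Sum>L\<in>nsets V d. a I * a J * (a K * a L) *
      (if I \<union> J = K \<union> L \<and> I \<inter> J = K \<inter> L then 2 ^ card (I \<inter> J) else 0))"
    by (simp only: gram_def sum.cartesian_product' fst_conv snd_conv)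
  also have "\<dots> = 2 + (\<Sum>r\<in>{1..<d}. \<Sum>R\<in>nsets V r. \<Sum>B\<in>nsets V r. (contraction V (d - r) a a R B)\<^sup>2)"
    unfolding sum_gram_eq_sum_contraction_squares[OF V(1)]
      sum_contraction_squares_eq[OF V(1) \<open>d \<ge> 1\<close>, symmetric] norm by simp
  finally show ?thesis by simp
qed

text \<open>The component of order 0 has weight 0 and the order \<open>d\<close> is removed, so only
  orders \<open>1 \<le> c < d\<close>, to which \<open>bound\<close> applies, have to be
  estimated.\<close>

lemma lower_components_square_le:
  assumes "finite V" "V \<subseteq> {1..}" "k \<le> d" "K \<ge> 0"
    and bound: "\<And>c. 1 \<le> c \<Longrightarrow> c < d \<Longrightarrow> contraction_bound V d a c K"
  shows "expectation (\<lambda>\<omega>. (\<Sum>c\<in>{..k} - {d}. real c * ev (component V d k a b c) \<omega>)\<^sup>2) \<le>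
    (\<Sum>c\<le>k. (real c)\<^sup>2) * (8 ^ (d + k) * 2 ^ k) * K * (\<Sum>J\<in>nsets V k. (b J)\<^sup>2)"
proof -
  let ?B = "8 ^ (d + k) * (K * 2 ^ k * (\<Sum>J\<in>nsets V k. (b J)\<^sup>2))"
  have B: "?B \<ge> 0" using \<open>K \<ge> 0\<close> by (simp add: sum_nonneg)
  have "expectation (\<lambda>\<omega>. (\<Sum>c\<in>{..k} - {d}. real c * ev (component V d k a b c) \<omega>)\<^sup>2) =
      (\<Sum>c\<in>{..k} - {d}. (real c)\<^sup>2 * expectation (\<lambda>\<omega>. (ev (component V d k a b c) \<omega>)\<^sup>2))"
    using assms by (intro expectation_sum_component_square) auto
  also have "\<dots> \<le> (\<Sum>c\<in>{..k} - {d}. (real c)\<^sup>2 * ?B)"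
  proof (rule sum_mono)
    fix c assume c: "c \<in> {..k} - {d}"
    show "(real c)\<^sup>2 * expectation (\<lambda>\<omega>. (ev (component V d k a b c) \<omega>)\<^sup>2) \<le> (real c)\<^sup>2 * ?B"
    proof (cases "c = 0")
      case False
      with c assms show ?thesis
        by (intro mult_left_mono expectation_component_square_le bound) auto
    qed simp
  qed
  also have "\<dots> \<le> (\<Sum>c\<in>{..k}. (real c)\<^sup>2 * ?B)"
    using B by (intro sum_mono2) auto
  also have "\<dots> = (\<Sum>c\<le>k. (real c)\<^sup>2) * ?B"
    by (rule sum_distrib_right[symmetric])
  finally show ?thesis by (simp add: mult_ac)
qed

text \<open>
  Multiplying a test polynomial of degree \<open>r\<close> by \<open>k - r\<close> variables that do not occur in \<open>F\<close>
  turns it into a test polynomial of degree \<open>k\<close>; its order-\<open>r\<close> contraction with \<open>F\<close> is the image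
  of the original coefficients.
\<close>

lemma contraction_bound_of_grad_prod_bound:
  assumes a: "supported V d a" and r: "1 \<le> r" "r \<le> k" and k: "k \<le> d"
    and R: "\<And>b. fin_coeffs k b \<Longrightarrow> expectation (\<lambda>\<omega>. (ev (hom_poly k b) \<omega>)\<^sup>2) \<le> 1 \<Longrightarrow>
      expectation (\<lambda>\<omega>. (ev (grad_prod (hom_poly d a) (hom_poly k b)) \<omega>)\<^sup>2) \<le> R"
  shows "contraction_bound V d a r R"
  unfolding contraction_bound_def
proof (intro allI)
  fix v :: "nat set \<Rightarrow> real"
  note V = supportedD(1,2)[OF a]
  have fin: "finite (nsets V m)" for m using V(1) by (rule finite_imp_finite_nsets)
  define s where "s = (\<Sum>C\<in>nsets V r. (v C)\<^sup>2)"
  show "(\<Sum>A\<in>nsets V (d - r). (\<Sum>C\<in>nsets V r. split_coeff a A C * v C)\<^sup>2) \<le> R * s"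
  proof (cases "s = 0")
    case True
    then have "v C = 0" if "C \<in> nsets V r" for C
      using that fin by (simp add: s_def sum_nonneg_eq_0_iff)
    then show ?thesis using True by simp
  next
    case False
    have "s \<ge> 0" unfolding s_def by (intro sum_nonneg) auto
    with False have s: "s > 0" by simp
    have "infinite ({1 :: nat..} - V)"
      using V(1) by (intro Diff_infinite_finite) (auto simp: infinite_Ici)
    then obtain D where D: "D \<subseteq> {1..} - V" "finite D" "card D = k - r"
      using infinite_arbitrarily_large by blast
    define W where "W = V \<union> D"
    have W: "finite W" "W \<subseteq> {1..}" using V D by (auto simp: W_def)
    have finW: "finite (nsets W m)" for m using W(1) by (rule finite_imp_finite_nsets)
    have aW: "supported W d a"
      using a W by (intro supported_superset[of V d a W]) (auto simp: W_def)
    \<comment> \<open>The test polynomial is the product of the fresh variables in \<open>D\<close>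
      times the polynomial with coefficients \<open>v\<close>; division by \<open>sqrt s\<close>
      gives it norm 1.\<close>
    define b where "b J = (if D \<subseteq> J \<and> J - D \<in> nsets V r then v (J - D) / sqrt s else 0)" for J
    have b_D: "b (D \<union> C) = v C / sqrt s" if "C \<in> nsets V r" for C
    proof -
      have "D \<union> C - D = C" using that D by (auto simp: in_nsets)
      then show ?thesis using that by (simp add: b_def)
    qed
    have bW: "supported W k b"
      unfolding supported_def
    proof (intro conjI W ballI impI)
      fix J assume "b J \<noteq> 0"
      then have "D \<subseteq> J" "J - D \<subseteq> V" by (auto simp: b_def in_nsets split: if_splits)
      then show "J \<subseteq> W" by (auto simp: W_def)
    qed
    have "fin_coeffs k b"
      unfolding fin_coeffs_def
    proof (rule finite_subset)
      show "{J \<in> nsets {1..} k. b J \<noteq> 0} \<subseteq> nsets W k"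
        using bW by (auto simp: supported_def in_nsets)
    qed (rule finW)
    moreover have "expectation (\<lambda>\<omega>. (ev (hom_poly k b) \<omega>)\<^sup>2) = 1"
    proof -
      have "(\<Sum>J\<in>nsets W k. (b J)\<^sup>2) = (\<Sum>J\<in>(\<lambda>C. D \<union> C) ` nsets V r. (b J)\<^sup>2)"
      proof (rule sum.mono_neutral_right[OF finW])
        show "(\<lambda>C. D \<union> C) ` nsets V r \<subseteq> nsets W k"
        proof (rule image_subsetI)
          fix C assume C: "C \<in> nsets V r"
          then have "D \<inter> C = {}" using D by (auto simp: in_nsets)
          then show "D \<union> C \<in> nsets W k"
            using C D r by (auto simp: in_nsets W_def card_Un_disjoint)
        qed
        show "\<forall>J\<in>nsets W k - (\<lambda>C. D \<union> C) ` nsets V r. (b J)\<^sup>2 = 0"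
        proof
          fix J assume J: "J \<in> nsets W k - (\<lambda>C. D \<union> C) ` nsets V r"
          show "(b J)\<^sup>2 = 0"
          proof (rule ccontr)
            assume "(b J)\<^sup>2 \<noteq> 0"
            then have "D \<subseteq> J" "J - D \<in> nsets V r" by (auto simp: b_def split: if_splits)
            moreover from this have "J = D \<union> (J - D)" by auto
            ultimately show False using J by blast
          qed
        qed
      qed
      also have "\<dots> = (\<Sum>C\<in>nsets V r. (b (D \<union> C))\<^sup>2)"
      proof (rule sum.reindex_cong[OF _ refl refl])
        show "inj_on ((\<union>) D) (nsets V r)"
        proof (rule inj_onI)
          fix C C' assume C: "C \<in> nsets V r" "C' \<in> nsets V r" "D \<union> C = D \<union> C'"
          then have "D \<inter> C = {}" "D \<inter> C' = {}" using D by (auto simp: in_nsets)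
          with C show "C = C'" by blast
        qed
      qed
      also have "\<dots> = (\<Sum>C\<in>nsets V r. (v C)\<^sup>2 / s)"
        using s by (intro sum.cong refl) (simp add: b_D power_divide)
      also have "\<dots> = 1"
        using s by (simp add: s_def[symmetric] sum_divide_distrib[symmetric])
      finally show ?thesis
        using expectation_hom_poly_square[OF bW] by simp
    qed
    ultimately have "expectation (\<lambda>\<omega>. (ev (grad_prod (hom_poly d a) (hom_poly k b)) \<omega>)\<^sup>2) \<le> R"
      by (intro R) auto
    also have "expectation (\<lambda>\<omega>. (ev (grad_prod (hom_poly d a) (hom_poly k b)) \<omega>)\<^sup>2) =
        expectation (\<lambda>\<omega>. (\<Sum>c\<in>{..k}. real c * ev (component W d k a b c) \<omega>)\<^sup>2)"
      by (simp add: at_vars_def grad_prod_eq_sum_component[OF aW bW k])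
    also have "\<dots> = (\<Sum>c\<in>{..k}. (real c)\<^sup>2 * expectation (\<lambda>\<omega>. (ev (component W d k a b c) \<omega>)\<^sup>2))"
      using W k by (intro expectation_sum_component_square) auto
    finally have "(\<Sum>c\<in>{..k}. (real c)\<^sup>2 * expectation (\<lambda>\<omega>. (ev (component W d k a b c) \<omega>)\<^sup>2)) \<le> R" .
    \<comment> \<open>By orthogonality the component of order \<open>r\<close> alone obeys the
      bound, and its weight \<open>r^2\<close> is at least 1.\<close>
    moreover have "(\<Sum>c\<in>{r}. (real c)\<^sup>2 * expectation (\<lambda>\<omega>. (ev (component W d k a b c) \<omega>)\<^sup>2)) \<le>
        (\<Sum>c\<in>{..k}. (real c)\<^sup>2 * expectation (\<lambda>\<omega>. (ev (component W d k a b c) \<omega>)\<^sup>2))"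
      using r by (intro sum_mono2) auto
    moreover have "1 * expectation (\<lambda>\<omega>. (ev (component W d k a b r) \<omega>)\<^sup>2) \<le>
        (real r)\<^sup>2 * expectation (\<lambda>\<omega>. (ev (component W d k a b r) \<omega>)\<^sup>2)"
      using r by (intro mult_right_mono) auto
    ultimately have "expectation (\<lambda>\<omega>. (ev (component W d k a b r) \<omega>)\<^sup>2) \<le> R"
      by simp
    moreover have "expectation (\<lambda>\<omega>. (ev (component W d k a b r) \<omega>)\<^sup>2) =
        (\<Sum>A\<in>nsets V (d - r). (\<Sum>C\<in>nsets V r. split_coeff a A C * v C)\<^sup>2) / s"
    proof -
      let ?Z = "nsets W (d - r) \<times> nsets W (k - r)" and ?Z' = "nsets V (d - r) \<times> {D}"
      let ?M = "\<lambda>x. contraction W r a b (fst x) (snd x)"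
      have a_V: "C \<subseteq> V \<and> A \<subseteq> V" if "A \<in> nsets W (d - r)" "C \<in> nsets W r" "split_coeff a A C \<noteq> 0" for A C
      proof -
        have "A \<inter> C = {}" "a (A \<union> C) \<noteq> 0"
          using that by (auto simp: split_coeff_def split: if_splits)
        moreover from this have "A \<union> C \<in> nsets {1..} d"
          using that r k W(2) by (auto simp: in_nsets card_Un_disjoint)
        ultimately show ?thesis
          using a by (auto simp: supported_def)
      qed
      have sub: "?Z' \<subseteq> ?Z"
        using D by (auto simp: in_nsets W_def)
      \<comment> \<open>Nonzero coefficients of \<open>a\<close> keep the contracted set and
        \<open>fst x\<close> inside \<open>V\<close>, so the fresh variables must all lie in
        \<open>snd x\<close>, which has exactly \<open>card D\<close> elements.\<close>
      have zero: "?M x = 0" if "x \<in> ?Z - ?Z'" for x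
        unfolding contraction_def
      proof (rule sum.neutral, rule ballI, rule ccontr)
        fix C assume C: "C \<in> nsets W r" "split_coeff a (fst x) C * split_coeff b (snd x) C \<noteq> 0"
        then have CV: "C \<subseteq> V" "fst x \<subseteq> V"
          using a_V[of "fst x" C] that by auto
        have "b (snd x \<union> C) \<noteq> 0"
          using C(2) by (auto simp: split_coeff_def split: if_splits)
        then have "D \<subseteq> snd x \<union> C" by (auto simp: b_def split: if_splits)
        with CV D have "D \<subseteq> snd x" by blast
        moreover have "finite (snd x)" "card (snd x) = card D"
          using that D by (auto simp: in_nsets)
        ultimately have "snd x = D" by (metis card_subset_eq)
        with CV that show False by (cases x) (auto simp: in_nsets)
      qed
      have M: "contraction W r a b A D = (\<Sum>C\<in>nsets V r. split_coeff a A C * v C) / sqrt s"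
        if "A \<in> nsets V (d - r)" for A
      proof -
        have "contraction W r a b A D = (\<Sum>C\<in>nsets V r. split_coeff a A C * split_coeff b D C)"
          unfolding contraction_def
        proof (rule sum.mono_neutral_right[OF finW])
          show "nsets V r \<subseteq> nsets W r"
            by (intro nsets_mono) (auto simp: W_def)
          show "\<forall>C\<in>nsets W r - nsets V r. split_coeff a A C * split_coeff b D C = 0"
          proof
            fix C assume C: "C \<in> nsets W r - nsets V r"
            have "A \<in> nsets W (d - r)"
              using that nsets_mono[of V W "d - r"] by (auto simp: W_def)
            with C a_V[of A C] show "split_coeff a A C * split_coeff b D C = 0"
              by (auto simp: in_nsets)
          qed
        qed
        also have "\<dots> = (\<Sum>C\<in>nsets V r. split_coeff a A C * v C / sqrt s)"
        proof (rule sum.cong[OF refl])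
          fix C assume C: "C \<in> nsets V r"
          then have "D \<inter> C = {}" using D by (auto simp: in_nsets)
          then show "split_coeff a A C * split_coeff b D C = split_coeff a A C * v C / sqrt s"
            using C by (simp add: split_coeff_def[of b] b_D)
        qed
        finally show ?thesis by (simp add: sum_divide_distrib)
      qed
      have "expectation (\<lambda>\<omega>. (ev (component W d k a b r) \<omega>)\<^sup>2) =
          (\<Sum>x\<in>?Z. \<Sum>y\<in>?Z. ?M x * ?M y * gram (fst x) (snd x) (fst y) (snd y))"
        unfolding power2_eq_square[of "ev _ _"] by (rule expectation_component_mult[OF W])
      also have "\<dots> = (\<Sum>x\<in>?Z'. \<Sum>y\<in>?Z. ?M x * ?M y * gram (fst x) (snd x) (fst y) (snd y))"
        using sub zero finW by (intro sum.mono_neutral_right) auto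
      also have "\<dots> = (\<Sum>x\<in>?Z'. \<Sum>y\<in>?Z'. ?M x * ?M y * gram (fst x) (snd x) (fst y) (snd y))"
        using sub zero finW by (intro sum.cong refl sum.mono_neutral_right) auto
      also have "\<dots> = (\<Sum>A\<in>nsets V (d - r). \<Sum>A'\<in>nsets V (d - r).
          contraction W r a b A D * contraction W r a b A' D * gram A D A' D)"
        by (simp add: sum.cartesian_product')
      also have "\<dots> = (\<Sum>A\<in>nsets V (d - r). \<Sum>A'\<in>nsets V (d - r).
          if A = A' then (contraction W r a b A D)\<^sup>2 else 0)"
      proof (intro sum.cong refl)
        fix A A' assume "A \<in> nsets V (d - r)" "A' \<in> nsets V (d - r)"
        then have dis: "A \<inter> D = {}" "A' \<inter> D = {}" using D by (auto simp: in_nsets)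
        then have "A \<union> D = A' \<union> D \<longleftrightarrow> A = A'" by blast
        \<comment> \<open>Freshness of \<open>D\<close> rules out repeated indices: the Wick
          products here are orthonormal and the second moment is an exact squared length.\<close>
        with dis have "gram A D A' D = (if A = A' then 1 else 0)" by (simp add: gram_def)
        then show "contraction W r a b A D * contraction W r a b A' D * gram A D A' D =
            (if A = A' then (contraction W r a b A D)\<^sup>2 else 0)"
          by (simp add: power2_eq_square)
      qed
      also have "\<dots> = (\<Sum>A\<in>nsets V (d - r). (\<Sum>C\<in>nsets V r. split_coeff a A C * v C)\<^sup>2 / s)"
        using fin s by (simp add: M power_divide)
      finally show ?thesis by (simp add: sum_divide_distrib)
    qed
    ultimately show ?thesis
      using s by (simp add: divide_le_eq)
  qed
qed

end

section \<open>Hypercontractivity\<close>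

text \<open>General multilinear polynomials: splitting off one variable destroys homogeneity, so the
  induction has to run in this larger class.\<close>

definition mpoly :: "nat set \<Rightarrow> (nat set \<Rightarrow> real) \<Rightarrow> (nat \<Rightarrow> real) \<Rightarrow> real" where
  "mpoly W a x = (\<Sum>I\<in>Pow W. a I * (\<Prod>i\<in>I. x i))"

lemma mpoly_restrict: "mpoly W a (restrict x W) = mpoly W a x"
  unfolding mpoly_def by (intro sum.cong refl arg_cong2[where f = "(*)"] prod.cong) auto

lemma mpoly_measurable: "mpoly W a \<in> borel_measurable (PiM W (\<lambda>_. borel))"
  unfolding mpoly_def by (intro borel_measurable_sum borel_measurable_times borel_measurable_prod) auto

lemma sum_Pow_insert:
  fixes h :: "'b set \<Rightarrow> real"
  assumes "finite W" "i \<notin> W"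
  shows "(\<Sum>I\<in>Pow (insert i W). h I) = (\<Sum>I\<in>Pow W. h I) + (\<Sum>I\<in>Pow W. h (insert i I))"
proof -
  have "inj_on (insert i) (Pow W)"
    using assms by (intro inj_onI) (metis PowD insert_ident subsetD)
  moreover have "Pow W \<inter> insert i ` Pow W = {}"
    using assms by auto
  ultimately show ?thesis
    using assms by (simp add: Pow_insert sum.union_disjoint sum.reindex)
qed

lemma mpoly_insert:
  assumes "finite W" "i \<notin> W"
  shows "mpoly (insert i W) a x = mpoly W a x + x i * mpoly W (\<lambda>I. a (insert i I)) x"
proof -
  have "(\<Prod>j\<in>insert i I. x j) = x i * (\<Prod>j\<in>I. x j)" if "I \<in> Pow W" for I
    using that assms finite_subset[of I W] by (subst prod.insert) auto
  then show ?thesis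
    unfolding mpoly_def sum_Pow_insert[OF assms] by (simp add: sum_distrib_left mult_ac)
qed

context prob_space
begin

text \<open>Hoelder's inequality with exponents 3/2 and 3. It follows by integrating the pointwise
  bound \<open>amgm\<close> for the normalised variables \<open>U / u\<close> and
  \<open>V / v\<close>.\<close>

lemma expectation_square_mult_le:
  assumes am: "all_moments U" "all_moments V" and nonneg: "\<And>\<omega>. U \<omega> \<ge> 0" "\<And>\<omega>. V \<omega> \<ge> 0"
    and le: "expectation (\<lambda>\<omega>. U \<omega> ^ 3) \<le> u ^ 3" "expectation (\<lambda>\<omega>. V \<omega> ^ 3) \<le> v ^ 3"
    and "u \<ge> 0" "v \<ge> 0"
  shows "expectation (\<lambda>\<omega>. (U \<omega>)\<^sup>2 * V \<omega>) \<le> u\<^sup>2 * v"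
proof -
  have amgm: "p\<^sup>2 * q \<le> (2 * p ^ 3 + q ^ 3) / 3" if "p \<ge> 0" "q \<ge> 0" for p q :: real
  proof -
    have "(2 * p ^ 3 + q ^ 3) / 3 - p\<^sup>2 * q = (p - q)\<^sup>2 * (2 * p + q) / 3"
      by (simp add: power2_eq_square power3_eq_cube algebra_simps)
    moreover have "(p - q)\<^sup>2 * (2 * p + q) / 3 \<ge> 0"
      using that by simp
    ultimately show ?thesis by linarith
  qed
  \<comment> \<open>\<open>u\<close> or \<open>v\<close> may be 0, so the normalisation uses
    \<open>u + e\<close> and \<open>v + e\<close>, and \<open>e\<close> tends to 0 at the
    end.\<close>
  have pos: "expectation (\<lambda>\<omega>. (U \<omega>)\<^sup>2 * V \<omega>) \<le> (u + e)\<^sup>2 * (v + e)" if "e > 0" for e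
  proof -
    let ?u = "u + e" and ?v = "v + e"
    have uv: "?u > 0" "?v > 0" using that assms by auto
    have "expectation (\<lambda>\<omega>. (U \<omega>)\<^sup>2 * V \<omega>) \<le>
        expectation (\<lambda>\<omega>. ?u\<^sup>2 * ?v * (2 * (U \<omega> ^ 3 / ?u ^ 3) + V \<omega> ^ 3 / ?v ^ 3) / 3)"
    proof (rule integral_mono)
      show "integrable M (\<lambda>\<omega>. (U \<omega>)\<^sup>2 * V \<omega>)"
        by (intro all_moments_integrable all_moments_intros am)
      show "integrable M (\<lambda>\<omega>. ?u\<^sup>2 * ?v * (2 * (U \<omega> ^ 3 / ?u ^ 3) + V \<omega> ^ 3 / ?v ^ 3) / 3)"
        unfolding divide_inverse by (intro all_moments_integrable all_moments_intros am)
      fix \<omega>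
      have "(U \<omega>)\<^sup>2 * V \<omega> = ?u\<^sup>2 * ?v * ((U \<omega> / ?u)\<^sup>2 * (V \<omega> / ?v))"
        using uv by (simp add: power_divide)
      also have "\<dots> \<le> ?u\<^sup>2 * ?v * ((2 * (U \<omega> / ?u) ^ 3 + (V \<omega> / ?v) ^ 3) / 3)"
        using uv nonneg by (intro mult_left_mono amgm) (auto intro: less_imp_le)
      finally show "(U \<omega>)\<^sup>2 * V \<omega> \<le> ?u\<^sup>2 * ?v * (2 * (U \<omega> ^ 3 / ?u ^ 3) + V \<omega> ^ 3 / ?v ^ 3) / 3"
        by (simp add: power_divide)
    qed
    also have "\<dots> = ?u\<^sup>2 * ?v * (2 * (expectation (\<lambda>\<omega>. U \<omega> ^ 3) / ?u ^ 3) + expectation (\<lambda>\<omega>. V \<omega> ^ 3) / ?v ^ 3) / 3"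
    proof -
      have "integrable M (\<lambda>\<omega>. U \<omega> ^ 3)" "integrable M (\<lambda>\<omega>. V \<omega> ^ 3)"
        by (intro all_moments_integrable all_moments_intros am)+
      then show ?thesis by simp
    qed
    also have "\<dots> \<le> ?u\<^sup>2 * ?v * (2 * 1 + 1) / 3"
    proof -
      have "expectation (\<lambda>\<omega>. U \<omega> ^ 3) \<le> ?u ^ 3" "expectation (\<lambda>\<omega>. V \<omega> ^ 3) \<le> ?v ^ 3"
        using le power_mono[of u ?u 3] power_mono[of v ?v 3] \<open>u \<ge> 0\<close> \<open>v \<ge> 0\<close> \<open>e > 0\<close> by linarith+
      then show ?thesis
        using uv by (intro divide_right_mono mult_left_mono add_mono) auto
    qed
    finally show ?thesis by simp
  qed
  have "((\<lambda>e. (u + e)\<^sup>2 * (v + e)) \<longlongrightarrow> (u + 0)\<^sup>2 * (v + 0)) (at_right 0)"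
    by (intro tendsto_intros)
  then have "expectation (\<lambda>\<omega>. (U \<omega>)\<^sup>2 * V \<omega>) \<le> (u + 0)\<^sup>2 * (v + 0)"
    by (rule tendsto_lowerbound) (auto simp: eventually_at_right_less pos intro!: eventually_at_rightI[of 0 1])
  then show ?thesis by simp
qed

end

context gaussian_sequence
begin

lemma indep_var_G:
  assumes "i \<notin> W" "i \<ge> 1" "W \<subseteq> {1..}" "g \<in> measurable (PiM W (\<lambda>_. borel)) N"
    and "\<And>\<omega>. Y \<omega> = g (restrict (\<lambda>j. G j \<omega>) W)"
  shows "indep_var borel (G i) N Y"
proof -
  have "indep_var borel ((\<lambda>f. f i) \<circ> (\<lambda>\<omega>. restrict (\<lambda>j. G j \<omega>) {i}))
      N (g \<circ> (\<lambda>\<omega>. restrict (\<lambda>j. G j \<omega>) W))"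
    using assms by (intro indep_var_compose[OF indep_var_restrict[OF indep_G]]) auto
  also have "(\<lambda>f. f i) \<circ> (\<lambda>\<omega>. restrict (\<lambda>j. G j \<omega>) {i}) = G i"
    by auto
  also have "g \<circ> (\<lambda>\<omega>. restrict (\<lambda>j. G j \<omega>) W) = Y"
    using assms by auto
  finally show ?thesis .
qed

lemma all_moments_mpoly: "W \<subseteq> {1..} \<Longrightarrow> all_moments (ev (mpoly W a))"
  unfolding at_vars_def mpoly_def by (auto intro!: all_moments_intros all_moments_G)

lemma expectation_G_power_mult:
  assumes "i \<notin> W" "i \<ge> 1" "W \<subseteq> {1..}"
  shows "expectation (\<lambda>\<omega>. G i \<omega> ^ j * (ev (mpoly W a) \<omega> ^ m * ev (mpoly W b) \<omega> ^ n)) =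
    expectation (\<lambda>\<omega>. G i \<omega> ^ j) * expectation (\<lambda>\<omega>. ev (mpoly W a) \<omega> ^ m * ev (mpoly W b) \<omega> ^ n)"
proof (rule indep_var_lebesgue_integral)
  note [measurable] = mpoly_measurable
  have "indep_var borel (G i) borel (\<lambda>\<omega>. ev (mpoly W a) \<omega> ^ m * ev (mpoly W b) \<omega> ^ n)"
    using assms by (intro indep_var_G[of i W "\<lambda>x. mpoly W a x ^ m * mpoly W b x ^ n"])
      (auto simp: at_vars_def mpoly_restrict)
  then have "indep_var borel ((\<lambda>x. x ^ j) \<circ> G i) borel (id \<circ> (\<lambda>\<omega>. ev (mpoly W a) \<omega> ^ m * ev (mpoly W b) \<omega> ^ n))"
    by (intro indep_var_compose) auto
  then show "indep_var borel (\<lambda>\<omega>. G i \<omega> ^ j) borel (\<lambda>\<omega>. ev (mpoly W a) \<omega> ^ m * ev (mpoly W b) \<omega> ^ n)"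
    by (simp add: comp_def)
  show "integrable M (\<lambda>\<omega>. G i \<omega> ^ j)"
    using assms by (intro all_moments_integrable all_moments_intros all_moments_G)
  show "integrable M (\<lambda>\<omega>. ev (mpoly W a) \<omega> ^ m * ev (mpoly W b) \<omega> ^ n)"
    using assms by (intro all_moments_integrable all_moments_intros all_moments_mpoly)
qed

text \<open>
  Induction on the variables: the constant 5 makes the binomial
  expansion of \<open>\<parallel>P + g Q\<parallel>\<^sub>6\<^sup>6\<close> dominated by that of \<open>(\<parallel>P\<parallel>\<^sub>6\<^sup>2 + 5 \<parallel>Q\<parallel>\<^sub>6\<^sup>2)\<^sup>3\<close>.
\<close>

lemma sixth_moment_mpoly_le:
  assumes "finite W" "W \<subseteq> {1..}"
  shows "expectation (\<lambda>\<omega>. ev (mpoly W a) \<omega> ^ 6) \<le> (\<Sum>I\<in>Pow W. 5 ^ card I * (a I)\<^sup>2) ^ 3"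
  using assms
proof (induction W arbitrary: a rule: finite_induct)
  case empty
  show ?case
    by (simp add: at_vars_def mpoly_def prob_space power_mult[symmetric])
next
  case (insert i W)
  let ?a = "\<lambda>I. a (insert i I)"
  define P where "P = ev (mpoly W a)"
  define Q where "Q = ev (mpoly W ?a)"
  define x where "x = (\<Sum>I\<in>Pow W. 5 ^ card I * (a I)\<^sup>2)"
  define y where "y = (\<Sum>I\<in>Pow W. 5 ^ card I * (?a I)\<^sup>2)"
  have W: "W \<subseteq> {1..}" "i \<ge> 1" using insert.prems by auto
  have xy: "x \<ge> 0" "y \<ge> 0" unfolding x_def y_def by (auto intro!: sum_nonneg)
  have am: "all_moments P" "all_moments Q" "all_moments (G i)"
    unfolding P_def Q_def using W by (auto intro!: all_moments_mpoly all_moments_G)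
  have PQ6: "expectation (\<lambda>\<omega>. P \<omega> ^ 6) \<le> x ^ 3" "expectation (\<lambda>\<omega>. Q \<omega> ^ 6) \<le> y ^ 3"
    unfolding P_def Q_def x_def y_def by (intro insert.IH W)+
  have sq: "z ^ 6 = (z\<^sup>2) ^ 3" "z ^ 4 = (z\<^sup>2)\<^sup>2" for z :: real
    by (simp_all add: power_mult[symmetric])
  have P4Q2: "expectation (\<lambda>\<omega>. P \<omega> ^ 4 * (Q \<omega>)\<^sup>2) \<le> x\<^sup>2 * y"
    using PQ6 xy unfolding sq by (intro expectation_square_mult_le) (auto intro!: all_moments_intros am)
  have P2Q4: "expectation (\<lambda>\<omega>. (P \<omega>)\<^sup>2 * Q \<omega> ^ 4) \<le> y\<^sup>2 * x"
  proof -
    have "expectation (\<lambda>\<omega>. Q \<omega> ^ 4 * (P \<omega>)\<^sup>2) \<le> y\<^sup>2 * x"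
      using PQ6 xy unfolding sq by (intro expectation_square_mult_le) (auto intro!: all_moments_intros am)
    then show ?thesis by (simp add: mult.commute)
  qed
  have E: "expectation (\<lambda>\<omega>. G i \<omega> ^ j * (P \<omega> ^ m * Q \<omega> ^ n)) =
      expectation (\<lambda>\<omega>. G i \<omega> ^ j) * expectation (\<lambda>\<omega>. P \<omega> ^ m * Q \<omega> ^ n)" for j m n
    unfolding P_def Q_def using insert.hyps W by (intro expectation_G_power_mult)
  have int: "integrable M (\<lambda>\<omega>. G i \<omega> ^ j * (P \<omega> ^ m * Q \<omega> ^ n))" for j m n
    by (intro all_moments_integrable all_moments_intros am)
  have "ev (mpoly (insert i W) a) \<omega> ^ 6 = (\<Sum>j\<le>6. of_nat (6 choose j) * (G i \<omega> ^ j * (P \<omega> ^ (6 - j) * Q \<omega> ^ j)))" for \<omega>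
  proof -
    have "ev (mpoly (insert i W) a) \<omega> = G i \<omega> * Q \<omega> + P \<omega>"
      using insert.hyps by (simp add: at_vars_def mpoly_insert P_def Q_def)
    then show ?thesis
      by (simp only: binomial_ring power_mult_distrib mult_ac)
  qed
  then have "expectation (\<lambda>\<omega>. ev (mpoly (insert i W) a) \<omega> ^ 6) =
      expectation (\<lambda>\<omega>. \<Sum>j\<le>6. of_nat (6 choose j) * (G i \<omega> ^ j * (P \<omega> ^ (6 - j) * Q \<omega> ^ j)))"
    by simp
  also have "\<dots> = (\<Sum>j\<le>6. of_nat (6 choose j) *
      (expectation (\<lambda>\<omega>. G i \<omega> ^ j) * expectation (\<lambda>\<omega>. P \<omega> ^ (6 - j) * Q \<omega> ^ j)))"
    by (subst Bochner_Integration.integral_sum)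
       (auto intro!: Bochner_Integration.integrable_mult_right int sum.cong simp: E)
  \<comment> \<open>Odd moments of \<open>G i\<close> vanish. The even moments 1, 1, 3, 15 multiply
    the binomial coefficients 1, 15, 15, 1.\<close>
  also have "\<dots> = expectation (\<lambda>\<omega>. P \<omega> ^ 6) + 15 * expectation (\<lambda>\<omega>. P \<omega> ^ 4 * (Q \<omega>)\<^sup>2) +
      45 * expectation (\<lambda>\<omega>. (P \<omega>)\<^sup>2 * Q \<omega> ^ 4) + 15 * expectation (\<lambda>\<omega>. Q \<omega> ^ 6)"
  proof -
    have set: "{..6 :: nat} = {0, 1, 2, 3, 4, 5, 6}" by auto
    have b: "(6 :: nat) choose 2 = 15" "(6 :: nat) choose 4 = 15" "(6 :: nat) choose 6 = 1"
      by (simp_all add: numeral_eq_Suc)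
    have "expectation (\<lambda>\<omega>. G i \<omega> ^ 4) = 3" "expectation (\<lambda>\<omega>. G i \<omega> ^ 6) = 15"
      "expectation (\<lambda>\<omega>. (G i \<omega>)\<^sup>2) = 1" "expectation (\<lambda>\<omega>. G i \<omega> ^ 3) = 0" "expectation (\<lambda>\<omega>. G i \<omega> ^ 5) = 0"
      "expectation (\<lambda>\<omega>. G i \<omega>) = 0"
      using moment_G[OF W(2), of 4] moment_G[OF W(2), of 6] moment_G[OF W(2), of 2]
        moment_G[OF W(2), of 3] moment_G[OF W(2), of 5] moment_G[OF W(2), of 1]
      by (simp_all add: fact_numeral)
    then show ?thesis
      unfolding set by (simp add: b prob_space)
  qed
  also have "\<dots> \<le> x ^ 3 + 15 * (x\<^sup>2 * y) + 45 * (y\<^sup>2 * x) + 15 * y ^ 3"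
    using PQ6 P4Q2 P2Q4 by (intro add_mono mult_left_mono) auto
  also have "\<dots> \<le> (x + 5 * y) ^ 3"
  proof -
    \<comment> \<open>The coefficient of \<open>x^2 * y\<close> is matched exactly by
      \<open>3 * 5 = 15\<close>; the other terms leave a nonnegative surplus.\<close>
    have "(x + 5 * y) ^ 3 = x ^ 3 + 15 * (x\<^sup>2 * y) + 45 * (y\<^sup>2 * x) + 15 * y ^ 3 + (30 * (y\<^sup>2 * x) + 110 * y ^ 3)"
      by (simp add: power2_eq_square power3_eq_cube algebra_simps)
    then show ?thesis using xy by simp
  qed
  also have "x + 5 * y = (\<Sum>I\<in>Pow (insert i W). 5 ^ card I * (a I)\<^sup>2)"
  proof -
    have "card (insert i I) = Suc (card I)" if "I \<in> Pow W" for I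
      using that insert.hyps finite_subset[of I W] by (subst card_insert_disjoint) auto
    then show ?thesis
      unfolding sum_Pow_insert[OF insert.hyps] x_def y_def by (simp add: sum_distrib_left mult_ac)
  qed
  finally show ?case .
qed

text \<open>Extending the coefficients by 0 to all subsets of \<open>V\<close> makes every surviving
  weight equal to \<open>5 ^ d\<close>, a constant that depends on the degree only.\<close>

lemma sixth_moment_hom_poly_le:
  assumes "supported V d a"
  shows "expectation (\<lambda>\<omega>. ev (hom_poly d a) \<omega> ^ 6) \<le> (5 ^ d * (\<Sum>I\<in>nsets V d. (a I)\<^sup>2)) ^ 3"
proof -
  note V = supportedD(1,2)[OF assms]
  let ?a = "\<lambda>I. if card I = d then a I else 0"
  have N: "nsets V d = {I \<in> Pow V. card I = d}"
    using V(1) finite_subset by (auto simp: in_nsets)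
  have "hom_poly d a x = mpoly V ?a x" for x
    unfolding hom_poly_eq[OF assms] mpoly_def N using V(1)
    by (subst sum.inter_filter) (auto intro!: sum.cong)
  then have "ev (hom_poly d a) = ev (mpoly V ?a)"
    by (auto simp: at_vars_def)
  moreover have "(\<Sum>I\<in>Pow V. 5 ^ card I * (?a I)\<^sup>2) = 5 ^ d * (\<Sum>I\<in>nsets V d. (a I)\<^sup>2)"
    unfolding sum_distrib_left N using V(1)
    by (subst sum.inter_filter) (auto intro!: sum.cong)
  ultimately show ?thesis
    using sixth_moment_mpoly_le[OF V, of ?a] by simp
qed

end

section \<open>Gaussian integration by parts\<close>

lemma (in prob_space) integrable_mult_iexp:
  assumes "all_moments Z" "U \<in> borel_measurable M"
  shows "integrable M (\<lambda>\<omega>. complex_of_real (Z \<omega>) * iexp (U \<omega>))"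
proof (rule Bochner_Integration.integrable_bound)
  show "integrable M Z" using assms by (intro all_moments_integrable)
  show "(\<lambda>\<omega>. complex_of_real (Z \<omega>) * iexp (U \<omega>)) \<in> borel_measurable M"
    using assms all_moments_measurable[of Z] by measurable
  show "AE \<omega> in M. norm (complex_of_real (Z \<omega>) * iexp (U \<omega>)) \<le> norm (Z \<omega>)"
    by (auto simp: norm_mult)
qed

text \<open>The first-order Taylor remainder of the exponential is at most
  \<open>(h X)^2 / 2\<close>; its expectation is of order \<open>h^2\<close>, so differentiation
  under the integral is justified.\<close>

lemma (in prob_space) has_vector_derivative_char:
  assumes X: "all_moments X"
  shows "((\<lambda>t. CLINT \<omega>|M. iexp (t * X \<omega>)) has_vector_derivative
    (\<i> * (CLINT \<omega>|M. complex_of_real (X \<omega>) * iexp (t * X \<omega>)))) (at t)"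
proof -
  note [measurable] = all_moments_measurable[OF X]
  let ?\<phi> = "\<lambda>t. CLINT \<omega>|M. iexp (t * X \<omega>)"
  let ?D = "\<i> * (CLINT \<omega>|M. complex_of_real (X \<omega>) * iexp (t * X \<omega>))"
  define C where "C = expectation (\<lambda>\<omega>. (X \<omega>)\<^sup>2) / 2"
  have int: "integrable M (\<lambda>\<omega>. iexp (s * X \<omega>))" for s
    using integrable_mult_iexp[OF all_moments_const[of 1], of "\<lambda>\<omega>. s * X \<omega>"] by simp
  have intX: "integrable M (\<lambda>\<omega>. complex_of_real (X \<omega>) * iexp (s * X \<omega>))" for s
    by (intro integrable_mult_iexp X) simp
  have bound: "norm (?\<phi> (t + h) - ?\<phi> t - h *\<^sub>R ?D) \<le> C * h\<^sup>2" for h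
  proof -
    let ?f = "\<lambda>\<omega>. iexp ((t + h) * X \<omega>) - iexp (t * X \<omega>) -
        complex_of_real h * \<i> * (complex_of_real (X \<omega>) * iexp (t * X \<omega>))"
    have "?\<phi> (t + h) - ?\<phi> t - h *\<^sub>R ?D = (CLINT \<omega>|M. ?f \<omega>)"
      using int[of "t + h"] int[of t] intX[of t] by (simp add: scaleR_conv_of_real mult.assoc)
    then have "norm (?\<phi> (t + h) - ?\<phi> t - h *\<^sub>R ?D) \<le> (\<integral>\<omega>. norm (?f \<omega>) \<partial>M)"
      by (simp only: integral_norm_bound)
    also have "\<dots> \<le> (\<integral>\<omega>. h\<^sup>2 / 2 * (X \<omega>)\<^sup>2 \<partial>M)"
    proof (rule integral_mono)
      show "integrable M (\<lambda>\<omega>. norm (?f \<omega>))"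
        using int[of "t + h"] int[of t] intX[of t]
        by (intro integrable_norm Bochner_Integration.integrable_diff integrable_mult_right) auto
      show "integrable M (\<lambda>\<omega>. h\<^sup>2 / 2 * (X \<omega>)\<^sup>2)"
        by (intro all_moments_integrable all_moments_intros X)
      fix \<omega>
      have "?f \<omega> = iexp (t * X \<omega>) * (iexp (h * X \<omega>) - (\<Sum>k\<le>1. (\<i> * complex_of_real (h * X \<omega>)) ^ k / fact k))"
        by (simp add: exp_add[symmetric] algebra_simps)
      then have "norm (?f \<omega>) = cmod (iexp (h * X \<omega>) - (\<Sum>k\<le>1. (\<i> * complex_of_real (h * X \<omega>)) ^ k / fact k))"
        by (simp only: norm_mult norm_exp_i_times mult_1_left)
      also have "\<dots> \<le> \<bar>h * X \<omega>\<bar> ^ Suc 1 / fact (Suc 1)"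
        by (rule iexp_approx1)
      also have "\<dots> = h\<^sup>2 / 2 * (X \<omega>)\<^sup>2"
        by (simp add: numeral_2_eq_2[symmetric] power_mult_distrib abs_mult)
      finally show "norm (?f \<omega>) \<le> h\<^sup>2 / 2 * (X \<omega>)\<^sup>2" .
    qed
    also have "\<dots> = C * h\<^sup>2"
      by (simp add: C_def)
    finally show ?thesis .
  qed
  have "(\<lambda>h. norm (?\<phi> (t + h) - ?\<phi> t - h *\<^sub>R ?D) / norm h) \<midarrow>0\<rightarrow> 0"
  proof (rule tendsto_sandwich[where f = "\<lambda>_. 0" and h = "\<lambda>h. C * \<bar>h\<bar>"])
    show "eventually (\<lambda>h. norm (?\<phi> (t + h) - ?\<phi> t - h *\<^sub>R ?D) / norm h \<le> C * \<bar>h\<bar>) (at 0)"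
    proof (rule eventually_at_filter[THEN iffD2], intro always_eventually allI impI)
      fix h :: real assume "h \<noteq> 0"
      have "norm (?\<phi> (t + h) - ?\<phi> t - h *\<^sub>R ?D) / norm h \<le> C * h\<^sup>2 / norm h"
        by (intro divide_right_mono bound) simp
      also have "\<dots> = C * \<bar>h\<bar>"
        using \<open>h \<noteq> 0\<close> by (simp add: power2_eq_square field_simps)
      finally show "norm (?\<phi> (t + h) - ?\<phi> t - h *\<^sub>R ?D) / norm h \<le> C * \<bar>h\<bar>" .
    qed
    show "(\<lambda>h. C * \<bar>h\<bar>) \<midarrow>0\<rightarrow> 0"
      by (auto intro!: tendsto_eq_intros)
  qed auto
  then show ?thesis
    unfolding has_vector_derivative_def has_derivative_at
    by (simp add: bounded_linear_scaleR_left)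
qed

text \<open>The characteristic function \<open>exp (- s^2 / 2)\<close> is differentiated in two
  ways, directly and under the integral. This is Gaussian integration by parts in dimension one,
  tested on exponentials.\<close>

lemma std_normal_iexp_moment:
  "(CLINT x|std_normal_distribution. complex_of_real x * iexp (s * x)) =
    \<i> * s * (CLINT x|std_normal_distribution. iexp (s * x))"
proof -
  interpret N: prob_space std_normal_distribution
    using real_dist_normal_dist by (rule real_distribution.axioms)
  have am: "N.all_moments (\<lambda>x. x)"
    unfolding N.all_moments_def
    using integrable_std_normal_moment_abs by (auto simp: integrable_density normal_density_nonneg)
  have char: "(CLINT x|std_normal_distribution. iexp (s * x)) = complex_of_real (exp (- (s\<^sup>2) / 2))" for s
    using fun_cong[OF char_std_normal_distribution, of s] by (simp add: char_def)
  have "((\<lambda>s. complex_of_real (exp (- (s\<^sup>2) / 2))) has_vector_derivative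
      complex_of_real (- s * exp (- (s\<^sup>2) / 2))) (at s)"
    by (rule has_vector_derivative_of_real) (auto intro!: derivative_eq_intros simp: has_real_derivative_iff_has_vector_derivative[symmetric])
  moreover have "((\<lambda>s. complex_of_real (exp (- (s\<^sup>2) / 2))) has_vector_derivative
      \<i> * (CLINT x|std_normal_distribution. complex_of_real x * iexp (s * x))) (at s)"
    using N.has_vector_derivative_char[OF am, of s] unfolding char .
  ultimately have "\<i> * (CLINT x|std_normal_distribution. complex_of_real x * iexp (s * x)) =
      complex_of_real (- s * exp (- (s\<^sup>2) / 2))"
    by (rule vector_derivative_unique_at[symmetric])
  then have "- (CLINT x|std_normal_distribution. complex_of_real x * iexp (s * x)) =
      \<i> * complex_of_real (- s * exp (- (s\<^sup>2) / 2))"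
    by (metis i_squared mult.assoc mult_minus1 power2_eq_square)
  then show ?thesis
    unfolding char by (simp add: minus_equation_iff[of "integral\<^sup>L _ _"])
qed

text \<open>By multilinearity the derivative in \<open>x i\<close> no longer involves
  \<open>x i\<close>; this makes it independent of \<open>G i\<close>.\<close>

lemma dpoly_restrict: "dpoly V d a i (restrict x (V - {i})) = dpoly V d a i x"
  unfolding dpoly_def
proof (intro sum.cong refl)
  fix I assume "I \<in> nsets V d"
  then have "(\<Prod>j\<in>I - {i}. restrict x (V - {i}) j) = (\<Prod>j\<in>I - {i}. x j)"
    by (intro prod.cong) (auto simp: in_nsets)
  then show "(if i \<in> I then a I * (\<Prod>j\<in>I - {i}. restrict x (V - {i}) j) else 0) =
      (if i \<in> I then a I * (\<Prod>j\<in>I - {i}. x j) else 0)"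
    by simp
qed

lemma dpoly_measurable: "dpoly V d a i \<in> borel_measurable (PiM (V - {i}) (\<lambda>_. borel))"
proof -
  have "(\<lambda>x. if i \<in> I then a I * (\<Prod>j\<in>I - {i}. x j) else 0) \<in> borel_measurable (PiM (V - {i}) (\<lambda>_. borel))"
    if "I \<in> nsets V d" for I
  proof (cases "i \<in> I")
    case True
    have "(\<lambda>x. a I * (\<Prod>j\<in>I - {i}. x j)) \<in> borel_measurable (PiM (V - {i}) (\<lambda>_. borel))"
      using that by (intro borel_measurable_times borel_measurable_prod measurable_component_singleton)
        (auto simp: in_nsets)
    with True show ?thesis by simp
  qed simp
  then show ?thesis
    unfolding dpoly_def by (intro borel_measurable_sum)
qed

text \<open>The part of the polynomial free of \<open>x i\<close>, so that the polynomial is affine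
  in \<open>x i\<close> with this intercept and slope \<open>dpoly\<close>.\<close>

definition rest_poly :: "nat set \<Rightarrow> nat \<Rightarrow> (nat set \<Rightarrow> real) \<Rightarrow> nat \<Rightarrow> (nat \<Rightarrow> real) \<Rightarrow> real" where
  "rest_poly V d a i x = (\<Sum>I\<in>nsets (V - {i}) d. a I * (\<Prod>j\<in>I. x j))"

lemma rest_poly_restrict: "rest_poly V d a i (restrict x (V - {i})) = rest_poly V d a i x"
  unfolding rest_poly_def
  by (intro sum.cong refl arg_cong2[where f = "(*)"] prod.cong) (auto simp: in_nsets)

lemma rest_poly_measurable: "rest_poly V d a i \<in> borel_measurable (PiM (V - {i}) (\<lambda>_. borel))"
  unfolding rest_poly_def
  by (intro borel_measurable_sum borel_measurable_times borel_measurable_prod measurable_component_singleton)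
     (auto simp: in_nsets)

lemma hom_poly_eq_rest_add_dpoly:
  assumes "supported V d a"
  shows "hom_poly d a x = rest_poly V d a i x + x i * dpoly V d a i x"
proof -
  note V = supportedD(1)[OF assms]
  have "hom_poly d a x = (\<Sum>I\<in>nsets V d. (if i \<notin> I then a I * (\<Prod>j\<in>I. x j) else 0) +
      x i * (if i \<in> I then a I * (\<Prod>j\<in>I - {i}. x j) else 0))"
    unfolding hom_poly_eq[OF assms]
  proof (rule sum.cong[OF refl])
    fix I assume I: "I \<in> nsets V d"
    show "a I * (\<Prod>j\<in>I. x j) = (if i \<notin> I then a I * (\<Prod>j\<in>I. x j) else 0) +
        x i * (if i \<in> I then a I * (\<Prod>j\<in>I - {i}. x j) else 0)"
    proof (cases "i \<in> I")
      case True
      then have "(\<Prod>j\<in>I. x j) = x i * (\<Prod>j\<in>I - {i}. x j)"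
        using I by (intro prod.remove) (auto simp: in_nsets)
      with True show ?thesis by simp
    qed simp
  qed
  also have "\<dots> = (\<Sum>I\<in>nsets V d. if i \<notin> I then a I * (\<Prod>j\<in>I. x j) else 0) + x i * dpoly V d a i x"
    by (simp only: sum.distrib dpoly_def sum_distrib_left)
  also have "(\<Sum>I\<in>nsets V d. if i \<notin> I then a I * (\<Prod>j\<in>I. x j) else 0) =
      (\<Sum>I\<in>{I \<in> nsets V d. i \<notin> I}. a I * (\<Prod>j\<in>I. x j))"
    using V by (subst sum.inter_filter) (auto simp: finite_imp_finite_nsets)
  also have "{I \<in> nsets V d. i \<notin> I} = nsets (V - {i}) d"
    by (auto simp: in_nsets)
  finally show ?thesis by (simp only: rest_poly_def)
qed

section \<open>Integration by parts in one variable and Stein's identity\<close>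

context gaussian_sequence
begin

lemma all_moments_rest_poly: "V \<subseteq> {1..} \<Longrightarrow> all_moments (ev (rest_poly V d a i))"
  unfolding at_vars_def rest_poly_def
  by (intro all_moments_intros all_moments_G) (auto simp: in_nsets)

lemma gaussian_integration_by_parts:
  assumes "i \<notin> W" "i \<ge> 1" "W \<subseteq> {1..}"
    and pq[measurable]: "p \<in> borel_measurable (PiM W (\<lambda>_. borel))" "q \<in> borel_measurable (PiM W (\<lambda>_. borel))"
    and PQ: "\<And>\<omega>. P \<omega> = p (restrict (\<lambda>j. G j \<omega>) W)" "\<And>\<omega>. Q \<omega> = q (restrict (\<lambda>j. G j \<omega>) W)"
    and am: "all_moments P" "all_moments Q"
  shows "(CLINT \<omega>|M. complex_of_real (G i \<omega> * Q \<omega>) * iexp (t * (P \<omega> + G i \<omega> * Q \<omega>))) =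
    \<i> * t * (CLINT \<omega>|M. complex_of_real ((Q \<omega>)\<^sup>2) * iexp (t * (P \<omega> + G i \<omega> * Q \<omega>)))"
proof -
  let ?N = "std_normal_distribution"
  let ?S = "PiM {i} (\<lambda>_. borel) :: (nat \<Rightarrow> real) measure"
  let ?T = "PiM W (\<lambda>_. borel) :: (nat \<Rightarrow> real) measure"
  define X where "X \<omega> = restrict (\<lambda>j. G j \<omega>) {i}" for \<omega>
  define Y where "Y \<omega> = restrict (\<lambda>j. G j \<omega>) W" for \<omega>
  define \<mu> where "\<mu> = distr M ?S X"
  define \<nu> where "\<nu> = distr M ?T Y"
  note [measurable] = am[THEN all_moments_measurable] G_measurable[OF assms(2)]
  have "indep_var ?S X ?T Y"
    unfolding X_def Y_def using assms by (intro indep_var_restrict[OF indep_G]) auto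
  then have XY[measurable]: "X \<in> measurable M ?S" "Y \<in> measurable M ?T"
    and joint: "distr M (?S \<Otimes>\<^sub>M ?T) (\<lambda>\<omega>. (X \<omega>, Y \<omega>)) = \<mu> \<Otimes>\<^sub>M \<nu>"
    unfolding indep_var_distribution_eq \<mu>_def \<nu>_def by auto
  interpret \<mu>: prob_space \<mu>
    unfolding \<mu>_def by (rule prob_space_distr) measurable
  interpret \<nu>: prob_space \<nu>
    unfolding \<nu>_def by (rule prob_space_distr) measurable
  interpret PP: pair_prob_space \<mu> \<nu> ..
  have G_X: "X \<omega> i = G i \<omega>" for \<omega>
    by (simp add: X_def)
  have coord[measurable]: "(\<lambda>x. x i) \<in> borel_measurable ?S"
    by (rule measurable_component_singleton) simp
  have \<mu>_N: "(CLINT x|\<mu>. g (x i)) = (CLINT x|?N. g x)" if [measurable]: "g \<in> borel_measurable borel" for g :: "real \<Rightarrow> complex"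
  proof -
    have "(CLINT x|\<mu>. g (x i)) = (CLINT \<omega>|M. g (G i \<omega>))"
      unfolding \<mu>_def by (subst integral_distr) (auto simp: G_X)
    also have "\<dots> = (CLINT x|distr M borel (G i). g x)"
      by (subst integral_distr) auto
    finally show ?thesis
      by (simp only: distr_G[OF assms(2)])
  qed
  define f1 where "f1 x y = complex_of_real (x i * q y) * iexp (t * (p y + x i * q y))" for x y :: "nat \<Rightarrow> real"
  define f2 where "f2 x y = complex_of_real ((q y)\<^sup>2) * iexp (t * (p y + x i * q y))" for x y :: "nat \<Rightarrow> real"
  have meas[measurable]: "case_prod f1 \<in> borel_measurable (?S \<Otimes>\<^sub>M ?T)" "case_prod f2 \<in> borel_measurable (?S \<Otimes>\<^sub>M ?T)"
    unfolding f1_def f2_def by measurable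
  have f_at: "f1 (X \<omega>) (Y \<omega>) = complex_of_real (G i \<omega> * Q \<omega>) * iexp (t * (P \<omega> + G i \<omega> * Q \<omega>))"
    "f2 (X \<omega>) (Y \<omega>) = complex_of_real ((Q \<omega>)\<^sup>2) * iexp (t * (P \<omega> + G i \<omega> * Q \<omega>))" for \<omega>
    by (simp_all add: f1_def f2_def G_X PQ Y_def)
  have "integrable M (\<lambda>\<omega>. f1 (X \<omega>) (Y \<omega>))" "integrable M (\<lambda>\<omega>. f2 (X \<omega>) (Y \<omega>))"
    unfolding f_at using assms(2) by (intro integrable_mult_iexp all_moments_intros am all_moments_G; simp)+
  then have int: "integrable (\<mu> \<Otimes>\<^sub>M \<nu>) (case_prod f1)" "integrable (\<mu> \<Otimes>\<^sub>M \<nu>) (case_prod f2)"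
    unfolding joint[symmetric] by (simp_all add: integrable_distr_eq)
  have E: "(CLINT \<omega>|M. f (X \<omega>) (Y \<omega>)) = (CLINT y|\<nu>. CLINT x|\<mu>. f x y)"
    if "integrable (\<mu> \<Otimes>\<^sub>M \<nu>) (case_prod f)" "case_prod f \<in> borel_measurable (?S \<Otimes>\<^sub>M ?T)"
    for f :: "(nat \<Rightarrow> real) \<Rightarrow> (nat \<Rightarrow> real) \<Rightarrow> complex"
  proof -
    have "(CLINT \<omega>|M. f (X \<omega>) (Y \<omega>)) = integral\<^sup>L (distr M (?S \<Otimes>\<^sub>M ?T) (\<lambda>\<omega>. (X \<omega>, Y \<omega>))) (case_prod f)"
      using that(2) by (subst integral_distr) auto
    also have "\<dots> = (CLINT y|\<nu>. CLINT x|\<mu>. f x y)"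
      unfolding joint using PP.integral_snd[OF that(1)] by simp
    finally show ?thesis .
  qed
  have inner: "(CLINT x|\<mu>. f1 x y) = \<i> * t * (CLINT x|\<mu>. f2 x y)" for y
  proof -
    have "(CLINT x|\<mu>. f1 x y) =
        (CLINT x|\<mu>. (complex_of_real (q y) * iexp (t * p y)) * (complex_of_real (x i) * iexp (t * q y * x i)))"
      unfolding f1_def by (intro Bochner_Integration.integral_cong refl) (simp add: exp_add[symmetric] algebra_simps)
    also have "\<dots> = (complex_of_real (q y) * iexp (t * p y)) * (CLINT x|\<mu>. complex_of_real (x i) * iexp (t * q y * x i))"
      by (rule integral_mult_right_zero)
    also have "(CLINT x|\<mu>. complex_of_real (x i) * iexp (t * q y * x i)) =
        (CLINT x|?N. complex_of_real x * iexp (t * q y * x))"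
      by (rule \<mu>_N) measurable
    also have "\<dots> = \<i> * (t * q y) * (CLINT x|?N. iexp (t * q y * x))"
      using std_normal_iexp_moment[of "t * q y"] by simp
    also have "(CLINT x|?N. iexp (t * q y * x)) = (CLINT x|\<mu>. iexp (t * q y * x i))"
      by (rule \<mu>_N[symmetric]) measurable
    also have "complex_of_real (q y) * iexp (t * p y) * (\<i> * (t * q y) * (CLINT x|\<mu>. iexp (t * q y * x i))) =
        \<i> * t * ((complex_of_real ((q y)\<^sup>2) * iexp (t * p y)) * (CLINT x|\<mu>. iexp (t * q y * x i)))"
      by (simp add: power2_eq_square)
    also have "(complex_of_real ((q y)\<^sup>2) * iexp (t * p y)) * (CLINT x|\<mu>. iexp (t * q y * x i)) =
        (CLINT x|\<mu>. (complex_of_real ((q y)\<^sup>2) * iexp (t * p y)) * iexp (t * q y * x i))"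
      by (rule integral_mult_right_zero[symmetric])
    also have "\<dots> = (CLINT x|\<mu>. f2 x y)"
      unfolding f2_def by (intro Bochner_Integration.integral_cong refl) (simp add: exp_add[symmetric] algebra_simps)
    finally show ?thesis .
  qed
  have "(CLINT \<omega>|M. f1 (X \<omega>) (Y \<omega>)) = (CLINT y|\<nu>. \<i> * t * (CLINT x|\<mu>. f2 x y))"
    unfolding E[OF int(1) meas(1)] inner ..
  also have "\<dots> = \<i> * t * (CLINT \<omega>|M. f2 (X \<omega>) (Y \<omega>))"
    unfolding E[OF int(2) meas(2)] by (rule integral_mult_right_zero)
  finally show ?thesis
    unfolding f_at .
qed

text \<open>Euler's identity writes \<open>d F\<close> as the sum of \<open>G_i\<close> times the
  partial derivatives. Integration by parts in each \<open>G_i\<close> turns every summand into a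
  squared derivative, and these add up to the gradient product.\<close>

lemma stein_identity:
  assumes "supported V d a"
  shows "d * (CLINT \<omega>|M. complex_of_real (ev (hom_poly d a) \<omega>) * iexp (t * ev (hom_poly d a) \<omega>)) =
    \<i> * t * (CLINT \<omega>|M. complex_of_real (ev (grad_prod (hom_poly d a) (hom_poly d a)) \<omega>) *
      iexp (t * ev (hom_poly d a) \<omega>))"
proof -
  note V = supportedD[OF assms]
  define F where "F = ev (hom_poly d a)"
  define Q where "Q i = ev (dpoly V d a i)" for i
  define P where "P i = ev (rest_poly V d a i)" for i
  have amF: "all_moments F" and amQ: "all_moments (Q i)" and amP: "all_moments (P i)" for i
    unfolding F_def Q_def P_def using V
    by (auto intro: all_moments_hom_poly all_moments_dpoly all_moments_rest_poly)
  have [measurable]: "F \<in> borel_measurable M" using amF by (rule all_moments_measurable)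
  have F_eq: "P i \<omega> + G i \<omega> * Q i \<omega> = F \<omega>" for i \<omega>
    by (simp add: F_def P_def Q_def at_vars_def hom_poly_eq_rest_add_dpoly[OF assms, of _ i])
  have ibp: "(CLINT \<omega>|M. complex_of_real (G i \<omega> * Q i \<omega>) * iexp (t * F \<omega>)) =
      \<i> * t * (CLINT \<omega>|M. complex_of_real ((Q i \<omega>)\<^sup>2) * iexp (t * F \<omega>))" if "i \<in> V" for i
    using gaussian_integration_by_parts[of i "V - {i}" "rest_poly V d a i" "dpoly V d a i" "P i" "Q i" t]
      V that amP amQ rest_poly_measurable dpoly_measurable
    unfolding F_eq by (auto simp: P_def Q_def at_vars_def rest_poly_restrict dpoly_restrict)
  have euler: "complex_of_real d * (complex_of_real (F \<omega>) * iexp (t * F \<omega>)) =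
      (\<Sum>i\<in>V. complex_of_real (G i \<omega> * Q i \<omega>) * iexp (t * F \<omega>))" for \<omega>
  proof -
    have "real d * F \<omega> = (\<Sum>i\<in>V. G i \<omega> * Q i \<omega>)"
      by (simp add: F_def Q_def at_vars_def euler_hom_poly[OF assms])
    then have "complex_of_real d * complex_of_real (F \<omega>) = (\<Sum>i\<in>V. complex_of_real (G i \<omega> * Q i \<omega>))"
      by (metis of_real_mult of_real_of_nat_eq of_real_sum)
    then show ?thesis
      by (simp only: mult.assoc[symmetric] sum_distrib_right)
  qed
  have grad: "complex_of_real (ev (grad_prod (hom_poly d a) (hom_poly d a)) \<omega>) * iexp (t * F \<omega>) =
      (\<Sum>i\<in>V. complex_of_real ((Q i \<omega>)\<^sup>2) * iexp (t * F \<omega>))" for \<omega>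
    by (simp add: at_vars_def grad_prod_hom_poly[OF assms assms] Q_def sum_distrib_right power2_eq_square)
  have "d * (CLINT \<omega>|M. complex_of_real (F \<omega>) * iexp (t * F \<omega>)) =
      (CLINT \<omega>|M. (\<Sum>i\<in>V. complex_of_real (G i \<omega> * Q i \<omega>) * iexp (t * F \<omega>)))"
    unfolding euler[symmetric] by simp
  also have "\<dots> = (\<Sum>i\<in>V. (CLINT \<omega>|M. complex_of_real (G i \<omega> * Q i \<omega>) * iexp (t * F \<omega>)))"
    using V by (intro Bochner_Integration.integral_sum integrable_mult_iexp all_moments_mult all_moments_G amQ)
      (auto intro: V(3))
  also have "\<dots> = (\<Sum>i\<in>V. \<i> * t * (CLINT \<omega>|M. complex_of_real ((Q i \<omega>)\<^sup>2) * iexp (t * F \<omega>)))"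
    by (intro sum.cong refl ibp)
  also have "\<dots> = \<i> * t * (\<Sum>i\<in>V. CLINT \<omega>|M. complex_of_real ((Q i \<omega>)\<^sup>2) * iexp (t * F \<omega>))"
    by (rule sum_distrib_left[symmetric])
  also have "(\<Sum>i\<in>V. CLINT \<omega>|M. complex_of_real ((Q i \<omega>)\<^sup>2) * iexp (t * F \<omega>)) =
      (CLINT \<omega>|M. (\<Sum>i\<in>V. complex_of_real ((Q i \<omega>)\<^sup>2) * iexp (t * F \<omega>)))"
    by (intro Bochner_Integration.integral_sum[symmetric] integrable_mult_iexp all_moments_power amQ) simp
  finally show ?thesis
    unfolding F_def[symmetric] grad .
qed

end

section \<open>Characteristic functions and the equivalence\<close>

text \<open>Depends only on the degrees, not on \<open>V\<close> or the coefficients, so the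
  estimates are uniform along a sequence.\<close>

definition component_const :: "nat \<Rightarrow> nat \<Rightarrow> real" where
  "component_const d k = (\<Sum>c\<le>k. (real c)\<^sup>2) * (8 ^ (d + k) * 2 ^ k)"

lemma component_const_nonneg: "component_const d k \<ge> 0"
  unfolding component_const_def by (intro mult_nonneg_nonneg sum_nonneg) auto

lemma (in prob_space) expectation_abs_le_sqrt:
  assumes "all_moments Z"
  shows "expectation (\<lambda>\<omega>. \<bar>Z \<omega>\<bar>) \<le> sqrt (expectation (\<lambda>\<omega>. (Z \<omega>)\<^sup>2))"
proof -
  have "integrable M (\<lambda>\<omega>. \<bar>Z \<omega>\<bar>)"
    using all_moments_integrable[OF assms] by simp
  moreover have "integrable M (\<lambda>\<omega>. (Z \<omega>)\<^sup>2)"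
    by (intro all_moments_integrable all_moments_intros assms)
  ultimately have "(expectation (\<lambda>\<omega>. \<bar>Z \<omega>\<bar>))\<^sup>2 \<le> expectation (\<lambda>\<omega>. (Z \<omega>)\<^sup>2)"
    using variance_positive[of "\<lambda>\<omega>. \<bar>Z \<omega>\<bar>"] variance_eq[of "\<lambda>\<omega>. \<bar>Z \<omega>\<bar>"] by simp
  then show ?thesis
    by (rule real_le_rsqrt)
qed

context gaussian_sequence
begin

lemma all_moments_grad_prod:
  assumes "supported V d a"
  shows "all_moments (ev (grad_prod (hom_poly d a) (hom_poly d a)))"
  unfolding at_vars_def grad_prod_hom_poly[OF assms assms] using supportedD(2)[OF assms]
  by (intro all_moments_intros all_moments_dpoly[unfolded at_vars_def])

text \<open>Stein's identity turns the left side into \<open>- s\<close> times the expectation of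
  \<open>(\<Gamma> / d - 1) iexp (s F)\<close>. The exponential has modulus 1, and the L1 norm is at
  most the L2 norm.\<close>

lemma char_deriv_add_bound:
  assumes a: "supported V d a" and "d \<ge> 1"
  shows "norm (\<i> * (CLINT \<omega>|M. complex_of_real (ev (hom_poly d a) \<omega>) * iexp (s * ev (hom_poly d a) \<omega>)) +
      s * (CLINT \<omega>|M. iexp (s * ev (hom_poly d a) \<omega>))) \<le>
    \<bar>s\<bar> * sqrt (expectation (\<lambda>\<omega>. (ev (grad_prod (hom_poly d a) (hom_poly d a)) \<omega> / d - 1)\<^sup>2))"
proof -
  define F where "F = ev (hom_poly d a)"
  define \<Gamma> where "\<Gamma> = ev (grad_prod (hom_poly d a) (hom_poly d a))"
  define Z where "Z \<omega> = \<Gamma> \<omega> / d - 1" for \<omega>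
  have am: "all_moments F" "all_moments \<Gamma>"
    unfolding F_def \<Gamma>_def using all_moments_hom_poly all_moments_grad_prod[OF a] by auto
  have amZ: "all_moments Z"
    unfolding Z_def divide_inverse by (intro all_moments_intros am)
  have [measurable]: "F \<in> borel_measurable M"
    using am by (simp add: all_moments_measurable)
  have int\<Gamma>: "integrable M (\<lambda>\<omega>. complex_of_real (\<Gamma> \<omega>) * iexp (s * F \<omega>))"
    by (intro integrable_mult_iexp am) simp
  have int1: "integrable M (\<lambda>\<omega>. iexp (s * F \<omega>))"
    using integrable_mult_iexp[OF all_moments_const[of 1], of "\<lambda>\<omega>. s * F \<omega>"] by simp
  have stein: "d * (CLINT \<omega>|M. complex_of_real (F \<omega>) * iexp (s * F \<omega>)) =
      \<i> * s * (CLINT \<omega>|M. complex_of_real (\<Gamma> \<omega>) * iexp (s * F \<omega>))"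
    unfolding F_def \<Gamma>_def by (rule stein_identity[OF a])
  have Z_eq: "(CLINT \<omega>|M. complex_of_real (Z \<omega>) * iexp (s * F \<omega>)) =
      (CLINT \<omega>|M. complex_of_real (\<Gamma> \<omega>) * iexp (s * F \<omega>)) / d - (CLINT \<omega>|M. iexp (s * F \<omega>))"
  proof -
    have "complex_of_real (Z \<omega>) * iexp (s * F \<omega>) =
        complex_of_real (\<Gamma> \<omega>) * iexp (s * F \<omega>) / d - iexp (s * F \<omega>)" for \<omega>
      by (simp add: Z_def field_simps)
    then show ?thesis
      using int\<Gamma> int1 by simp
  qed
  have "\<i> * (CLINT \<omega>|M. complex_of_real (F \<omega>) * iexp (s * F \<omega>)) + s * (CLINT \<omega>|M. iexp (s * F \<omega>)) =
      - s * (CLINT \<omega>|M. complex_of_real (Z \<omega>) * iexp (s * F \<omega>))" (is "?L = _")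
  proof -
    define A where "A = (CLINT \<omega>|M. complex_of_real (F \<omega>) * iexp (s * F \<omega>))"
    define B where "B = (CLINT \<omega>|M. complex_of_real (\<Gamma> \<omega>) * iexp (s * F \<omega>))"
    have "A = \<i> * s * B / d"
      using stein \<open>d \<ge> 1\<close> unfolding A_def[symmetric] B_def[symmetric] by (simp add: eq_divide_eq mult.commute)
    then show ?thesis
      unfolding Z_eq A_def[symmetric] B_def[symmetric]
      by (simp add: right_diff_distrib mult.assoc[symmetric])
  qed
  then have "norm ?L = \<bar>s\<bar> * norm (CLINT \<omega>|M. complex_of_real (Z \<omega>) * iexp (s * F \<omega>))"
    by (simp only: norm_mult norm_of_real abs_minus_cancel)
  also have "\<dots> \<le> \<bar>s\<bar> * (\<integral>\<omega>. norm (complex_of_real (Z \<omega>) * iexp (s * F \<omega>)) \<partial>M)"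
    by (intro mult_left_mono integral_norm_bound) simp
  also have "(\<integral>\<omega>. norm (complex_of_real (Z \<omega>) * iexp (s * F \<omega>)) \<partial>M) = expectation (\<lambda>\<omega>. \<bar>Z \<omega>\<bar>)"
    by (simp only: norm_mult norm_exp_i_times norm_of_real mult_1_right)
  also have "\<bar>s\<bar> * expectation (\<lambda>\<omega>. \<bar>Z \<omega>\<bar>) \<le> \<bar>s\<bar> * sqrt (expectation (\<lambda>\<omega>. (Z \<omega>)\<^sup>2))"
    by (intro mult_left_mono expectation_abs_le_sqrt amZ) simp
  finally show ?thesis
    unfolding F_def Z_def \<Gamma>_def .
qed

text \<open>
  The bound on \<open>\<phi>' s + s \<phi> s\<close> controls the derivative of \<open>exp (s\<^sup>2 / 2) \<phi> s\<close>, which is constant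
  exactly for the Gaussian characteristic function. The sign \<open>e\<close> treats both half-lines at once.
\<close>

lemma char_hom_poly_close:
  assumes a: "supported V d a" and "d \<ge> 1"
  shows "norm (char (distr M borel (ev (hom_poly d a))) t - complex_of_real (exp (- (t\<^sup>2) / 2))) \<le>
    sqrt (expectation (\<lambda>\<omega>. (ev (grad_prod (hom_poly d a) (hom_poly d a)) \<omega> / d - 1)\<^sup>2))"
    (is "_ \<le> ?\<delta>")
proof -
  define F where "F = ev (hom_poly d a)"
  define \<phi> where "\<phi> s = (CLINT \<omega>|M. iexp (s * F \<omega>))" for s
  define \<phi>' where "\<phi>' s = \<i> * (CLINT \<omega>|M. complex_of_real (F \<omega>) * iexp (s * F \<omega>))" for s
  have amF: "all_moments F" unfolding F_def by (rule all_moments_hom_poly)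
  have [measurable]: "F \<in> borel_measurable M" using amF by (rule all_moments_measurable)
  have char: "char (distr M borel F) s = \<phi> s" for s
    unfolding char_def \<phi>_def by (subst integral_distr) auto
  have deriv: "(\<phi> has_vector_derivative \<phi>' s) (at s)" for s
    unfolding \<phi>_def \<phi>'_def by (rule has_vector_derivative_char[OF amF])
  have bound: "norm (\<phi>' s + s * \<phi> s) \<le> \<bar>s\<bar> * ?\<delta>" for s
    unfolding \<phi>_def \<phi>'_def F_def by (rule char_deriv_add_bound[OF assms])
  have \<phi>0: "\<phi> 0 = 1"
    by (simp add: \<phi>_def prob_space)
  have \<delta>: "?\<delta> \<ge> 0" by simp
  have half: "norm (\<phi> (e * u) - complex_of_real (exp (- (u\<^sup>2) / 2))) \<le> ?\<delta>"
    if u: "u > 0" and e: "e = 1 \<or> e = - 1" for u e :: real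
  proof -
    define f where "f s = exp (s\<^sup>2 / 2) *\<^sub>R \<phi> (e * s)" for s
    have df: "(f has_vector_derivative
        exp (s\<^sup>2 / 2) *\<^sub>R (e *\<^sub>R \<phi>' (e * s)) + (s * exp (s\<^sup>2 / 2)) *\<^sub>R \<phi> (e * s)) (at s)" for s
    proof -
      have "((\<phi> \<circ> (\<lambda>s. e * s)) has_vector_derivative (e *\<^sub>R \<phi>' (e * s))) (at s)"
        by (rule vector_diff_chain_at[OF _ deriv]) (auto intro!: derivative_eq_intros)
      moreover have "((\<lambda>s. exp (s\<^sup>2 / 2)) has_real_derivative s * exp (s\<^sup>2 / 2)) (at s)"
        by (auto intro!: derivative_eq_intros)
      ultimately show ?thesis
        unfolding f_def comp_def by (intro has_vector_derivative_scaleR)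
    qed
    \<comment> \<open>Mean value inequality against the comparison function
      \<open>?\<delta> * exp (s^2 / 2)\<close>, whose derivative dominates the norm of the
      derivative of \<open>f\<close>.\<close>
    have "norm (f u - f 0) \<le> ?\<delta> * exp (u\<^sup>2 / 2) - ?\<delta> * exp (0\<^sup>2 / 2)"
    proof (rule differentiable_bound_general[OF u _ _ df])
      show "continuous_on {0..u} f"
        by (rule continuous_on_vector_derivative) (use df has_vector_derivative_at_within in blast)
      show "continuous_on {0..u} (\<lambda>s. ?\<delta> * exp (s\<^sup>2 / 2))"
        by (intro continuous_intros) auto
      show "((\<lambda>s. ?\<delta> * exp (s\<^sup>2 / 2)) has_vector_derivative ?\<delta> * (s * exp (s\<^sup>2 / 2))) (at s)" for s
        unfolding has_real_derivative_iff_has_vector_derivative[symmetric]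
        by (auto intro!: derivative_eq_intros)
      fix s :: real assume "0 < s"
      have ee: "e * e = 1" using e by auto
      have "exp (s\<^sup>2 / 2) *\<^sub>R (e *\<^sub>R \<phi>' (e * s)) + (s * exp (s\<^sup>2 / 2)) *\<^sub>R \<phi> (e * s) =
          (exp (s\<^sup>2 / 2) * e) *\<^sub>R (\<phi>' (e * s) + (e * s) *\<^sub>R \<phi> (e * s))"
      proof -
        have "(exp (s\<^sup>2 / 2) * e) * (e * s) = s * exp (s\<^sup>2 / 2)"
          using ee by (metis mult.assoc mult.commute mult_1)
        then show ?thesis
          by (simp only: scaleR_add_right scaleR_scaleR)
      qed
      then have "norm (exp (s\<^sup>2 / 2) *\<^sub>R (e *\<^sub>R \<phi>' (e * s)) + (s * exp (s\<^sup>2 / 2)) *\<^sub>R \<phi> (e * s)) =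
          exp (s\<^sup>2 / 2) * norm (\<phi>' (e * s) + (e * s) *\<^sub>R \<phi> (e * s))"
        using e by (auto simp: abs_mult)
      also have "\<dots> \<le> exp (s\<^sup>2 / 2) * (\<bar>e * s\<bar> * ?\<delta>)"
        using bound[of "e * s"] by (intro mult_left_mono) (auto simp: scaleR_conv_of_real)
      also have "\<bar>e * s\<bar> = s"
        using e \<open>0 < s\<close> by auto
      finally show "norm (exp (s\<^sup>2 / 2) *\<^sub>R (e *\<^sub>R \<phi>' (e * s)) + (s * exp (s\<^sup>2 / 2)) *\<^sub>R \<phi> (e * s)) \<le>
          ?\<delta> * (s * exp (s\<^sup>2 / 2))"
        by (simp add: mult_ac)
    qed
    also have "\<dots> \<le> ?\<delta> * exp (u\<^sup>2 / 2)"
      using \<delta> by simp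
    finally have le: "norm (f u - 1) \<le> ?\<delta> * exp (u\<^sup>2 / 2)"
      by (simp add: f_def \<phi>0)
    have "\<phi> (e * u) - complex_of_real (exp (- (u\<^sup>2) / 2)) = exp (- (u\<^sup>2) / 2) *\<^sub>R (f u - 1)"
    proof -
      have "exp (- (u\<^sup>2) / 2) * exp (u\<^sup>2 / 2) = 1"
        by (simp add: exp_add[symmetric])
      then show ?thesis
        by (simp only: f_def scaleR_diff_right scaleR_scaleR scaleR_one) (simp add: scaleR_conv_of_real)
    qed
    then have "norm (\<phi> (e * u) - complex_of_real (exp (- (u\<^sup>2) / 2))) = exp (- (u\<^sup>2) / 2) * norm (f u - 1)"
      by simp
    also have "\<dots> \<le> exp (- (u\<^sup>2) / 2) * (?\<delta> * exp (u\<^sup>2 / 2))"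
      using le by (intro mult_left_mono) auto
    also have "\<dots> = ?\<delta>"
      by (simp add: exp_minus)
    finally show ?thesis .
  qed
  have "norm (\<phi> t - complex_of_real (exp (- (t\<^sup>2) / 2))) \<le> ?\<delta>"
  proof (cases t "0 :: real" rule: linorder_cases)
    case less
    then show ?thesis using half[of "- t" "- 1"] by simp
  next
    case equal
    then show ?thesis using \<delta> by (simp add: \<phi>0)
  next
    case greater
    then show ?thesis using half[of t 1] by simp
  qed
  then show ?thesis
    unfolding char[symmetric] F_def .
qed

text \<open>Orders up to \<open>k\<close> are tested directly; higher orders follow by
  transposition. The square on \<open>\<epsilon>\<close> appears because
  \<open>contraction_bound\<close> measures squared norms.\<close>

lemma contraction_bound_of_rho_tilde:
  assumes a: "supported V d a" and k: "d div 2 \<le> k" "k \<le> d - 1"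
    and \<rho>: "rho_tilde M G k (hom_poly d a) \<le> ennreal \<epsilon>" and "\<epsilon> \<ge> 0" and r: "1 \<le> r" "r < d"
  shows "contraction_bound V d a r (\<epsilon>\<^sup>2)"
proof -
  have small: "contraction_bound V d a c (\<epsilon>\<^sup>2)" if c: "1 \<le> c" "c \<le> k" for c
  proof (rule contraction_bound_of_grad_prod_bound[OF a c])
    show "k \<le> d" using k by simp
    fix b assume b: "fin_coeffs k b" "expectation (\<lambda>\<omega>. (ev (hom_poly k b) \<omega>)\<^sup>2) \<le> 1"
    then have "L2_norm M (ev (hom_poly k b)) \<le> 1"
      by (simp add: L2_norm_def)
    with b have "ennreal (L2_norm M (ev (grad_prod (hom_poly d a) (hom_poly k b)))) \<le> ennreal \<epsilon>"
      by (intro order_trans[OF _ \<rho>]) (auto simp: rho_tilde_def intro!: SUP_upper)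
    then have "L2_norm M (ev (grad_prod (hom_poly d a) (hom_poly k b))) \<le> \<epsilon>"
      using \<open>\<epsilon> \<ge> 0\<close> by (simp add: ennreal_le_iff)
    then show "expectation (\<lambda>\<omega>. (ev (grad_prod (hom_poly d a) (hom_poly k b)) \<omega>)\<^sup>2) \<le> \<epsilon>\<^sup>2"
      unfolding L2_norm_def by (rule sqrt_le_D)
  qed
  show ?thesis
  proof (cases "r \<le> k")
    case True
    then show ?thesis using r by (intro small)
  next
    case False
    \<comment> \<open>Here \<open>r \<ge> k + 1\<close>, and \<open>d \<le> 2 * k + 1\<close>
      because \<open>k\<close> is at least the rounded-down half of \<open>d\<close>.\<close>
    then have "1 \<le> d - r" "d - r \<le> k" using r k by auto
    then have "contraction_bound V d a (d - r) (\<epsilon>\<^sup>2)"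
      by (rule small)
    then have "contraction_bound V d a (d - (d - r)) (\<epsilon>\<^sup>2)"
      by (rule contraction_bound_transpose) auto
    then show ?thesis using r by simp
  qed
qed

text \<open>The top term of the gradient product is \<open>d * Y_d = d\<close>, so dividing by
  \<open>d\<close> and subtracting 1 leaves exactly the components below \<open>d\<close>.\<close>

lemma grad_prod_deviation_le:
  assumes a: "supported V d a" and "d \<ge> 1" and norm: "(\<Sum>I\<in>nsets V d. (a I)\<^sup>2) = 1"
    and K: "K \<ge> 0" "\<And>c. 1 \<le> c \<Longrightarrow> c < d \<Longrightarrow> contraction_bound V d a c K"
  shows "expectation (\<lambda>\<omega>. (ev (grad_prod (hom_poly d a) (hom_poly d a)) \<omega> / d - 1)\<^sup>2) \<le>
    component_const d d * K"
proof -
  note V = supportedD(1,2)[OF a]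
  let ?S = "\<lambda>\<omega>. \<Sum>c\<in>{..d} - {d}. real c * ev (component V d d a a c) \<omega>"
  have eq: "ev (grad_prod (hom_poly d a) (hom_poly d a)) \<omega> / d - 1 = ?S \<omega> / d" for \<omega>
  proof -
    have "ev (grad_prod (hom_poly d a) (hom_poly d a)) \<omega> = (\<Sum>c\<le>d. real c * ev (component V d d a a c) \<omega>)"
      by (simp add: at_vars_def grad_prod_eq_sum_component[OF a a])
    also have "\<dots> = real d * ev (component V d d a a d) \<omega> + ?S \<omega>"
      by (rule sum.remove) auto
    also have "ev (component V d d a a d) \<omega> = 1"
      by (simp add: at_vars_def component_top[OF V(1)] norm)
    finally show ?thesis
      using \<open>d \<ge> 1\<close> by (simp add: field_simps)
  qed
  have "expectation (\<lambda>\<omega>. (ev (grad_prod (hom_poly d a) (hom_poly d a)) \<omega> / d - 1)\<^sup>2) =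
      expectation (\<lambda>\<omega>. (?S \<omega>)\<^sup>2) / (real d)\<^sup>2"
    unfolding eq by (simp add: power_divide)
  also have "\<dots> \<le> expectation (\<lambda>\<omega>. (?S \<omega>)\<^sup>2) / 1"
    using \<open>d \<ge> 1\<close> by (intro divide_left_mono) auto
  also have "\<dots> \<le> component_const d d * K"
    using lower_components_square_le[OF V, of d d K a a] K norm by (simp add: component_const_def)
  finally show ?thesis .
qed

text \<open>\<open>m\<close> is the fourth cumulant. The inner root turns the sum of squared
  Hilbert-Schmidt norms into a bound on squared operator norms, the outer one comes from the L2
  norm. The normalisation is assumed for every \<open>V\<close> because \<open>V\<close> must be
  enlarged by the variables of each test polynomial.\<close>

lemma rho_tilde_le:
  assumes a: "\<And>V. supported V d a \<Longrightarrow> (\<Sum>I\<in>nsets V d. (a I)\<^sup>2) = 1" "fin_coeffs d a" and "d \<ge> 1"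
  defines "m \<equiv> expectation (\<lambda>\<omega>. ev (hom_poly d a) \<omega> ^ 4) - 3"
  shows "m \<ge> 0" "rho_tilde M G (d - 1) (hom_poly d a) \<le> ennreal (sqrt (component_const d (d - 1) * sqrt m))"
proof -
  let ?T = "\<lambda>V r. \<Sum>R\<in>nsets V r. \<Sum>B\<in>nsets V r. (contraction V (d - r) a a R B)\<^sup>2"
  have T_nonneg: "?T V r \<ge> 0" for V r
    by (intro sum_nonneg) auto
  have m: "(\<Sum>r\<in>{1..<d}. ?T V r) \<le> m" if "supported V d a" for V
    using fourth_moment_ge[OF that \<open>d \<ge> 1\<close> a(1)[OF that]] by (simp add: m_def)
  obtain V0 where V0: "supported V0 d a"
    using a(2) by (rule fin_coeffs_supported)
  have "(\<Sum>r\<in>{1..<d}. ?T V0 r) \<ge> 0"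
    using T_nonneg by (rule sum_nonneg)
  with m[OF V0] show "m \<ge> 0" by linarith
  show "rho_tilde M G (d - 1) (hom_poly d a) \<le> ennreal (sqrt (component_const d (d - 1) * sqrt m))"
    unfolding rho_tilde_def
  proof (rule SUP_least)
    fix b assume "b \<in> {b. fin_coeffs (d - 1) b \<and> L2_norm M (ev (hom_poly (d - 1) b)) \<le> 1}"
    then have b: "fin_coeffs (d - 1) b" and b1: "L2_norm M (ev (hom_poly (d - 1) b)) \<le> 1" by auto
    obtain V1 where V1: "supported V1 (d - 1) b"
      using b by (rule fin_coeffs_supported)
    define V where "V = V0 \<union> V1"
    have V: "finite V" "V \<subseteq> {1..}"
      using supportedD(1,2)[OF V0] supportedD(1,2)[OF V1] by (auto simp: V_def)
    have aV: "supported V d a"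
      using V by (intro supported_superset[OF V0]) (auto simp: V_def)
    have bV: "supported V (d - 1) b"
      using V by (intro supported_superset[OF V1]) (auto simp: V_def)
    have bsum: "(\<Sum>J\<in>nsets V (d - 1). (b J)\<^sup>2) \<le> 1"
      using b1 unfolding L2_norm_def expectation_hom_poly_square[OF bV] by simp
    have bound: "contraction_bound V d a c (sqrt m)" if "1 \<le> c" "c < d" for c
    proof (rule contraction_bound_mono[OF contraction_bound_hilbert_schmidt])
      have "?T V c \<le> (\<Sum>r\<in>{1..<d}. ?T V r)"
        using that T_nonneg by (intro member_le_sum) auto
      then show "sqrt (?T V c) \<le> sqrt m"
        using m[OF aV] by simp
    qed
    have "expectation (\<lambda>\<omega>. (ev (grad_prod (hom_poly d a) (hom_poly (d - 1) b)) \<omega>)\<^sup>2) =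
        expectation (\<lambda>\<omega>. (\<Sum>c\<in>{..d - 1} - {d}. real c * ev (component V d (d - 1) a b c) \<omega>)\<^sup>2)"
    proof -
      \<comment> \<open>A test polynomial of degree below \<open>d\<close> cannot produce the
        uncontrolled component of order \<open>d\<close>.\<close>
      have "{..d - 1} - {d} = {..d - 1}" using \<open>d \<ge> 1\<close> by auto
      then show ?thesis
        unfolding at_vars_def by (simp only: grad_prod_eq_sum_component[OF aV bV diff_le_self])
    qed
    also have "\<dots> \<le> component_const d (d - 1) * sqrt m * (\<Sum>J\<in>nsets V (d - 1). (b J)\<^sup>2)"
      unfolding component_const_def
      by (rule lower_components_square_le[OF V]) (use \<open>m \<ge> 0\<close> bound in auto)
    also have "\<dots> \<le> component_const d (d - 1) * sqrt m * 1"
      using bsum \<open>m \<ge> 0\<close> component_const_nonneg by (intro mult_left_mono) auto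
    finally show "ennreal (L2_norm M (ev (grad_prod (hom_poly d a) (hom_poly (d - 1) b)))) \<le>
        ennreal (sqrt (component_const d (d - 1) * sqrt m))"
      unfolding L2_norm_def by (intro ennreal_leI real_sqrt_le_mono) simp
  qed
qed

text \<open>Weak convergence handles the bounded continuous truncation at \<open>L ^ 4\<close>;
  where \<open>\<bar>x\<bar> > L\<close>, the fourth power is at most \<open>x ^ 6 / L^2\<close>,
  controlled by the sixth moments.\<close>

lemma weak_conv_fourth_moment:
  fixes F :: "nat \<Rightarrow> 'a \<Rightarrow> real"
  assumes am: "\<And>n. all_moments (F n)" and six: "\<And>n. expectation (\<lambda>\<omega>. F n \<omega> ^ 6) \<le> B"
    and conv: "weak_conv_m (\<lambda>n. distr M borel (F n)) std_normal_distribution" and "e > 0"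
  shows "eventually (\<lambda>n. expectation (\<lambda>\<omega>. F n \<omega> ^ 4) < 3 + e) sequentially"
proof -
  note [measurable] = am[THEN all_moments_measurable]
  have int: "integrable M (\<lambda>\<omega>. F n \<omega> ^ k)" for n k
    by (intro all_moments_integrable all_moments_intros am)
  have "B \<ge> 0"
    using six[of 0] by (rule order_trans[rotated]) simp
  \<comment> \<open>Chosen so that \<open>B / L^2 \<le> e / 2\<close>; the added 1 keeps
    \<open>L\<close> positive when \<open>B = 0\<close>.\<close>
  define L where "L = sqrt (2 * B / e + 1)"
  have L2: "L\<^sup>2 = 2 * B / e + 1" and L: "L > 0"
    using \<open>B \<ge> 0\<close> \<open>e > 0\<close> by (auto simp: L_def add_nonneg_pos)
  let ?h = "\<lambda>x :: real. min (x ^ 4) (L ^ 4)"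
  have "(\<lambda>n. integral\<^sup>L (distr M borel (F n)) ?h) \<longlonglongrightarrow> integral\<^sup>L std_normal_distribution ?h"
  proof (rule weak_conv_imp_integral_bdd_continuous_conv[OF _ real_dist_normal_dist conv])
    show "real_distribution (distr M borel (F n))" for n
      by (rule real_distribution_distr) simp
    show "isCont ?h x" for x
      by (intro continuous_intros)
    show "norm (?h x) \<le> L ^ 4" for x by simp
  qed
  moreover have "integral\<^sup>L std_normal_distribution ?h \<le> 3"
  proof -
    have "integral\<^sup>L std_normal_distribution ?h \<le> integral\<^sup>L std_normal_distribution (\<lambda>x. x ^ 4)"
      by (rule integral_mono') (auto intro: integrable_std_normal_distribution_moment)
    also have "\<dots> = 3"
      using std_normal_distribution_even_moments(1)[of 2] by (simp add: fact_numeral)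
    finally show ?thesis .
  qed
  ultimately have "eventually (\<lambda>n. integral\<^sup>L (distr M borel (F n)) ?h < 3 + e / 2) sequentially"
    using \<open>e > 0\<close> by (intro order_tendstoD(2)) auto
  then show ?thesis
  proof eventually_elim
    case (elim n)
    have "expectation (\<lambda>\<omega>. F n \<omega> ^ 4) \<le> expectation (\<lambda>\<omega>. ?h (F n \<omega>) + F n \<omega> ^ 6 / L\<^sup>2)"
    proof (rule integral_mono)
      show "integrable M (\<lambda>\<omega>. ?h (F n \<omega>) + F n \<omega> ^ 6 / L\<^sup>2)"
        using int[of n 4] int[of n 6] by (intro Bochner_Integration.integrable_add integrable_min integrable_divide) auto
      fix \<omega>
      show "F n \<omega> ^ 4 \<le> ?h (F n \<omega>) + F n \<omega> ^ 6 / L\<^sup>2"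
      proof (cases "\<bar>F n \<omega>\<bar> \<le> L")
        case True
        then have "F n \<omega> ^ 4 \<le> L ^ 4"
          by (metis power_mono abs_ge_zero power_even_abs even_numeral)
        then show ?thesis by simp
      next
        case False
        then have "L\<^sup>2 \<le> (F n \<omega>)\<^sup>2"
          using L by (metis abs_of_pos abs_le_square_iff less_imp_le not_le)
        then have "F n \<omega> ^ 4 * L\<^sup>2 \<le> F n \<omega> ^ 4 * (F n \<omega>)\<^sup>2"
          by (intro mult_left_mono) auto
        then have "F n \<omega> ^ 4 \<le> F n \<omega> ^ 6 / L\<^sup>2"
          using L by (simp add: pos_le_divide_eq power_add[symmetric])
        moreover have "?h (F n \<omega>) \<ge> 0" by simp
        ultimately show ?thesis by linarith
      qed
    qed (rule int)
    also have "\<dots> = expectation (\<lambda>\<omega>. ?h (F n \<omega>)) + expectation (\<lambda>\<omega>. F n \<omega> ^ 6) / L\<^sup>2"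
      using int[of n 4] int[of n 6] by (subst Bochner_Integration.integral_add) auto
    also have "expectation (\<lambda>\<omega>. ?h (F n \<omega>)) = integral\<^sup>L (distr M borel (F n)) ?h"
      by (subst integral_distr) auto
    also have "expectation (\<lambda>\<omega>. F n \<omega> ^ 6) / L\<^sup>2 \<le> B / L\<^sup>2"
      using six by (intro divide_right_mono) auto
    also have "B / L\<^sup>2 \<le> e / 2"
      using \<open>B \<ge> 0\<close> \<open>e > 0\<close> unfolding L2 by (simp add: field_simps add_nonneg_pos)
    finally show ?case using elim by simp
  qed
qed

text \<open>Levy's continuity theorem. The set \<open>V\<close> varies with \<open>n\<close>, but
  the bound on the characteristic functions involves only \<open>d\<close> and
  \<open>\<epsilon>\<close>.\<close>

lemma weak_conv_of_rho_tilde: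
  assumes coeffs: "\<And>n. fin_coeffs d (a n)" and var: "\<And>n. expectation (\<lambda>\<omega>. (ev (hom_poly d (a n)) \<omega>)\<^sup>2) = 1"
    and "d \<ge> 1" and k: "k \<in> {d div 2..d - 1}"
    and lim: "(\<lambda>n. rho_tilde M G k (hom_poly d (a n))) \<longlonglongrightarrow> 0"
  shows "weak_conv_m (\<lambda>n. distr M borel (ev (hom_poly d (a n)))) std_normal_distribution"
proof (rule levy_continuity[OF _ real_dist_normal_dist])
  show "real_distribution (distr M borel (ev (hom_poly d (a n))))" for n
    by (intro real_distribution_distr all_moments_measurable all_moments_hom_poly)
  fix t
  show "(\<lambda>n. char (distr M borel (ev (hom_poly d (a n)))) t) \<longlonglongrightarrow> char std_normal_distribution t"
    unfolding char_std_normal_distribution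
  proof (rule tendstoI)
    fix e :: real assume "e > 0"
    let ?C = "sqrt (component_const d d)"
    have C: "?C \<ge> 0" using component_const_nonneg by simp
    \<comment> \<open>The added 1 avoids division by 0 and makes the later estimate strict.\<close>
    define \<epsilon> where "\<epsilon> = e / (?C + 1)"
    have \<epsilon>: "\<epsilon> > 0" using \<open>e > 0\<close> C by (simp add: \<epsilon>_def add_nonneg_pos)
    have C\<epsilon>: "?C * \<epsilon> < e"
    proof -
      have "?C * \<epsilon> < (?C + 1) * \<epsilon>" using \<epsilon> by simp
      also have "\<dots> = e" using add_nonneg_pos[OF C zero_less_one] by (simp add: \<epsilon>_def)
      finally show ?thesis .
    qed
    have "eventually (\<lambda>n. rho_tilde M G k (hom_poly d (a n)) < ennreal \<epsilon>) sequentially"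
      using \<epsilon> by (intro order_tendstoD(2)[OF lim]) simp
    then show "eventually (\<lambda>n. dist (char (distr M borel (ev (hom_poly d (a n)))) t)
        (complex_of_real (exp (- t\<^sup>2 / 2))) < e) sequentially"
    proof eventually_elim
      case (elim n)
      obtain V where V: "supported V d (a n)"
        using coeffs by (rule fin_coeffs_supported)
      have "contraction_bound V d (a n) c (\<epsilon>\<^sup>2)" if "1 \<le> c" "c < d" for c
        using k elim \<epsilon> that by (intro contraction_bound_of_rho_tilde[OF V, of k \<epsilon>]) auto
      moreover have "(\<Sum>I\<in>nsets V d. (a n I)\<^sup>2) = 1"
        using var[of n] expectation_hom_poly_square[OF V] by simp
      ultimately have le: "expectation (\<lambda>\<omega>. (ev (grad_prod (hom_poly d (a n)) (hom_poly d (a n))) \<omega> / d - 1)\<^sup>2) \<le>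
          component_const d d * \<epsilon>\<^sup>2"
        using \<open>d \<ge> 1\<close> by (intro grad_prod_deviation_le[OF V]) auto
      have "norm (char (distr M borel (ev (hom_poly d (a n)))) t - complex_of_real (exp (- (t\<^sup>2) / 2))) \<le>
          sqrt (component_const d d * \<epsilon>\<^sup>2)"
        using char_hom_poly_close[OF V \<open>d \<ge> 1\<close>] real_sqrt_le_mono[OF le] by (rule order_trans)
      also have "\<dots> = ?C * \<epsilon>"
        using \<epsilon> by (simp add: real_sqrt_mult)
      finally show ?case
        using C\<epsilon> by (simp add: dist_norm)
    qed
  qed
qed

text \<open>The sixth moments are bounded uniformly in \<open>n\<close>, so weak convergence bounds
  the fourth moments from above in the limit. The matching lower bound is \<open>m_nonneg\<close>,
  hence the fourth cumulants tend to 0.\<close>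

lemma rho_tilde_of_weak_conv:
  assumes coeffs: "\<And>n. fin_coeffs d (a n)" and var: "\<And>n. expectation (\<lambda>\<omega>. (ev (hom_poly d (a n)) \<omega>)\<^sup>2) = 1"
    and "d \<ge> 1"
    and conv: "weak_conv_m (\<lambda>n. distr M borel (ev (hom_poly d (a n)))) std_normal_distribution"
  shows "(\<lambda>n. rho_tilde M G (d - 1) (hom_poly d (a n))) \<longlonglongrightarrow> 0"
proof -
  define m where "m n = expectation (\<lambda>\<omega>. ev (hom_poly d (a n)) \<omega> ^ 4) - 3" for n
  have norm: "(\<Sum>I\<in>nsets V d. (a n I)\<^sup>2) = 1" if "supported V d (a n)" for V n
    using var[of n] expectation_hom_poly_square[OF that] by simp
  have m_nonneg: "m n \<ge> 0"
    and le: "rho_tilde M G (d - 1) (hom_poly d (a n)) \<le> ennreal (sqrt (component_const d (d - 1) * sqrt (m n)))" for n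
    unfolding m_def using rho_tilde_le[OF norm coeffs \<open>d \<ge> 1\<close>] by auto
  have six: "expectation (\<lambda>\<omega>. ev (hom_poly d (a n)) \<omega> ^ 6) \<le> (5 ^ d) ^ 3" for n
  proof -
    obtain V where V: "supported V d (a n)"
      using coeffs by (rule fin_coeffs_supported)
    show ?thesis
      using sixth_moment_hom_poly_le[OF V] norm[OF V] by simp
  qed
  have "m \<longlonglongrightarrow> 0"
  proof (rule tendstoI)
    fix e :: real assume "e > 0"
    with weak_conv_fourth_moment[OF all_moments_hom_poly six conv]
    have "eventually (\<lambda>n. expectation (\<lambda>\<omega>. ev (hom_poly d (a n)) \<omega> ^ 4) < 3 + e) sequentially" .
    then show "eventually (\<lambda>n. dist (m n) 0 < e) sequentially"
    proof eventually_elim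
      case (elim n)
      then show ?case using m_nonneg[of n] by (simp add: m_def)
    qed
  qed
  then have "(\<lambda>n. ennreal (sqrt (component_const d (d - 1) * sqrt (m n)))) \<longlonglongrightarrow>
      ennreal (sqrt (component_const d (d - 1) * sqrt 0))"
    by (intro tendsto_intros)
  then have "(\<lambda>n. ennreal (sqrt (component_const d (d - 1) * sqrt (m n)))) \<longlonglongrightarrow> 0"
    by simp
  then show ?thesis
    by (rule tendsto_sandwich[rotated 3, where f = "\<lambda>_. 0"]) (use le in \<open>auto intro: always_eventually\<close>)
qed

end

theorem theorem1p3:
  fixes M :: "'a measure"
    and G :: "nat \<Rightarrow> 'a \<Rightarrow> real"
    and d :: nat
    and a :: "nat \<Rightarrow> nat set \<Rightarrow> real"
  assumes "prob_space M"
    and "prob_space.indep_vars M (\<lambda>_. borel) G {1..}"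
    and "\<And>i. i \<ge> 1 \<Longrightarrow> distributed M lborel (G i) std_normal_density"
    and "d \<ge> 1"
    and "\<And>n. fin_coeffs d (a n)"
    and "\<And>n. (\<integral>\<omega>. (at_vars G (hom_poly d (a n)) \<omega>)\<^sup>2 \<partial>M) = 1"
  shows "weak_conv_m (\<lambda>n. distr M borel (at_vars G (hom_poly d (a n)))) std_normal_distribution
    \<longleftrightarrow> (\<exists>k\<in>{d div 2..d - 1}. (\<lambda>n. rho_tilde M G k (hom_poly d (a n))) \<longlonglongrightarrow> 0)"
proof -
  interpret gaussian_sequence M G
    using assms(1-3) by (intro gaussian_sequence.intro gaussian_sequence_axioms.intro)
  show ?thesis
  proof
    assume "weak_conv_m (\<lambda>n. distr M borel (at_vars G (hom_poly d (a n)))) std_normal_distribution"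
    then have "(\<lambda>n. rho_tilde M G (d - 1) (hom_poly d (a n))) \<longlonglongrightarrow> 0"
      by (rule rho_tilde_of_weak_conv[OF assms(5,6,4)])
    \<comment> \<open>The largest admissible \<open>k\<close> always serves as witness; for
      \<open>d = 1\<close> the range is just \<open>{0}\<close>.\<close>
    moreover have "d - 1 \<in> {d div 2..d - 1}"
      using \<open>d \<ge> 1\<close> by auto
    ultimately show "\<exists>k\<in>{d div 2..d - 1}. (\<lambda>n. rho_tilde M G k (hom_poly d (a n))) \<longlonglongrightarrow> 0"
      by blast
  next
    assume "\<exists>k\<in>{d div 2..d - 1}. (\<lambda>n. rho_tilde M G k (hom_poly d (a n))) \<longlonglongrightarrow> 0"
    then obtain k where "k \<in> {d div 2..d - 1}" "(\<lambda>n. rho_tilde M G k (hom_poly d (a n))) \<longlonglongrightarrow> 0"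
      by blast
    then show "weak_conv_m (\<lambda>n. distr M borel (at_vars G (hom_poly d (a n)))) std_normal_distribution"
      by (rule weak_conv_of_rho_tilde[OF assms(5,6,4)])
  qed
qed

end
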